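(* Let $\mathcal S$ be a triangulated category with a very good metric $\{\mathcal M_i,\ i\in\mathbb N\}$, let $F:\mathcal S\to\mathcal T$ be a good extension with respect to the metric, and assume that each $\mathcal M_i$ is closed in $\mathcal S$ under direct summands. Then the metric $\{\mathcal M_i,\ i\in\mathbb N\}$ is excellent if and only if, for every integer $m>0$, there exists an integer $n>0$ such that every object $B\in\mathcal S$ admits, in the category $\mathfrak L'(\mathcal S)\subset\mathcal T$, a distinguished triangle $A\to F(B)\to C\to\Sigma A$ with $C\in\mathfrak S(\mathcal S)\cap(\mathcal L'_n)^\perp$ and $A\in\mathcal L'_m$. (Here $\mathfrak S(\mathcal S)$ is viewed as a subcategory of $\mathfrak L'(\mathcal S)$ as explained in the context.)
   Context: Conventions: subcategories are full; $\Sigma$ is the shift; $\mathcal A*\mathcal B$ is the class of $b$ admitting a distinguished triangle $a\to b\to c\to\Sigma a$ with $a\in\mathcal A,c\in\mathcal B$; $\mathcal A^\perp=\{b:\mathrm{Hom}(a,b)=0\ \forall a\in\mathcal A\}$, ${}^\perp\mathcal A=\{b:\mathrm{Hom}(b,a)=0\ \forall a\in\mathcal A\}$. Good metric on a triangulated category $\mathcal S$: full subcategories $\{\mathcal M_i,\ i\in\mathbb N\}$ with $0\in\mathcal M_i$, $\Sigma^{-1}\mathcal M_{i+1}\cup\mathcal M_{i+1}\cup\Sigma\mathcal M_{i+1}\subset\mathcal M_i$ and $\mathcal M_i*\mathcal M_i\subset\mathcal M_i$. A sequence $E_1\to E_2\to\cdots$ in $\mathcal S$ is Cauchy if for every $i$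 there is $N$ such that for all $k>j\ge N$ the cone of $E_j\to E_k$ lies in $\mathcal M_i$. $\mathrm{Mod}\text{-}\mathcal S$ is the category of additive functors $\mathcal S^{op}\to\mathrm{Ab}$ and $Y$ the Yoneda embedding. $\mathfrak L(\mathcal S)\subset\mathrm{Mod}\text{-}\mathcal S$ is the full subcategory of objects isomorphic to $\mathrm{colim}\,Y(E_* )$, $E_*$ Cauchy; $\mathfrak C(\mathcal S)=\bigcup_iY(\mathcal M_i)^\perp$; $\mathfrak S(\mathcal S)=\mathfrak L(\mathcal S)\cap\mathfrak C(\mathcal S)$; $\mathcal L_i\subset\mathfrak L(\mathcal S)$ is the full subcategory of objects isomorphic to $\mathrm{colim}\,Y(E_* )$ with $E_*$ Cauchy and contained in $\mathcal M_i$. Type-$n$ morphisms: let $A=\mathrm{colim}\,Y(a_* )$, $B=\mathrm{colim}\,Y(b_* )$ with $a_*,b_*$ Cauchy in $\mathcal S$. A morphism $G:A\to B$ is of type-$n$ with respect to $(a_*,b_* )$ if there are subsequences $a'_*$ of $a_*$ and $b'_*$ of $b_*$ and a map of sequences $f_*:a'_*\to b'_*$ with $G=\mathrm{colim}\,Y(f_* )$ and with the cone of $f_i$ in $\mathcal M_n$ for all $i\gg0$. A good metric is very good if: (a) $\mathcal S=\bigcup_{i}{}^\perp\mathcal M_i$; (b) for every $m\in\mathbb N$ there is $n>m$ such that every $F\in\mathcal S$ admits a distinguished triangle $E\to F\to D\to\Sigma E$ in $\mathcal S$ with $E\in{}^\perp\mathcal M_n$ and $D\in\mathcal M_m$. It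 is excellent if it satisfies (a), (b) and (c): for every $m\in\mathbb N$ there is $n>m$ such that for every $F\in\mathcal S$ there exist a Cauchy sequence $d_*$ in $\mathcal S$ with $D=\mathrm{colim}\,Y(d_* )\in\mathfrak S(\mathcal S)\cap\mathcal L_n^\perp$ and a morphism $Y(F)\to D$ of type-$m$ with respect to $(F,d_* )$, where $F$ denotes the constant sequence. Let $F:\mathcal S\to\mathcal T$ be a fully faithful triangulated functor; $\mathcal Y:\mathcal T\to\mathrm{Mod}\text{-}\mathcal S$ is $\mathcal Y(t)=\mathrm{Hom}_{\mathcal T}(F(-),t)$. $F$ is a good extension with respect to the metric if for every Cauchy sequence $a_*$ in $\mathcal S$ the coproduct $\coprod_iF(a_i)$ exists in $\mathcal T$, and the natural map $\mathrm{colim}\,Y(a_* )\to\mathcal Y\big(\mathrm{Hocolim}\,F(a_* )\big)$ is an isomorphism, where $\mathrm{Hocolim}\,F(a_* )$ is the third object of a distinguished triangle on $\mathrm{id}-\mathrm{shift}:\coprod_iF(a_i)\to\coprod_iF(a_i)$. $\mathfrak L'(\mathcal S)\subset\mathcal T$ is the full subcategory of objects isomorphic to $\mathrm{Hocolim}\,F(a_* )$, $a_*$ Cauchy in $\mathcal S$, and $\mathcal L'_i\subset\mathfrak L'(\mathcal S)$ that of objects isomorphic to such with $a_*$ contained in $\mathcal M_i$. Under the hypotheses of the claim, $\mathfrak L'(\mathcal S)$ is a triangulated subcategory of $\mathcal T$. The functor $\mathcal Y$ restricts to an equivalence $\mathfrak L'(\mathcal S)\cap\mathcal Y^{-1}(\mathfrak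 C(\mathcal S))\to\mathfrak S(\mathcal S)$ (earlier work), and via it $\mathfrak S(\mathcal S)$ is identified with the full subcategory $\mathfrak L'(\mathcal S)\cap\mathcal Y^{-1}(\mathfrak C(\mathcal S))$ of $\mathfrak L'(\mathcal S)$. *)

theory Defs
  imports "HOL-Algebra.Group"
begin

section \<open>Preadditive categories\<close>

text \<open>
  The hom-set from \<open>a\<close> to \<open>b\<close> is an abelian group \<open>Hom C a b\<close>. Abelian groups are
  \<open>comm_group\<close>s throughout, hence written multiplicatively: \<open>\<otimes>\<close> is the sum of two parallel
  morphisms, \<open>\<one>\<close> the zero morphism and \<open>inv\<close> the negative. Hom-sets of distinct pairs of objects
  are disjoint, so that composition and functors need no object arguments on morphisms.
\<close>

record ('o, 'm) precat =
  Ob :: "'o set"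
  Hom :: "'o \<Rightarrow> 'o \<Rightarrow> 'm monoid"
  Id :: "'o \<Rightarrow> 'm"
  cmp :: "'m \<Rightarrow> 'm \<Rightarrow> 'm"  (infixl \<open>\<cdot>\<index>\<close> 75)

abbreviation Mor :: "('o, 'm, 'x) precat_scheme \<Rightarrow> 'o \<Rightarrow> 'o \<Rightarrow> 'm set" where
  "Mor C a b \<equiv> carrier (Hom C a b)"

abbreviation zero_mor :: "('o, 'm, 'x) precat_scheme \<Rightarrow> 'o \<Rightarrow> 'o \<Rightarrow> 'm" where
  "zero_mor C a b \<equiv> \<one>\<^bsub>Hom C a b\<^esub>"

abbreviation neg_mor :: "('o, 'm, 'x) precat_scheme \<Rightarrow> 'o \<Rightarrow> 'o \<Rightarrow> 'm \<Rightarrow> 'm" where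
  "neg_mor C a b f \<equiv> inv\<^bsub>Hom C a b\<^esub> f"

locale preadditive_category =
  fixes C :: "('o, 'm, 'x) precat_scheme" (structure)
  assumes hom_comm_group: "\<lbrakk>a \<in> Ob C; b \<in> Ob C\<rbrakk> \<Longrightarrow> comm_group (Hom C a b)"
    and hom_disjoint:
      "\<lbrakk>a \<in> Ob C; b \<in> Ob C; a' \<in> Ob C; b' \<in> Ob C; f \<in> Mor C a b; f \<in> Mor C a' b'\<rbrakk>
        \<Longrightarrow> a = a' \<and> b = b'"
    and id_mor: "a \<in> Ob C \<Longrightarrow> Id C a \<in> Mor C a a"
    and cmp_mor:
      "\<lbrakk>a \<in> Ob C; b \<in> Ob C; c \<in> Ob C; f \<in> Mor C a b; g \<in> Mor C b c\<rbrakk> \<Longrightarrow> g \<cdot> f \<in> Mor C a c"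
    and id_left: "\<lbrakk>a \<in> Ob C; b \<in> Ob C; f \<in> Mor C a b\<rbrakk> \<Longrightarrow> Id C b \<cdot> f = f"
    and id_right: "\<lbrakk>a \<in> Ob C; b \<in> Ob C; f \<in> Mor C a b\<rbrakk> \<Longrightarrow> f \<cdot> Id C a = f"
    and cmp_assoc:
      "\<lbrakk>a \<in> Ob C; b \<in> Ob C; c \<in> Ob C; d \<in> Ob C; f \<in> Mor C a b; g \<in> Mor C b c; h \<in> Mor C c d\<rbrakk>
        \<Longrightarrow> (h \<cdot> g) \<cdot> f = h \<cdot> (g \<cdot> f)"
    and cmp_add_left:
      "\<lbrakk>a \<in> Ob C; b \<in> Ob C; c \<in> Ob C; f \<in> Mor C a b; g \<in> Mor C b c; g' \<in> Mor C b c\<rbrakk>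
        \<Longrightarrow> (g \<otimes>\<^bsub>Hom C b c\<^esub> g') \<cdot> f = (g \<cdot> f) \<otimes>\<^bsub>Hom C a c\<^esub> (g' \<cdot> f)"
    and cmp_add_right:
      "\<lbrakk>a \<in> Ob C; b \<in> Ob C; c \<in> Ob C; f \<in> Mor C a b; f' \<in> Mor C a b; g \<in> Mor C b c\<rbrakk>
        \<Longrightarrow> g \<cdot> (f \<otimes>\<^bsub>Hom C a b\<^esub> f') = (g \<cdot> f) \<otimes>\<^bsub>Hom C a c\<^esub> (g \<cdot> f')"

definition is_zero_object :: "('o, 'm, 'x) precat_scheme \<Rightarrow> 'o \<Rightarrow> bool" where
  "is_zero_object C z \<longleftrightarrow> z \<in> Ob C \<and> Id C z = zero_mor C z z"

definition is_iso :: "('o, 'm, 'x) precat_scheme \<Rightarrow> 'o \<Rightarrow> 'o \<Rightarrow> 'm \<Rightarrow> bool" where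
  "is_iso C a b f \<longleftrightarrow> f \<in> Mor C a b \<and>
     (\<exists>g \<in> Mor C b a. g \<cdot>\<^bsub>C\<^esub> f = Id C a \<and> f \<cdot>\<^bsub>C\<^esub> g = Id C b)"

definition isomorphic :: "('o, 'm, 'x) precat_scheme \<Rightarrow> 'o \<Rightarrow> 'o \<Rightarrow> bool" where
  "isomorphic C a b \<longleftrightarrow> (\<exists>f. is_iso C a b f)"

definition is_biproduct :: "('o, 'm, 'x) precat_scheme \<Rightarrow> 'o \<Rightarrow> 'o \<Rightarrow> 'o \<Rightarrow> bool" where
  "is_biproduct C a b s \<longleftrightarrow> s \<in> Ob C \<and>
     (\<exists>i \<in> Mor C a s. \<exists>j \<in> Mor C b s. \<exists>p \<in> Mor C s a. \<exists>q \<in> Mor C s b.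
        p \<cdot>\<^bsub>C\<^esub> i = Id C a \<and> q \<cdot>\<^bsub>C\<^esub> j = Id C b \<and>
        p \<cdot>\<^bsub>C\<^esub> j = zero_mor C b a \<and> q \<cdot>\<^bsub>C\<^esub> i = zero_mor C a b \<and>
        (i \<cdot>\<^bsub>C\<^esub> p) \<otimes>\<^bsub>Hom C s s\<^esub> (j \<cdot>\<^bsub>C\<^esub> q) = Id C s)"

locale additive_category = preadditive_category +
  assumes zero_object: "\<exists>z. is_zero_object C z"
    and biproducts: "\<lbrakk>a \<in> Ob C; b \<in> Ob C\<rbrakk> \<Longrightarrow> \<exists>s. is_biproduct C a b s"

text \<open>Right and left orthogonals of a full subcategory.\<close>

definition perp_right :: "('o, 'm, 'x) precat_scheme \<Rightarrow> 'o set \<Rightarrow> 'o set" where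
  "perp_right C X = {b \<in> Ob C. \<forall>a \<in> X. Mor C a b = {zero_mor C a b}}"

definition perp_left :: "('o, 'm, 'x) precat_scheme \<Rightarrow> 'o set \<Rightarrow> 'o set" where
  "perp_left C X = {b \<in> Ob C. \<forall>a \<in> X. Mor C b a = {zero_mor C b a}}"

definition closed_under_summands :: "('o, 'm, 'x) precat_scheme \<Rightarrow> 'o set \<Rightarrow> bool" where
  "closed_under_summands C X \<longleftrightarrow>
     (\<forall>a \<in> Ob C. \<forall>b \<in> Ob C. \<forall>s \<in> X. is_biproduct C a b s \<longrightarrow> a \<in> X \<and> b \<in> X)"


section \<open>Functors\<close>

record ('o, 'm, 'p, 'n) fctr =
  Fo :: "'o \<Rightarrow> 'p"
  Fm :: "'m \<Rightarrow> 'n"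

definition additive_functor ::
  "('o, 'm, 'x) precat_scheme \<Rightarrow> ('p, 'n, 'y) precat_scheme \<Rightarrow> ('o, 'm, 'p, 'n) fctr \<Rightarrow> bool" where
  "additive_functor C D F \<longleftrightarrow>
     (\<forall>a \<in> Ob C. Fo F a \<in> Ob D \<and> Fm F (Id C a) = Id D (Fo F a)) \<and>
     (\<forall>a \<in> Ob C. \<forall>b \<in> Ob C. Fm F \<in> hom (Hom C a b) (Hom D (Fo F a) (Fo F b))) \<and>
     (\<forall>a \<in> Ob C. \<forall>b \<in> Ob C. \<forall>c \<in> Ob C. \<forall>f \<in> Mor C a b. \<forall>g \<in> Mor C b c.
        Fm F (g \<cdot>\<^bsub>C\<^esub> f) = Fm F g \<cdot>\<^bsub>D\<^esub> Fm F f)"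

definition fully_faithful ::
  "('o, 'm, 'x) precat_scheme \<Rightarrow> ('p, 'n, 'y) precat_scheme \<Rightarrow> ('o, 'm, 'p, 'n) fctr \<Rightarrow> bool" where
  "fully_faithful C D F \<longleftrightarrow>
     (\<forall>a \<in> Ob C. \<forall>b \<in> Ob C. bij_betw (Fm F) (Mor C a b) (Mor D (Fo F a) (Fo F b)))"

definition essentially_surjective ::
  "('o, 'm, 'x) precat_scheme \<Rightarrow> ('p, 'n, 'y) precat_scheme \<Rightarrow> ('o, 'm, 'p, 'n) fctr \<Rightarrow> bool" where
  "essentially_surjective C D F \<longleftrightarrow> (\<forall>d \<in> Ob D. \<exists>c \<in> Ob C. isomorphic D (Fo F c) d)"


section \<open>Triangulated categories\<close>

text \<open>
  The tuple \<open>(a, b, c, f, g, h)\<close> in \<open>Tri C\<close> is the distinguished triangle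
  \<open>a \<longrightarrow> b \<longrightarrow> c \<longrightarrow> \<Sigma> a\<close> with maps \<open>f\<close>, \<open>g\<close>, \<open>h\<close>. The shift is only required to be an
  autoequivalence; automorphisms are a special case.
\<close>

record ('o, 'm) tricat = "('o, 'm) precat" +
  Sh :: "('o, 'm, 'o, 'm) fctr"
  Tri :: "('o \<times> 'o \<times> 'o \<times> 'm \<times> 'm \<times> 'm) set"

locale triangulated_category = additive_category C
  for C :: "('o, 'm, 'x) tricat_scheme" (structure) +
  assumes shift_functor: "additive_functor C C (Sh C)"
    and shift_fully_faithful: "fully_faithful C C (Sh C)"
    and shift_essentially_surjective: "essentially_surjective C C (Sh C)"
    and tri_mor:
      "(a, b, c, f, g, h) \<in> Tri C \<Longrightarrow> a \<in> Ob C \<and> b \<in> Ob C \<and> c \<in> Ob C \<and>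
         f \<in> Mor C a b \<and> g \<in> Mor C b c \<and> h \<in> Mor C c (Fo (Sh C) a)"
    and tri_iso_closed:
      "\<lbrakk>(a, b, c, f, g, h) \<in> Tri C; a' \<in> Ob C; b' \<in> Ob C; c' \<in> Ob C;
        f' \<in> Mor C a' b'; g' \<in> Mor C b' c'; h' \<in> Mor C c' (Fo (Sh C) a');
        is_iso C a a' u; is_iso C b b' v; is_iso C c c' w;
        v \<cdot> f = f' \<cdot> u; w \<cdot> g = g' \<cdot> v; Fm (Sh C) u \<cdot> h = h' \<cdot> w\<rbrakk>
        \<Longrightarrow> (a', b', c', f', g', h') \<in> Tri C"
    and tri_id:
      "\<lbrakk>a \<in> Ob C; is_zero_object C z\<rbrakk>
        \<Longrightarrow> (a, a, z, Id C a, zero_mor C a z, zero_mor C z (Fo (Sh C) a)) \<in> Tri C"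
    and tri_cone:
      "\<lbrakk>a \<in> Ob C; b \<in> Ob C; f \<in> Mor C a b\<rbrakk> \<Longrightarrow> \<exists>c g h. (a, b, c, f, g, h) \<in> Tri C"
    and tri_rotate:
      "\<lbrakk>a \<in> Ob C; b \<in> Ob C; c \<in> Ob C; f \<in> Mor C a b; g \<in> Mor C b c; h \<in> Mor C c (Fo (Sh C) a)\<rbrakk>
        \<Longrightarrow> (a, b, c, f, g, h) \<in> Tri C \<longleftrightarrow>
          (b, c, Fo (Sh C) a, g, h, neg_mor C (Fo (Sh C) a) (Fo (Sh C) b) (Fm (Sh C) f)) \<in> Tri C"
    and tri_morphism:
      "\<lbrakk>(a, b, c, f, g, h) \<in> Tri C; (a', b', c', f', g', h') \<in> Tri C;
        u \<in> Mor C a a'; v \<in> Mor C b b'; v \<cdot> f = f' \<cdot> u\<rbrakk>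
        \<Longrightarrow> \<exists>w \<in> Mor C c c'. w \<cdot> g = g' \<cdot> v \<and> Fm (Sh C) u \<cdot> h = h' \<cdot> w"
    and tri_octahedral:
      "\<lbrakk>(a, b, d, f, p, p') \<in> Tri C; (b, c, e', g, q, q') \<in> Tri C; (a, c, e, g \<cdot> f, r, r') \<in> Tri C\<rbrakk>
        \<Longrightarrow> \<exists>u v. (d, e, e', u, v, Fm (Sh C) p \<cdot> q') \<in> Tri C \<and>
              u \<cdot> p = r \<cdot> g \<and> r' \<cdot> u = p' \<and> v \<cdot> r = q \<and> q' \<cdot> v = Fm (Sh C) f \<cdot> r'"

text \<open>The class \<open>X * Y\<close> of extensions.\<close>

definition ext_class :: "('o, 'm, 'x) tricat_scheme \<Rightarrow> 'o set \<Rightarrow> 'o set \<Rightarrow> 'o set" where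
  "ext_class C X Y = {b. \<exists>a \<in> X. \<exists>c \<in> Y. \<exists>f g h. (a, b, c, f, g, h) \<in> Tri C}"

definition cone_in :: "('o, 'm, 'x) tricat_scheme \<Rightarrow> 'o set \<Rightarrow> 'o \<Rightarrow> 'o \<Rightarrow> 'm \<Rightarrow> bool" where
  "cone_in C X a b f \<longleftrightarrow> (\<exists>c \<in> X. \<exists>g h. (a, b, c, f, g, h) \<in> Tri C)"

text \<open>
  A triangulated functor is a pair consisting of an additive functor \<open>F\<close> and a natural
  isomorphism \<open>\<phi>\<close> from \<open>F \<Sigma>\<close> to \<open>\<Sigma> F\<close>.
\<close>

definition triangulated_functor ::
  "('o, 'm, 'x) tricat_scheme \<Rightarrow> ('p, 'n, 'y) tricat_scheme \<Rightarrow> ('o, 'm, 'p, 'n) fctr \<Rightarrow>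
     ('o \<Rightarrow> 'n) \<Rightarrow> bool" where
  "triangulated_functor S T F \<phi> \<longleftrightarrow> additive_functor S T F \<and>
     (\<forall>a \<in> Ob S. is_iso T (Fo F (Fo (Sh S) a)) (Fo (Sh T) (Fo F a)) (\<phi> a)) \<and>
     (\<forall>a \<in> Ob S. \<forall>b \<in> Ob S. \<forall>f \<in> Mor S a b.
        \<phi> b \<cdot>\<^bsub>T\<^esub> Fm F (Fm (Sh S) f) = Fm (Sh T) (Fm F f) \<cdot>\<^bsub>T\<^esub> \<phi> a) \<and>
     (\<forall>a b c f g h. (a, b, c, f, g, h) \<in> Tri S \<longrightarrow>
        (Fo F a, Fo F b, Fo F c, Fm F f, Fm F g, \<phi> a \<cdot>\<^bsub>T\<^esub> Fm F h) \<in> Tri T)"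


section \<open>Sequences and good metrics\<close>

text \<open>A sequence consists of objects \<open>E i\<close> and maps \<open>e i\<close> from \<open>E i\<close> to \<open>E (Suc i)\<close>.\<close>

definition is_seq :: "('o, 'm, 'x) precat_scheme \<Rightarrow> (nat \<Rightarrow> 'o) \<Rightarrow> (nat \<Rightarrow> 'm) \<Rightarrow> bool" where
  "is_seq C E e \<longleftrightarrow> (\<forall>i. E i \<in> Ob C \<and> e i \<in> Mor C (E i) (E (Suc i)))"

primrec transit_add ::
  "('o, 'm, 'x) precat_scheme \<Rightarrow> (nat \<Rightarrow> 'o) \<Rightarrow> (nat \<Rightarrow> 'm) \<Rightarrow> nat \<Rightarrow> nat \<Rightarrow> 'm" where
  "transit_add C E e j 0 = Id C (E j)"
| "transit_add C E e j (Suc n) = e (j + n) \<cdot>\<^bsub>C\<^esub> transit_add C E e j n"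

text \<open>The composite \<open>E j \<longrightarrow> E k\<close>, meaningful for \<open>j \<le> k\<close>.\<close>

definition transit ::
  "('o, 'm, 'x) precat_scheme \<Rightarrow> (nat \<Rightarrow> 'o) \<Rightarrow> (nat \<Rightarrow> 'm) \<Rightarrow> nat \<Rightarrow> nat \<Rightarrow> 'm" where
  "transit C E e j k = transit_add C E e j (k - j)"

definition good_metric :: "('o, 'm, 'x) tricat_scheme \<Rightarrow> (nat \<Rightarrow> 'o set) \<Rightarrow> bool" where
  "good_metric S M \<longleftrightarrow>
     (\<forall>i. M i \<subseteq> Ob S \<and> (\<exists>z \<in> M i. is_zero_object S z) \<and>
          {x \<in> Ob S. Fo (Sh S) x \<in> M (Suc i)} \<union> M (Suc i) \<union> Fo (Sh S) ` M (Suc i) \<subseteq> M i \<and>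
          ext_class S (M i) (M i) \<subseteq> M i)"

definition cauchy ::
  "('o, 'm, 'x) tricat_scheme \<Rightarrow> (nat \<Rightarrow> 'o set) \<Rightarrow> (nat \<Rightarrow> 'o) \<Rightarrow> (nat \<Rightarrow> 'm) \<Rightarrow> bool" where
  "cauchy S M E e \<longleftrightarrow> is_seq S E e \<and>
     (\<forall>i. \<exists>N. \<forall>j k. N \<le> j \<and> j < k \<longrightarrow> cone_in S (M i) (E j) (E k) (transit S E e j k))"


section \<open>Modules over a preadditive category\<close>

text \<open>
  An object of \<open>Mod-S\<close> is an additive functor from the opposite of \<open>S\<close> to abelian groups. The
  type \<open>'g\<close> of group elements is a parameter, and morphisms are allowed between modules over
  different element types, so that representable modules, colimits of representables and modules
  coming from a larger category can be compared.
\<close>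

record ('o, 'm, 'g) cmod =
  at :: "'o \<Rightarrow> 'g monoid"
  act :: "'m \<Rightarrow> 'g \<Rightarrow> 'g"

definition Modules :: "('o, 'm, 'x) precat_scheme \<Rightarrow> ('o, 'm, 'g) cmod set" where
  "Modules S = {A.
     (\<forall>x \<in> Ob S. comm_group (at A x)) \<and>
     (\<forall>x \<in> Ob S. \<forall>y \<in> Ob S. \<forall>f \<in> Mor S x y. act A f \<in> hom (at A y) (at A x)) \<and>
     (\<forall>x \<in> Ob S. \<forall>u \<in> carrier (at A x). act A (Id S x) u = u) \<and>
     (\<forall>x \<in> Ob S. \<forall>y \<in> Ob S. \<forall>z \<in> Ob S. \<forall>f \<in> Mor S x y. \<forall>g \<in> Mor S y z.
        \<forall>u \<in> carrier (at A z). act A (g \<cdot>\<^bsub>S\<^esub> f) u = act A f (act A g u)) \<and>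
     (\<forall>x \<in> Ob S. \<forall>y \<in> Ob S. \<forall>f \<in> Mor S x y. \<forall>f' \<in> Mor S x y. \<forall>u \<in> carrier (at A y).
        act A (f \<otimes>\<^bsub>Hom S x y\<^esub> f') u = act A f u \<otimes>\<^bsub>at A x\<^esub> act A f' u)}"

definition mod_hom ::
  "('o, 'm, 'x) precat_scheme \<Rightarrow> ('o, 'm, 'g) cmod \<Rightarrow> ('o, 'm, 'h) cmod \<Rightarrow> ('o \<Rightarrow> 'g \<Rightarrow> 'h) set" where
  "mod_hom S A B = {\<eta>.
     (\<forall>x \<in> Ob S. \<eta> x \<in> hom (at A x) (at B x)) \<and>
     (\<forall>x \<in> Ob S. \<forall>y \<in> Ob S. \<forall>f \<in> Mor S x y. \<forall>u \<in> carrier (at A y).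
        \<eta> x (act A f u) = act B f (\<eta> y u))}"

definition mod_iso ::
  "('o, 'm, 'x) precat_scheme \<Rightarrow> ('o, 'm, 'g) cmod \<Rightarrow> ('o, 'm, 'h) cmod \<Rightarrow> ('o \<Rightarrow> 'g \<Rightarrow> 'h) set" where
  "mod_iso S A B = {\<eta> \<in> mod_hom S A B. \<forall>x \<in> Ob S. \<eta> x \<in> iso (at A x) (at B x)}"

definition mod_hom_trivial ::
  "('o, 'm, 'x) precat_scheme \<Rightarrow> ('o, 'm, 'g) cmod \<Rightarrow> ('o, 'm, 'h) cmod \<Rightarrow> bool" where
  "mod_hom_trivial S A B \<longleftrightarrow>
     (\<forall>\<eta> \<in> mod_hom S A B. \<forall>x \<in> Ob S. \<forall>u \<in> carrier (at A x). \<eta> x u = \<one>\<^bsub>at B x\<^esub>)"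

definition yoneda :: "('o, 'm, 'x) precat_scheme \<Rightarrow> 'o \<Rightarrow> ('o, 'm, 'm) cmod" where
  "yoneda S s = \<lparr>at = \<lambda>x. Hom S x s, act = \<lambda>f u. u \<cdot>\<^bsub>S\<^esub> f\<rparr>"

text \<open>The restricted Yoneda functor, \<open>t \<mapsto> Hom(F(-), t)\<close>.\<close>

definition restricted_yoneda ::
  "('p, 'n, 'y) precat_scheme \<Rightarrow> ('o, 'm, 'p, 'n) fctr \<Rightarrow> 'p \<Rightarrow> ('o, 'm, 'n) cmod" where
  "restricted_yoneda T F t = \<lparr>at = \<lambda>x. Hom T (Fo F x) t, act = \<lambda>f u. u \<cdot>\<^bsub>T\<^esub> Fm F f\<rparr>"

text \<open>
  The sequential colimit of representables, computed objectwise: an element at \<open>x\<close> is the germ of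
  a pair \<open>(k, h)\<close> with \<open>h\<close> a morphism from \<open>x\<close> to \<open>E k\<close>. In the sum and in the action, the
  union is over representatives, all of which give the same germ.
\<close>

definition germ_rel ::
  "('o, 'm, 'x) precat_scheme \<Rightarrow> (nat \<Rightarrow> 'o) \<Rightarrow> (nat \<Rightarrow> 'm) \<Rightarrow> ((nat \<times> 'm) \<times> (nat \<times> 'm)) set" where
  "germ_rel S E e = {((k, h), (k', h')).
     (\<exists>x \<in> Ob S. h \<in> Mor S x (E k) \<and> h' \<in> Mor S x (E k')) \<and>
     (\<exists>l. k \<le> l \<and> k' \<le> l \<and> transit S E e k l \<cdot>\<^bsub>S\<^esub> h = transit S E e k' l \<cdot>\<^bsub>S\<^esub> h')}"

definition germ ::
  "('o, 'm, 'x) precat_scheme \<Rightarrow> (nat \<Rightarrow> 'o) \<Rightarrow> (nat \<Rightarrow> 'm) \<Rightarrow> nat \<Rightarrow> 'm \<Rightarrow> (nat \<times> 'm) set" where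
  "germ S E e k h = germ_rel S E e `` {(k, h)}"

definition colimY ::
  "('o, 'm, 'x) precat_scheme \<Rightarrow> (nat \<Rightarrow> 'o) \<Rightarrow> (nat \<Rightarrow> 'm) \<Rightarrow> ('o, 'm, (nat \<times> 'm) set) cmod" where
  "colimY S E e = \<lparr>
     at = \<lambda>x. \<lparr>
       carrier = (SIGMA k:UNIV. Mor S x (E k)) // germ_rel S E e,
       mult = \<lambda>U V. \<Union>(k, h) \<in> U. \<Union>(k', h') \<in> V.
         germ S E e (max k k')
           ((transit S E e k (max k k') \<cdot>\<^bsub>S\<^esub> h) \<otimes>\<^bsub>Hom S x (E (max k k'))\<^esub>
            (transit S E e k' (max k k') \<cdot>\<^bsub>S\<^esub> h')),
       one = germ S E e 0 (zero_mor S x (E 0))\<rparr>,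
     act = \<lambda>f U. \<Union>(k, h) \<in> U. germ S E e k (h \<cdot>\<^bsub>S\<^esub> f)\<rparr>"

text \<open>
  The module \<open>A\<close>, with legs \<open>\<iota> k\<close> from \<open>Y(E k)\<close> to \<open>A\<close>, is a colimit of \<open>Y(E)\<close>: the legs are
  induced by an isomorphism from the standard colimit. As the germs exhaust the standard colimit,
  \<open>\<eta>\<close> is the natural map determined by the legs.
\<close>

definition is_colimY ::
  "('o, 'm, 'x) precat_scheme \<Rightarrow> (nat \<Rightarrow> 'o) \<Rightarrow> (nat \<Rightarrow> 'm) \<Rightarrow>
     ('o, 'm, 'g) cmod \<Rightarrow> (nat \<Rightarrow> 'o \<Rightarrow> 'm \<Rightarrow> 'g) \<Rightarrow> bool" where
  "is_colimY S E e A \<iota> \<longleftrightarrow> A \<in> Modules S \<and>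
     (\<exists>\<eta> \<in> mod_iso S (colimY S E e) A.
        \<forall>x \<in> Ob S. \<forall>k. \<forall>h \<in> Mor S x (E k). \<eta> x (germ S E e k h) = \<iota> k x h)"


section \<open>The completion and the categories attached to a metric\<close>

definition Lcat ::
  "('o, 'm, 'x) tricat_scheme \<Rightarrow> (nat \<Rightarrow> 'o set) \<Rightarrow> ('o, 'm, 'g) cmod set" where
  "Lcat S M = {A \<in> Modules S. \<exists>E e. cauchy S M E e \<and> mod_iso S (colimY S E e) A \<noteq> {}}"

definition Lcat_at ::
  "('o, 'm, 'x) tricat_scheme \<Rightarrow> (nat \<Rightarrow> 'o set) \<Rightarrow> nat \<Rightarrow> ('o, 'm, 'g) cmod set" where
  "Lcat_at S M i = {A \<in> Modules S. \<exists>E e. cauchy S M E e \<and> (\<forall>k. E k \<in> M i) \<and>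
     mod_iso S (colimY S E e) A \<noteq> {}}"

definition Ccat ::
  "('o, 'm, 'x) tricat_scheme \<Rightarrow> (nat \<Rightarrow> 'o set) \<Rightarrow> ('o, 'm, 'g) cmod set" where
  "Ccat S M = {A \<in> Modules S. \<exists>i. \<forall>s \<in> M i. mod_hom_trivial S (yoneda S s) A}"

definition Scat ::
  "('o, 'm, 'x) tricat_scheme \<Rightarrow> (nat \<Rightarrow> 'o set) \<Rightarrow> ('o, 'm, 'g) cmod set" where
  "Scat S M = Lcat S M \<inter> Ccat S M"

text \<open>
  The right orthogonal of \<open>Lcat_at S M i\<close>. Every object of the latter is isomorphic to one with
  element type \<open>(nat \<times> 'm) set\<close>, that of the standard colimits.
\<close>

definition Lcat_at_perp ::
  "('o, 'm, 'x) tricat_scheme \<Rightarrow> (nat \<Rightarrow> 'o set) \<Rightarrow> nat \<Rightarrow> ('o, 'm, 'g) cmod set" where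
  "Lcat_at_perp S M i = {B \<in> Modules S.
     \<forall>A \<in> (Lcat_at S M i :: ('o, 'm, (nat \<times> 'm) set) cmod set). mod_hom_trivial S A B}"

text \<open>
  \<open>G\<close> is a morphism of type \<open>n\<close> with respect to the Cauchy sequences \<open>a\<close> and \<open>b\<close> (with transition
  maps \<open>d\<close> and \<open>e\<close>), where \<open>A\<close> with legs \<open>\<alpha>\<close> and \<open>B\<close> with legs \<open>\<beta>\<close> are the colimits. The
  subsequences are \<open>a \<circ> r\<close> and \<open>b \<circ> s\<close>. The second of the conditions on \<open>f\<close> says that \<open>G\<close> is
  the colimit of the \<open>Y(f i)\<close>.
\<close>

definition type_mor ::
  "('o, 'm, 'x) tricat_scheme \<Rightarrow> (nat \<Rightarrow> 'o set) \<Rightarrow> nat \<Rightarrow>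
     (nat \<Rightarrow> 'o) \<Rightarrow> (nat \<Rightarrow> 'm) \<Rightarrow> ('o, 'm, 'g) cmod \<Rightarrow> (nat \<Rightarrow> 'o \<Rightarrow> 'm \<Rightarrow> 'g) \<Rightarrow>
     (nat \<Rightarrow> 'o) \<Rightarrow> (nat \<Rightarrow> 'm) \<Rightarrow> ('o, 'm, 'h) cmod \<Rightarrow> (nat \<Rightarrow> 'o \<Rightarrow> 'm \<Rightarrow> 'h) \<Rightarrow>
     ('o \<Rightarrow> 'g \<Rightarrow> 'h) \<Rightarrow> bool" where
  "type_mor S M n a d A \<alpha> b e B \<beta> G \<longleftrightarrow>
     cauchy S M a d \<and> is_colimY S a d A \<alpha> \<and> cauchy S M b e \<and> is_colimY S b e B \<beta> \<and>
     G \<in> mod_hom S A B \<and>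
     (\<exists>r s f. strict_mono r \<and> strict_mono s \<and>
        (\<forall>i. f i \<in> Mor S (a (r i)) (b (s i)) \<and>
             transit S b e (s i) (s (Suc i)) \<cdot>\<^bsub>S\<^esub> f i
               = f (Suc i) \<cdot>\<^bsub>S\<^esub> transit S a d (r i) (r (Suc i))) \<and>
        (\<forall>i. \<forall>x \<in> Ob S. \<forall>h \<in> Mor S x (a (r i)).
             G x (\<alpha> (r i) x h) = \<beta> (s i) x (f i \<cdot>\<^bsub>S\<^esub> h)) \<and>
        (\<exists>N. \<forall>i\<ge>N. cone_in S (M n) (a (r i)) (b (s i)) (f i)))"

definition very_good_metric :: "('o, 'm, 'x) tricat_scheme \<Rightarrow> (nat \<Rightarrow> 'o set) \<Rightarrow> bool" where
  "very_good_metric S M \<longleftrightarrow> good_metric S M \<and>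
     Ob S = (\<Union>i. perp_left S (M i)) \<and>
     (\<forall>m. \<exists>n>m. \<forall>x \<in> Ob S. x \<in> ext_class S (perp_left S (M n)) (M m))"

definition excellent_metric :: "('o, 'm, 'x) tricat_scheme \<Rightarrow> (nat \<Rightarrow> 'o set) \<Rightarrow> bool" where
  "excellent_metric S M \<longleftrightarrow> very_good_metric S M \<and>
     (\<forall>m. \<exists>n>m. \<forall>x \<in> Ob S. \<exists>D d G.
        cauchy S M D d \<and> colimY S D d \<in> Scat S M \<inter> Lcat_at_perp S M n \<and>
        type_mor S M m (\<lambda>_. x) (\<lambda>_. Id S x) (yoneda S x) (\<lambda>_ _ h. h)
          D d (colimY S D d) (\<lambda>k _ h. germ S D d k h) G)"


section \<open>Good extensions\<close>

definition is_coproduct ::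
  "('o, 'm, 'x) precat_scheme \<Rightarrow> (nat \<Rightarrow> 'o) \<Rightarrow> 'o \<Rightarrow> (nat \<Rightarrow> 'm) \<Rightarrow> bool" where
  "is_coproduct C X P \<iota> \<longleftrightarrow> P \<in> Ob C \<and> (\<forall>i. \<iota> i \<in> Mor C (X i) P) \<and>
     (\<forall>y \<in> Ob C. \<forall>f. (\<forall>i. f i \<in> Mor C (X i) y) \<longrightarrow> (\<exists>!g. g \<in> Mor C P y \<and> (\<forall>i. g \<cdot>\<^bsub>C\<^esub> \<iota> i = f i)))"

text \<open>
  \<open>t\<close> is a homotopy colimit of the sequence \<open>(X, x)\<close>, and \<open>\<kappa> i\<close> are the induced maps from \<open>X i\<close>
  to \<open>t\<close>; here \<open>s\<close> is the shift map of the coproduct \<open>P\<close>.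
\<close>

definition is_hocolim ::
  "('o, 'm, 'x) tricat_scheme \<Rightarrow> (nat \<Rightarrow> 'o) \<Rightarrow> (nat \<Rightarrow> 'm) \<Rightarrow> 'o \<Rightarrow> (nat \<Rightarrow> 'm) \<Rightarrow> bool" where
  "is_hocolim C X x t \<kappa> \<longleftrightarrow>
     (\<exists>P \<iota> s g h. is_coproduct C X P \<iota> \<and>
        s \<in> Mor C P P \<and> (\<forall>i. s \<cdot>\<^bsub>C\<^esub> \<iota> i = \<iota> (Suc i) \<cdot>\<^bsub>C\<^esub> x i) \<and>
        (P, P, t, Id C P \<otimes>\<^bsub>Hom C P P\<^esub> neg_mor C P P s, g, h) \<in> Tri C \<and>
        (\<forall>i. \<kappa> i = g \<cdot>\<^bsub>C\<^esub> \<iota> i))"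

text \<open>
  The last condition says that the natural map from \<open>colim Y(a)\<close> to the restricted Yoneda image
  of \<open>Hocolim F(a)\<close>, sending the germ of \<open>(k, h)\<close> to \<open>\<kappa> k \<cdot> F(h)\<close>, is an isomorphism.
\<close>

definition good_extension ::
  "('o, 'm, 'x) tricat_scheme \<Rightarrow> (nat \<Rightarrow> 'o set) \<Rightarrow> ('p, 'n, 'y) tricat_scheme \<Rightarrow>
     ('o, 'm, 'p, 'n) fctr \<Rightarrow> ('o \<Rightarrow> 'n) \<Rightarrow> bool" where
  "good_extension S M T F \<phi> \<longleftrightarrow>
     triangulated_functor S T F \<phi> \<and> fully_faithful S T F \<and>
     (\<forall>a d. cauchy S M a d \<longrightarrow>
        (\<exists>P \<iota>. is_coproduct T (\<lambda>i. Fo F (a i)) P \<iota>) \<and>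
        (\<forall>t \<kappa>. is_hocolim T (\<lambda>i. Fo F (a i)) (\<lambda>i. Fm F (d i)) t \<kappa> \<longrightarrow>
           is_colimY S a d (restricted_yoneda T F t) (\<lambda>k _ h. \<kappa> k \<cdot>\<^bsub>T\<^esub> Fm F h)))"

definition L'cat ::
  "('o, 'm, 'x) tricat_scheme \<Rightarrow> (nat \<Rightarrow> 'o set) \<Rightarrow> ('p, 'n, 'y) tricat_scheme \<Rightarrow>
     ('o, 'm, 'p, 'n) fctr \<Rightarrow> 'p set" where
  "L'cat S M T F = {t \<in> Ob T. \<exists>a d t' \<kappa>. cauchy S M a d \<and>
     is_hocolim T (\<lambda>i. Fo F (a i)) (\<lambda>i. Fm F (d i)) t' \<kappa> \<and> isomorphic T t' t}"

definition L'cat_at ::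
  "('o, 'm, 'x) tricat_scheme \<Rightarrow> (nat \<Rightarrow> 'o set) \<Rightarrow> ('p, 'n, 'y) tricat_scheme \<Rightarrow>
     ('o, 'm, 'p, 'n) fctr \<Rightarrow> nat \<Rightarrow> 'p set" where
  "L'cat_at S M T F n = {t \<in> Ob T. \<exists>a d t' \<kappa>. cauchy S M a d \<and> (\<forall>k. a k \<in> M n) \<and>
     is_hocolim T (\<lambda>i. Fo F (a i)) (\<lambda>i. Fm F (d i)) t' \<kappa> \<and> isomorphic T t' t}"

text \<open>The copy of \<open>Scat S M\<close> inside \<open>L'cat S M T F\<close>.\<close>

definition S'cat ::
  "('o, 'm, 'x) tricat_scheme \<Rightarrow> (nat \<Rightarrow> 'o set) \<Rightarrow> ('p, 'n, 'y) tricat_scheme \<Rightarrow>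
     ('o, 'm, 'p, 'n) fctr \<Rightarrow> 'p set" where
  "S'cat S M T F = {t \<in> L'cat S M T F. restricted_yoneda T F t \<in> Ccat S M}"

text \<open>The distinguished triangles of a full triangulated subcategory.\<close>

definition Tri_in ::
  "('o, 'm, 'x) tricat_scheme \<Rightarrow> 'o set \<Rightarrow> ('o \<times> 'o \<times> 'o \<times> 'm \<times> 'm \<times> 'm) set" where
  "Tri_in C X = {(a, b, c, f, g, h) \<in> Tri C. a \<in> X \<and> b \<in> X \<and> c \<in> X}"

end

theory Submission
  imports Defs
begin

text \<open>
  Fix a very good metric \<open>M\<close> on \<open>S\<close> and a good extension \<open>F\<close> into \<open>T\<close>. Both conditions ask for an
  approximation of every object \<open>b\<close> of \<open>S\<close>: excellence by maps \<open>b \<longrightarrow> d i\<close> into a Cauchy sequence with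
  small cones, the other condition by a triangle \<open>A \<longrightarrow> F b \<longrightarrow> C\<close> with \<open>A\<close> small. Passing between them
  means taking the homotopy colimit of a sequence of triangles. Cones are not functorial, so the
  cones of a sequence of maps need not form a sequence for which this makes sense, and maps out of a
  homotopy colimit are determined by the terms only up to phantoms. The first problem
  is avoided by not choosing transition maps before they are forced, the second by a vanishing derived
  limit.

  The notion that carries this is \<open>approx t a \<psi>\<close>: a family of maps \<open>\<psi> i\<close> from \<open>F (a i)\<close> to \<open>t\<close>, with no
  transition maps between the \<open>a i\<close>, such that for each \<open>n\<close> and all large \<open>i\<close> the map \<open>\<psi> i\<close> induces a
  bijection on maps from \<open>F x\<close>, for all \<open>x\<close> in the left orthogonal of \<open>M n\<close> simultaneously. A Cauchy
  sequence approximates its homotopy colimit (\<open>approx_hocolimF\<close>). Conversely, if \<open>t\<close> is generated by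
  the image of \<open>F\<close>, then every approximating family has a subsequence that becomes Cauchy, with
  homotopy colimit \<open>t\<close>, for suitable transition maps (\<open>approx_subsequence\<close>). The transition maps exist
  because each \<open>a i\<close> is itself left orthogonal to some \<open>M n\<close>. The sequence is Cauchy because an object
  that receives no maps from the left orthogonal of \<open>M n\<close>, with \<open>n\<close> large compared to \<open>i\<close>, is a
  summand of an object of \<open>M i\<close> (\<open>mem_if_orthogonal\<close>). This is where closure under summands enters.

  Approximation is stable under taking cones, by the five lemma, for any fill-in maps. Given
  maps \<open>f i\<close> from \<open>b\<close> to \<open>d i\<close> as in an excellent metric and \<open>C\<close> the homotopy colimit of the \<open>F (d i)\<close>,
  the cones of the \<open>f i\<close> therefore approximate the cone \<open>\<Sigma> A\<close> of \<open>F b \<longrightarrow> C\<close>. Given a triangle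
  \<open>A \<longrightarrow> F b \<longrightarrow> C\<close> with \<open>A\<close> the homotopy colimit of the \<open>F (a i)\<close>, the cones of the induced maps
  \<open>a i \<longrightarrow> b\<close> approximate \<open>C\<close>, and the maps from \<open>b\<close> to these cones have cones \<open>\<Sigma> (a i)\<close>. The metric
  is used one step further out than asked for, at \<open>m + 1\<close>, to absorb the shift.

  It remains to compare orthogonality to \<open>L\<^sub>n\<close> in modules with orthogonality to \<open>L'\<^sub>n\<close> in \<open>T\<close>. A map from
  \<open>Hocolim F(a)\<close> to \<open>C\<close> induces a map of modules that sees only its restrictions to the \<open>F (a i)\<close>. If
  the module of \<open>C\<close> lies in \<open>Ccat S M\<close>, then for large \<open>i\<close> the images under \<open>F\<close> of the cones of
  \<open>a i \<longrightarrow> a (i + 1)\<close> have no maps into \<open>C\<close>, the inverse system of maps from the shifts of the \<open>F (a i)\<close> to \<open>C\<close> is eventually surjective, and its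
  first derived limit vanishes (\<open>no_phantom\<close>): nothing is lost.
\<close>

section \<open>Morphisms of a preadditive category\<close>

context preadditive_category
begin

text \<open>
  As hom-sets are disjoint, a morphism determines its source \<open>dm\<close> and target \<open>cd\<close>. Typing
  conditions then become equations between objects, which rewriting settles.
\<close>

definition arr :: "'m \<Rightarrow> bool" where
  "arr f \<longleftrightarrow> (\<exists>a \<in> Ob C. \<exists>b \<in> Ob C. f \<in> Mor C a b)"

definition dm :: "'m \<Rightarrow> 'o" where
  "dm f = (THE a. a \<in> Ob C \<and> (\<exists>b \<in> Ob C. f \<in> Mor C a b))"

definition cd :: "'m \<Rightarrow> 'o" where
  "cd f = (THE b. b \<in> Ob C \<and> (\<exists>a \<in> Ob C. f \<in> Mor C a b))"

definition in_hom :: "'m \<Rightarrow> 'o \<Rightarrow> 'o \<Rightarrow> bool" where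
  [simp]: "in_hom f a b \<longleftrightarrow> arr f \<and> dm f = a \<and> cd f = b"

lemma in_homI:
  assumes "a \<in> Ob C" "b \<in> Ob C" "f \<in> Mor C a b"
  shows "in_hom f a b"
proof -
  have disj: "a' = a \<and> b' = b" if "a' \<in> Ob C" "b' \<in> Ob C" "f \<in> Mor C a' b'" for a' b'
    using hom_disjoint[OF that(1,2) assms(1,2) that(3) assms(3)] .
  have "dm f = a" unfolding dm_def
    by (rule the_equality) (use assms disj in blast)+
  moreover have "cd f = b" unfolding cd_def
    by (rule the_equality) (use assms disj in blast)+
  ultimately show ?thesis using assms by (auto simp: arr_def)
qed

lemma in_homD:
  assumes "in_hom f a b"
  shows "a \<in> Ob C" "b \<in> Ob C" "f \<in> Mor C a b"
proof -
  obtain a' b' where *: "a' \<in> Ob C" "b' \<in> Ob C" "f \<in> Mor C a' b'"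
    using assms by (auto simp: arr_def)
  with in_homI[OF *] assms show "a \<in> Ob C" "b \<in> Ob C" "f \<in> Mor C a b" by auto
qed

lemma in_hom_iff: "in_hom f a b \<longleftrightarrow> a \<in> Ob C \<and> b \<in> Ob C \<and> f \<in> Mor C a b"
  using in_homI in_homD by blast

lemma Mor_iff: "a \<in> Ob C \<Longrightarrow> b \<in> Ob C \<Longrightarrow> f \<in> Mor C a b \<longleftrightarrow> in_hom f a b"
  using in_hom_iff by blast

lemma dm_Ob [simp]: "arr f \<Longrightarrow> dm f \<in> Ob C"
  using in_homD[of f "dm f" "cd f"] by simp

lemma cd_Ob [simp]: "arr f \<Longrightarrow> cd f \<in> Ob C"
  using in_homD[of f "dm f" "cd f"] by simp

lemma cmp_in_hom:
  assumes "arr f" "arr g" "dm g = cd f"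
  shows "in_hom (g \<cdot> f) (dm f) (cd g)"
proof -
  have "g \<cdot> f \<in> Mor C (dm f) (cd g)"
    by (rule cmp_mor[of "dm f" "cd f"]) (use assms in \<open>auto simp: Mor_iff\<close>)
  with assms show ?thesis by (simp add: Mor_iff)
qed

lemma cmp_simps [simp]:
  assumes "arr f" "arr g" "dm g = cd f"
  shows "arr (g \<cdot> f)" "dm (g \<cdot> f) = dm f" "cd (g \<cdot> f) = cd g"
  using cmp_in_hom[OF assms] by auto

lemma Id_simps [simp]:
  assumes "a \<in> Ob C"
  shows "arr (Id C a)" "dm (Id C a) = a" "cd (Id C a) = a"
  using id_mor[OF assms] assms by (auto simp: Mor_iff)

lemma cmp_Id_left [simp]: "arr f \<Longrightarrow> cd f = b \<Longrightarrow> Id C b \<cdot> f = f"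
  using id_left[of "dm f" "cd f" f] by (auto simp: Mor_iff)

lemma cmp_Id_right [simp]: "arr f \<Longrightarrow> dm f = a \<Longrightarrow> f \<cdot> Id C a = f"
  using id_right[of "dm f" "cd f" f] by (auto simp: Mor_iff)

lemma assoc:
  "arr f \<Longrightarrow> arr g \<Longrightarrow> arr h \<Longrightarrow> dm g = cd f \<Longrightarrow> dm h = cd g \<Longrightarrow> (h \<cdot> g) \<cdot> f = h \<cdot> (g \<cdot> f)"
  using cmp_assoc[of "dm f" "cd f" "cd g" "cd h" f g h] by (auto simp: Mor_iff)

definition add :: "'m \<Rightarrow> 'm \<Rightarrow> 'm" where
  "add f g = f \<otimes>\<^bsub>Hom C (dm f) (cd f)\<^esub> g"

definition neg :: "'m \<Rightarrow> 'm" where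
  "neg f = neg_mor C (dm f) (cd f) f"

definition sub :: "'m \<Rightarrow> 'm \<Rightarrow> 'm" where
  "sub f g = add f (neg g)"

definition par :: "'m \<Rightarrow> 'm \<Rightarrow> bool" where
  [simp]: "par f g \<longleftrightarrow> arr f \<and> arr g \<and> dm f = dm g \<and> cd f = cd g"

lemma hom_group: "a \<in> Ob C \<Longrightarrow> b \<in> Ob C \<Longrightarrow> group (Hom C a b)"
  using hom_comm_group comm_group.axioms(2) by blast

lemma zero_simps [simp]:
  assumes "a \<in> Ob C" "b \<in> Ob C"
  shows "arr (zero_mor C a b)" "dm (zero_mor C a b) = a" "cd (zero_mor C a b) = b"
  using monoid.one_closed[OF group.is_monoid[OF hom_group[OF assms]]] assms by (auto simp: Mor_iff)

lemma add_simps [simp]: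
  assumes "par f g"
  shows "arr (add f g)" "dm (add f g) = dm g" "cd (add f g) = cd g"
  using monoid.m_closed[OF group.is_monoid[OF hom_group[of "dm f" "cd f"]], of f g] assms
  by (auto simp: add_def Mor_iff)

lemma neg_simps [simp]:
  assumes "arr f"
  shows "arr (neg f)" "dm (neg f) = dm f" "cd (neg f) = cd f"
  using group.inv_closed[OF hom_group[of "dm f" "cd f"], of f] assms
  by (auto simp: neg_def Mor_iff)

lemma sub_simps [simp]:
  assumes "par f g"
  shows "arr (sub f g)" "dm (sub f g) = dm g" "cd (sub f g) = cd g"
  using assms by (auto simp: sub_def)

lemma add_zero [simp]:
  assumes "arr f" "dm f = a" "cd f = b"
  shows "add f (zero_mor C a b) = f" "add (zero_mor C a b) f = f"
proof -
  interpret comm_group "Hom C a b" using hom_comm_group assms by auto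
  have "f \<in> Mor C a b" using assms by (auto simp: Mor_iff)
  then show "add f (zero_mor C a b) = f" "add (zero_mor C a b) f = f"
    using assms zero_simps[of a b] dm_Ob[of f] cd_Ob[of f] by (simp_all add: add_def)
qed

lemma neg_zero [simp]:
  assumes "a \<in> Ob C" "b \<in> Ob C"
  shows "neg (zero_mor C a b) = zero_mor C a b"
proof -
  interpret comm_group "Hom C a b" using hom_comm_group assms by auto
  show ?thesis using assms by (auto simp: neg_def)
qed

lemma neg_neg [simp]:
  assumes "arr f"
  shows "neg (neg f) = f"
proof -
  interpret comm_group "Hom C (dm f) (cd f)" using hom_comm_group assms by auto
  show ?thesis
    unfolding neg_def[of "neg f"] neg_simps[OF assms] unfolding neg_def
    by (rule inv_inv) (use assms in \<open>simp add: Mor_iff\<close>)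
qed

lemma sub_eq_zero:
  assumes "par f g" "dm f = a" "cd f = b"
  shows "sub f g = zero_mor C a b \<longleftrightarrow> f = g"
proof -
  interpret comm_group "Hom C a b" using hom_comm_group assms by auto
  have "f \<in> Mor C a b" "g \<in> Mor C a b" using assms by (auto simp: Mor_iff)
  then have "f \<otimes>\<^bsub>Hom C a b\<^esub> inv\<^bsub>Hom C a b\<^esub> g = \<one>\<^bsub>Hom C a b\<^esub> \<longleftrightarrow> f = g"
    using inv_equality[of f "inv\<^bsub>Hom C a b\<^esub> g"] by auto
  then show ?thesis using assms by (simp add: sub_def add_def neg_def)
qed

lemma sub_zero [simp]: "arr f \<Longrightarrow> dm f = a \<Longrightarrow> cd f = b \<Longrightarrow> sub f (zero_mor C a b) = f"
  by (auto simp: sub_def)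

lemma add_sub:
  assumes "par f g"
  shows "add (sub f g) g = f" "sub (add f g) f = g" "add f (sub g f) = g"
proof -
  interpret comm_group "Hom C (dm f) (cd f)" using hom_comm_group assms by auto
  have f: "f \<in> carrier (Hom C (dm f) (cd f))" and g: "g \<in> carrier (Hom C (dm f) (cd f))"
    using assms by (auto simp: Mor_iff)
  have eq: "dm g = dm f" "cd g = cd f" using assms by auto
  have "f \<otimes>\<^bsub>Hom C (dm f) (cd f)\<^esub> inv\<^bsub>Hom C (dm f) (cd f)\<^esub> g \<otimes>\<^bsub>Hom C (dm f) (cd f)\<^esub> g = f"
    using f g by (simp add: m_assoc)
  then show "add (sub f g) g = f"
    using assms sub_simps[OF assms] by (simp add: add_def sub_def neg_def)
  have "f \<otimes>\<^bsub>Hom C (dm f) (cd f)\<^esub> g \<otimes>\<^bsub>Hom C (dm f) (cd f)\<^esub> inv\<^bsub>Hom C (dm f) (cd f)\<^esub> f = g"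
    using f g by (simp add: m_comm[of f g] m_assoc)
  then show "sub (add f g) f = g"
    using add_simps[OF assms] by (simp add: add_def sub_def neg_def eq)
  have "f \<otimes>\<^bsub>Hom C (dm f) (cd f)\<^esub> (g \<otimes>\<^bsub>Hom C (dm f) (cd f)\<^esub> inv\<^bsub>Hom C (dm f) (cd f)\<^esub> f) = g"
    using f g by (simp add: m_comm[of g] m_assoc[symmetric])
  then show "add f (sub g f) = g"
    by (simp add: add_def sub_def neg_def eq)
qed

lemma cmp_zero [simp]:
  assumes "arr h" "dm h = b" "a \<in> Ob C"
  shows "h \<cdot> zero_mor C a b = zero_mor C a (cd h)"
proof -
  interpret comm_group "Hom C a (cd h)" using hom_comm_group assms by auto
  have b: "b \<in> Ob C" using assms by auto
  have "h \<cdot> zero_mor C a b = h \<cdot> add (zero_mor C a b) (zero_mor C a b)" using assms b by simp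
  also have "\<dots> = (h \<cdot> zero_mor C a b) \<otimes>\<^bsub>Hom C a (cd h)\<^esub> (h \<cdot> zero_mor C a b)"
    using assms b by (auto simp: add_def Mor_iff intro!: cmp_add_right)
  finally show ?thesis using assms b r_cancel_one'[of "h \<cdot> zero_mor C a b"  "h \<cdot> zero_mor C a b"] by (auto simp: Mor_iff)
qed

lemma zero_cmp [simp]:
  assumes "arr h" "cd h = a" "b \<in> Ob C"
  shows "zero_mor C a b \<cdot> h = zero_mor C (dm h) b"
proof -
  interpret comm_group "Hom C (dm h) b" using hom_comm_group assms by auto
  have b: "a \<in> Ob C" using assms by auto
  have "zero_mor C a b \<cdot> h = add (zero_mor C a b) (zero_mor C a b) \<cdot> h" using assms b by simp
  also have "\<dots> = (zero_mor C a b \<cdot> h) \<otimes>\<^bsub>Hom C (dm h) b\<^esub> (zero_mor C a b \<cdot> h)"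
    using assms b by (auto simp: add_def Mor_iff intro!: cmp_add_left)
  finally show ?thesis using assms b r_cancel_one'[of "zero_mor C a b \<cdot> h"  "zero_mor C a b \<cdot> h"] by (auto simp: Mor_iff)
qed

lemma cmp_add:
  assumes "par f g" "arr h" "dm h = cd g"
  shows "h \<cdot> add f g = add (h \<cdot> f) (h \<cdot> g)"
  using assms cmp_add_right[of "dm f" "cd f" "cd h" f g h] by (auto simp: add_def Mor_iff)

lemma add_cmp:
  assumes "par f g" "arr h" "cd h = dm g"
  shows "add f g \<cdot> h = add (f \<cdot> h) (g \<cdot> h)"
  using assms cmp_add_left[of "dm h" "dm f" "cd f" h f g] by (auto simp: add_def Mor_iff)

lemma neg_unique:
  assumes "par f g" "add f g = zero_mor C (dm f) (cd f)"
  shows "g = neg f"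
proof -
  interpret comm_group "Hom C (dm f) (cd f)" using hom_comm_group assms by auto
  have "g \<otimes>\<^bsub>Hom C (dm f) (cd f)\<^esub> f = \<one>\<^bsub>Hom C (dm f) (cd f)\<^esub>"
    using assms m_comm[of f g] by (auto simp: add_def Mor_iff)
  then show ?thesis using inv_equality[of g f] assms by (simp add: neg_def Mor_iff)
qed

lemma add_neg [simp]:
  assumes "arr f" shows "add f (neg f) = zero_mor C (dm f) (cd f)"
proof -
  interpret comm_group "Hom C (dm f) (cd f)" using hom_comm_group assms by auto
  have "f \<in> Mor C (dm f) (cd f)" using assms by (auto simp: Mor_iff)
  then show ?thesis using assms neg_simps[OF assms] by (simp add: neg_def add_def)
qed

lemma cmp_neg:
  assumes "arr f" "arr h" "dm h = cd f"
  shows "h \<cdot> neg f = neg (h \<cdot> f)"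
proof (rule neg_unique)
  show "par (h \<cdot> f) (h \<cdot> neg f)" using assms by simp
  have "add (h \<cdot> f) (h \<cdot> neg f) = h \<cdot> add f (neg f)"
    by (rule cmp_add[symmetric]) (use assms in simp_all)
  also have "\<dots> = zero_mor C (dm f) (cd h)" using assms by simp
  finally show "add (h \<cdot> f) (h \<cdot> neg f) = zero_mor C (dm (h \<cdot> f)) (cd (h \<cdot> f))"
    using assms by simp
qed

lemma neg_cmp:
  assumes "arr f" "arr h" "dm h = cd f"
  shows "neg h \<cdot> f = neg (h \<cdot> f)"
proof (rule neg_unique)
  show "par (h \<cdot> f) (neg h \<cdot> f)" using assms by simp
  have "add (h \<cdot> f) (neg h \<cdot> f) = add h (neg h) \<cdot> f"
    by (rule add_cmp[symmetric]) (use assms in simp_all)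
  also have "\<dots> = zero_mor C (dm f) (cd h)" using assms by simp
  finally show "add (h \<cdot> f) (neg h \<cdot> f) = zero_mor C (dm (h \<cdot> f)) (cd (h \<cdot> f))"
    using assms by simp
qed

lemma neg_eq_iff: "arr f \<Longrightarrow> arr g \<Longrightarrow> neg f = neg g \<longleftrightarrow> f = g"
  by (metis neg_neg)

lemma cmp_sub:
  assumes "par f g" "arr h" "dm h = cd g"
  shows "h \<cdot> sub f g = sub (h \<cdot> f) (h \<cdot> g)"
  using assms by (simp add: sub_def cmp_add cmp_neg)

lemma sub_cmp:
  assumes "par f g" "arr h" "cd h = dm g"
  shows "sub f g \<cdot> h = sub (f \<cdot> h) (g \<cdot> h)"
  using assms by (simp add: sub_def add_cmp neg_cmp)

lemma add_assoc:
  assumes "par f g" "par g h"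
  shows "add (add f g) h = add f (add g h)"
proof -
  interpret comm_group "Hom C (dm h) (cd h)" using hom_comm_group assms by simp
  have "f \<in> Mor C (dm h) (cd h)" "g \<in> Mor C (dm h) (cd h)" "h \<in> Mor C (dm h) (cd h)"
    using assms by (simp_all add: Mor_iff)
  then show ?thesis using assms add_simps[of f g] add_simps[of g h]
    by (simp add: add_def m_assoc)
qed

lemma cmp_swap:
  assumes "g \<cdot> f = g' \<cdot> f'" "arr f" "arr g" "dm g = cd f" "arr f'" "arr g'" "dm g' = cd f'"
    "arr t" "dm f = cd t" "dm f' = cd t"
  shows "g \<cdot> (f \<cdot> t) = g' \<cdot> (f' \<cdot> t)"
proof -
  have "g \<cdot> (f \<cdot> t) = (g \<cdot> f) \<cdot> t" by (rule assoc[symmetric]) (use assms in simp_all)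
  also have "\<dots> = (g' \<cdot> f') \<cdot> t" by (simp only: assms(1))
  also have "\<dots> = g' \<cdot> (f' \<cdot> t)" by (rule assoc) (use assms in simp_all)
  finally show ?thesis .
qed

lemma is_isoE:
  assumes "is_iso C a b f" "a \<in> Ob C" "b \<in> Ob C"
  obtains g where "in_hom f a b" "in_hom g b a" "g \<cdot> f = Id C a" "f \<cdot> g = Id C b"
  using assms unfolding is_iso_def by (auto simp: Mor_iff)

lemma is_isoI:
  assumes "in_hom f a b" "in_hom g b a" "g \<cdot> f = Id C a" "f \<cdot> g = Id C b"
  shows "is_iso C a b f"
  using assms unfolding is_iso_def by (auto simp: Mor_iff)

lemma is_iso_Id [simp]: "a \<in> Ob C \<Longrightarrow> is_iso C a a (Id C a)"
  by (rule is_isoI[where g = "Id C a"]) auto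

lemma from_zero_object:
  assumes "is_zero_object C z" "in_hom u z x"
  shows "u = zero_mor C z x"
proof -
  have "u = u \<cdot> Id C z" using assms by simp
  also have "\<dots> = zero_mor C z x" using assms by (auto simp: is_zero_object_def)
  finally show ?thesis .
qed

lemma to_zero_object:
  assumes "is_zero_object C z" "in_hom u x z"
  shows "u = zero_mor C x z"
proof -
  have "u = Id C z \<cdot> u" using assms by simp
  also have "\<dots> = zero_mor C x z" using assms by (auto simp: is_zero_object_def)
  finally show ?thesis .
qed

text \<open>
  Injectivity and surjectivity of composition with \<open>u\<close> on maps out of the object \<open>x\<close>. By additivity,
  a trivial kernel is enough for the former.
\<close>

definition inj_on_hom :: "'o \<Rightarrow> 'm \<Rightarrow> bool" where
  "inj_on_hom x u \<longleftrightarrow> (\<forall>v. in_hom v x (dm u) \<and> u \<cdot> v = zero_mor C x (cd u) \<longrightarrow> v = zero_mor C x (dm u))"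

definition surj_on_hom :: "'o \<Rightarrow> 'm \<Rightarrow> bool" where
  "surj_on_hom x u \<longleftrightarrow> (\<forall>v. in_hom v x (cd u) \<longrightarrow> (\<exists>w. in_hom w x (dm u) \<and> v = u \<cdot> w))"

definition bij_on_hom :: "'o \<Rightarrow> 'm \<Rightarrow> bool" where
  "bij_on_hom x u \<longleftrightarrow> inj_on_hom x u \<and> surj_on_hom x u"

lemma bij_on_homI:
  assumes "\<And>v. in_hom v x (dm u) \<and> u \<cdot> v = zero_mor C x (cd u) \<Longrightarrow> v = zero_mor C x (dm u)"
    and "\<And>v. in_hom v x (cd u) \<Longrightarrow> \<exists>w. in_hom w x (dm u) \<and> v = u \<cdot> w"
  shows "bij_on_hom x u"
  unfolding bij_on_hom_def inj_on_hom_def surj_on_hom_def using assms by blast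

lemma inj_on_homD:
  assumes "inj_on_hom x u" "arr u" "in_hom v x (dm u)" "in_hom w x (dm u)" "u \<cdot> v = u \<cdot> w"
  shows "v = w"
proof -
  have x: "x \<in> Ob C" using assms by auto
  have "u \<cdot> sub v w = zero_mor C x (cd u)" using assms x
    by (simp add: cmp_sub sub_eq_zero)
  then have "sub v w = zero_mor C x (dm u)" using assms unfolding inj_on_hom_def by simp
  then show ?thesis using assms by (simp add: sub_eq_zero)
qed

lemma surj_on_homE:
  assumes "surj_on_hom x u" "arr v" "dm v = x" "cd v = cd u"
  obtains w where "arr w" "dm w = x" "cd w = dm u" "v = u \<cdot> w"
  using assms unfolding surj_on_hom_def by auto

lemma iso_on_hom:
  assumes "x \<in> Ob C" "in_hom u a b" "in_hom u' b a" "u' \<cdot> u = Id C a" "u \<cdot> u' = Id C b"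
  shows "bij_on_hom x u"
proof (rule bij_on_homI)
  fix v assume v: "in_hom v x (dm u) \<and> u \<cdot> v = zero_mor C x (cd u)"
  have "v = (u' \<cdot> u) \<cdot> v" using assms v by auto
  also have "\<dots> = u' \<cdot> (u \<cdot> v)" by (rule assoc) (use assms v in auto)
  also have "\<dots> = zero_mor C x (dm u)" using assms v by auto
  finally show "v = zero_mor C x (dm u)" .
next
  fix v assume v: "in_hom v x (cd u)"
  have "v = (u \<cdot> u') \<cdot> v" using assms v by auto
  also have "\<dots> = u \<cdot> (u' \<cdot> v)" by (rule assoc) (use assms v in auto)
  finally show "\<exists>w. in_hom w x (dm u) \<and> v = u \<cdot> w" using assms v by (intro exI[of _ "u' \<cdot> v"]) auto
qed

lemma bij_on_hom_source:
  assumes "in_hom i x y" "in_hom j y x" "j \<cdot> i = Id C x" "i \<cdot> j = Id C y" "arr u" "bij_on_hom x u"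
  shows "bij_on_hom y u"
proof (rule bij_on_homI)
  fix v assume v: "in_hom v y (dm u) \<and> u \<cdot> v = zero_mor C y (cd u)"
  have "u \<cdot> (v \<cdot> i) = (u \<cdot> v) \<cdot> i" by (rule assoc[symmetric]) (use assms v in auto)
  also have "\<dots> = zero_mor C y (cd u) \<cdot> i" using v by (simp only:)
  also have "\<dots> = zero_mor C x (cd u)" using assms by simp
  finally have "u \<cdot> (v \<cdot> i) = zero_mor C x (cd u)" .
  then have "v \<cdot> i = zero_mor C x (dm u)"
    using assms v unfolding bij_on_hom_def inj_on_hom_def by simp
  then have "(v \<cdot> i) \<cdot> j = zero_mor C y (dm u)" using assms(1-5) by auto
  then show "v = zero_mor C y (dm u)" using assms(1-5) v by (simp add: assoc)
next
  fix v assume v: "in_hom v y (cd u)"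
  obtain w where w: "arr w" "dm w = x" "cd w = dm u" "v \<cdot> i = u \<cdot> w"
    by (rule surj_on_homE[of x u "v \<cdot> i"]) (use assms v in \<open>auto simp: bij_on_hom_def\<close>)
  have "v = (v \<cdot> i) \<cdot> j" using v assms(1-5) by (simp add: assoc)
  also have "\<dots> = u \<cdot> (w \<cdot> j)" using v assms(1-5) w by (simp add: assoc)
  finally show "\<exists>w. in_hom w y (dm u) \<and> v = u \<cdot> w" using assms(1-5) w
    by (intro exI[of _ "w \<cdot> j"]) auto
qed

end

section \<open>Additive and fully faithful functors\<close>

locale additive_fun = A: preadditive_category A + B: preadditive_category B
  for A :: "('o, 'm, 'x) precat_scheme" and B :: "('p, 'n, 'y) precat_scheme" +
  fixes F :: "('o, 'm, 'p, 'n) fctr"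
  assumes additive: "additive_functor A B F"
begin

lemma obj [simp]: "a \<in> Ob A \<Longrightarrow> Fo F a \<in> Ob B"
  using additive by (auto simp: additive_functor_def)

lemma map_Id [simp]: "a \<in> Ob A \<Longrightarrow> Fm F (Id A a) = Id B (Fo F a)"
  using additive by (auto simp: additive_functor_def)

lemma map_hom: "a \<in> Ob A \<Longrightarrow> b \<in> Ob A \<Longrightarrow> Fm F \<in> hom (Hom A a b) (Hom B (Fo F a) (Fo F b))"
  using additive by (auto simp: additive_functor_def)

lemma map_simps [simp]:
  assumes "A.arr f"
  shows "B.arr (Fm F f)" "B.dm (Fm F f) = Fo F (A.dm f)" "B.cd (Fm F f) = Fo F (A.cd f)"
proof -
  have "f \<in> Mor A (A.dm f) (A.cd f)" using assms by (simp add: A.Mor_iff)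
  then have "Fm F f \<in> Mor B (Fo F (A.dm f)) (Fo F (A.cd f))"
    using map_hom[of "A.dm f" "A.cd f"] assms by (auto simp: hom_def)
  then show "B.arr (Fm F f)" "B.dm (Fm F f) = Fo F (A.dm f)" "B.cd (Fm F f) = Fo F (A.cd f)"
    using assms by (auto simp: B.Mor_iff)
qed

lemma map_cmp [simp]:
  assumes "A.arr f" "A.arr g" "A.dm g = A.cd f"
  shows "Fm F (g \<cdot>\<^bsub>A\<^esub> f) = Fm F g \<cdot>\<^bsub>B\<^esub> Fm F f"
proof -
  have "f \<in> Mor A (A.dm f) (A.cd f)" "g \<in> Mor A (A.cd f) (A.cd g)" using assms by (simp_all add: A.Mor_iff)
  then show ?thesis using additive assms A.dm_Ob A.cd_Ob unfolding additive_functor_def by blast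
qed

lemma map_zero [simp]:
  assumes "a \<in> Ob A" "b \<in> Ob A"
  shows "Fm F (zero_mor A a b) = zero_mor B (Fo F a) (Fo F b)"
  using hom_one[OF map_hom[OF assms]] A.hom_group[OF assms] B.hom_group assms by simp

lemma map_add:
  assumes "A.par f g"
  shows "Fm F (A.add f g) = B.add (Fm F f) (Fm F g)"
proof -
  have "f \<in> Mor A (A.dm f) (A.cd f)" "g \<in> Mor A (A.dm f) (A.cd f)" using assms by (simp_all add: A.Mor_iff)
  then show ?thesis using hom_mult[OF map_hom, of "A.dm f" "A.cd f" f g] assms
    by (simp add: A.add_def B.add_def)
qed

lemma map_neg [simp]:
  assumes "A.arr f"
  shows "Fm F (A.neg f) = B.neg (Fm F f)"
proof (rule B.neg_unique)
  show "B.par (Fm F f) (Fm F (A.neg f))" using assms by simp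
  show "B.add (Fm F f) (Fm F (A.neg f)) = zero_mor B (B.dm (Fm F f)) (B.cd (Fm F f))"
    using assms map_add[of f "A.neg f"] by simp
qed

end

locale ff_fun = additive_fun +
  assumes ff: "fully_faithful A B F"
begin

lemma full:
  assumes "B.arr u" "B.dm u = Fo F a" "B.cd u = Fo F b" "a \<in> Ob A" "b \<in> Ob A"
  obtains f where "A.arr f" "A.dm f = a" "A.cd f = b" "u = Fm F f"
proof -
  have "u \<in> Mor B (Fo F a) (Fo F b)" using assms by (simp add: B.Mor_iff)
  then have "u \<in> Fm F ` Mor A a b" using ff assms by (auto simp: fully_faithful_def bij_betw_def)
  then show ?thesis using that assms by (auto simp: A.Mor_iff)
qed

lemma faithful:
  assumes "A.par f g" "Fm F f = Fm F g"
  shows "f = g"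
proof -
  have "inj_on (Fm F) (Mor A (A.dm f) (A.cd f))"
    using ff assms by (auto simp: fully_faithful_def bij_betw_def)
  moreover have "f \<in> Mor A (A.dm f) (A.cd f)" "g \<in> Mor A (A.dm f) (A.cd f)"
    using assms by (simp_all add: A.Mor_iff)
  ultimately show ?thesis using assms by (simp add: inj_on_def)
qed

lemma faithful_zero:
  assumes "A.arr f" "A.dm f = a" "A.cd f = b" "Fm F f = zero_mor B (Fo F a) (Fo F b)"
  shows "f = zero_mor A a b"
  by (rule faithful) (use assms in auto)

end

section \<open>Exactness in triangulated categories\<close>

context triangulated_category
begin

abbreviation sho :: "'o \<Rightarrow> 'o" where "sho \<equiv> Fo (Sh C)"
abbreviation shm :: "'m \<Rightarrow> 'm" where "shm \<equiv> Fm (Sh C)"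

lemma shift_ff: "ff_fun C C (Sh C)"
  by unfold_locales (rule shift_functor shift_fully_faithful)+

lemma shift_add: "additive_fun C C (Sh C)"
  using shift_ff ff_fun.axioms(1) by blast

lemmas sho_Ob [simp] = additive_fun.obj[OF shift_add]
lemmas shm_simps [simp] = additive_fun.map_simps[OF shift_add]
lemmas shm_Id [simp] = additive_fun.map_Id[OF shift_add]
lemmas shm_cmp [simp] = additive_fun.map_cmp[OF shift_add]
lemmas shm_zero [simp] = additive_fun.map_zero[OF shift_add]
lemmas shm_neg [simp] = additive_fun.map_neg[OF shift_add]
lemmas shm_full = ff_fun.full[OF shift_ff]
lemmas shm_faithful = ff_fun.faithful[OF shift_ff]
lemmas shm_faithful_zero = ff_fun.faithful_zero[OF shift_ff]

lemma unshift:
  assumes "x \<in> Ob C"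
  obtains y i j where "y \<in> Ob C" "in_hom i (sho y) x" "in_hom j x (sho y)"
    "j \<cdot> i = Id C (sho y)" "i \<cdot> j = Id C x"
proof -
  obtain y i where y: "y \<in> Ob C" "is_iso C (sho y) x i"
    using shift_essentially_surjective assms by (auto simp: essentially_surjective_def isomorphic_def)
  obtain j where "in_hom i (sho y) x" "in_hom j x (sho y)" "j \<cdot> i = Id C (sho y)" "i \<cdot> j = Id C x"
    using is_isoE[OF y(2)] y(1) assms by auto
  with y that show ?thesis by blast
qed

lemma triD:
  assumes "(a, b, c, f, g, h) \<in> Tri C"
  shows "arr f" "dm f = a" "cd f = b" "arr g" "dm g = b" "cd g = c" "arr h" "dm h = c" "cd h = sho a"
    "a \<in> Ob C" "b \<in> Ob C" "c \<in> Ob C"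
  using tri_mor[OF assms] by (auto simp: Mor_iff)

lemma tri_rot_iff:
  assumes "in_hom f a b" "in_hom g b c" "in_hom h c (sho a)"
  shows "(a, b, c, f, g, h) \<in> Tri C \<longleftrightarrow> (b, c, sho a, g, h, neg (shm f)) \<in> Tri C"
proof -
  have "a \<in> Ob C" "b \<in> Ob C" "c \<in> Ob C" using assms by auto
  moreover have "neg_mor C (sho a) (sho b) (shm f) = neg (shm f)" using assms by (auto simp: neg_def)
  ultimately show ?thesis using tri_rotate[of a b c f g h] assms by (auto simp: Mor_iff)
qed

lemma tri_rot:
  assumes "(a, b, c, f, g, h) \<in> Tri C"
  shows "(b, c, sho a, g, h, neg (shm f)) \<in> Tri C"
  using tri_rot_iff[THEN iffD1, OF _ _ _ assms] triD[OF assms] by simp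

lemma shift_zero_object: "is_zero_object C z \<Longrightarrow> is_zero_object C (sho z)"
  unfolding is_zero_object_def using shm_Id shm_zero sho_Ob by metis

lemma tri_zero_left:
  assumes "x \<in> Ob C" "is_zero_object C z"
  shows "(z, x, x, zero_mor C z x, Id C x, zero_mor C x (sho z)) \<in> Tri C"
proof -
  have z: "z \<in> Ob C" using assms by (auto simp: is_zero_object_def)
  have "neg (shm (zero_mor C z x)) = zero_mor C (sho z) (sho x)" using assms z by simp
  then show ?thesis
    using tri_rot_iff[of "zero_mor C z x" z x "Id C x" x "zero_mor C x (sho z)"] assms z
      tri_id[of x "sho z"] shift_zero_object[OF assms(2)] by simp
qed

lemma tri_comp:
  assumes "(a, b, c, f, g, h) \<in> Tri C"
  shows "g \<cdot> f = zero_mor C a c"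
proof -
  obtain z where z: "is_zero_object C z" using zero_object by auto
  then have z': "z \<in> Ob C" by (auto simp: is_zero_object_def)
  note t = triD[OF assms]
  obtain w where w: "w \<in> Mor C z c" "w \<cdot> zero_mor C a z = g \<cdot> f"
    using tri_morphism[OF tri_id[OF t(10) z] assms, of "Id C a" f] t by (auto simp: Mor_iff)
  then show ?thesis using t z' by (auto simp: Mor_iff)
qed

text \<open>
  The rotated identity triangle of \<open>x\<close> maps to the rotation of the given one by \<open>u\<close> and \<open>0\<close>; the
  remaining component of that morphism is the shift of the factorisation.
\<close>

lemma exact_mid:
  assumes "(a, b, c, f, g, h) \<in> Tri C" "in_hom u x b" "g \<cdot> u = zero_mor C x c"
  obtains w where "arr w" "dm w = x" "cd w = a" "u = f \<cdot> w"
proof -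
  obtain z where z: "is_zero_object C z" using zero_object by auto
  then have z': "z \<in> Ob C" by (auto simp: is_zero_object_def)
  note t = triD[OF assms(1)]
  have x: "x \<in> Ob C" using assms by auto
  have "\<exists>w \<in> Mor C (sho x) (sho a). w \<cdot> zero_mor C z (sho x) = h \<cdot> zero_mor C z c \<and> shm u \<cdot> neg (shm (Id C x)) = neg (shm f) \<cdot> w"
    by (rule tri_morphism[OF tri_rot[OF tri_id[OF x z]] tri_rot[OF assms(1)]])
      (use assms t x z' in \<open>auto simp: Mor_iff\<close>)
  then obtain w where w: "in_hom w (sho x) (sho a)" "shm u \<cdot> neg (shm (Id C x)) = neg (shm f) \<cdot> w"
    using x t by (auto simp: Mor_iff)
  obtain w' where w': "arr w'" "dm w' = x" "cd w' = a" "w = shm w'"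
    by (rule shm_full[of w x a]) (use w x t in auto)
  have "neg (shm u) = neg (shm (f \<cdot> w'))" using w w' t x assms(2) by (simp add: cmp_neg neg_cmp)
  then have "shm u = shm (f \<cdot> w')" using w' t x assms(2) by (simp add: neg_eq_iff)
  then have "u = f \<cdot> w'" by (rule shm_faithful[rotated]) (use w' t x assms(2) in auto)
  with w' that show ?thesis by blast
qed

lemma exact_right:
  assumes "(a, b, c, f, g, h) \<in> Tri C" "in_hom u x c" "h \<cdot> u = zero_mor C x (sho a)"
  obtains w where "arr w" "dm w = x" "cd w = b" "u = g \<cdot> w"
  using exact_mid[OF tri_rot[OF assms(1)] assms(2,3)] .

lemma exact_shift:
  assumes "(a, b, c, f, g, h) \<in> Tri C" "in_hom u x (sho a)" "shm f \<cdot> u = zero_mor C x (sho b)"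
  obtains w where "arr w" "dm w = x" "cd w = c" "u = h \<cdot> w"
proof -
  have "neg (shm f) \<cdot> u = zero_mor C x (sho b)"
    using assms triD[OF assms(1)] by (auto simp: neg_cmp)
  then show ?thesis using exact_right[OF tri_rot[OF assms(1)] assms(2)] that by blast
qed

lemma coexact_mid:
  assumes "(a, b, c, f, g, h) \<in> Tri C" "in_hom u b x" "u \<cdot> f = zero_mor C a x"
  obtains w where "arr w" "dm w = c" "cd w = x" "u = w \<cdot> g"
proof -
  obtain z where z: "is_zero_object C z" using zero_object by auto
  then have z': "z \<in> Ob C" by (auto simp: is_zero_object_def)
  note t = triD[OF assms(1)]
  have x: "x \<in> Ob C" using assms by auto
  \<comment> \<open>Compare with the triangle \<open>z \<longrightarrow> x \<longrightarrow> x\<close> on a zero object \<open>z\<close>.\<close>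
  have "\<exists>w \<in> Mor C c x. w \<cdot> g = Id C x \<cdot> u \<and> shm (zero_mor C a z) \<cdot> h = zero_mor C x (sho z) \<cdot> w"
  proof (rule tri_morphism[OF assms(1) tri_zero_left[OF x z]])
    show "u \<in> Mor C b x" using assms(2) t x by (auto simp: Mor_iff)
    show "zero_mor C a z \<in> Mor C a z" using t z' by (auto simp: Mor_iff)
    show "u \<cdot> f = zero_mor C z x \<cdot> zero_mor C a z"
      using assms(2,3) t x z' by simp
  qed
  then obtain w where w: "w \<in> Mor C c x" "w \<cdot> g = Id C x \<cdot> u" by blast
  show ?thesis by (rule that[of w]) (use w x t assms(2) in \<open>simp_all add: Mor_iff\<close>)
qed

lemma coexact_right:
  assumes "(a, b, c, f, g, h) \<in> Tri C" "in_hom u c x" "u \<cdot> g = zero_mor C b x"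
  obtains w where "arr w" "dm w = sho a" "cd w = x" "u = w \<cdot> h"
  using coexact_mid[OF tri_rot[OF assms(1)] assms(2,3)] .

lemma coexact_shift:
  assumes "(a, b, c, f, g, h) \<in> Tri C" "in_hom u (sho a) x" "u \<cdot> h = zero_mor C c x"
  obtains w where "arr w" "dm w = sho b" "cd w = x" "u = w \<cdot> shm f"
proof -
  note t = triD[OF assms(1)]
  obtain w where w: "arr w" "dm w = sho b" "cd w = x" "u = w \<cdot> neg (shm f)"
    using coexact_right[OF tri_rot[OF assms(1)] assms(2,3)] .
  then have "u = neg w \<cdot> shm f" using t by (simp add: neg_cmp cmp_neg)
  then show ?thesis using w that[of "neg w"] by simp
qed

lemma tri_comp':
  assumes "(a, b, c, f, g, h) \<in> Tri C"
  shows "h \<cdot> g = zero_mor C b (sho a)" "shm f \<cdot> h = zero_mor C c (sho b)"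
proof -
  note t = triD[OF assms]
  show "h \<cdot> g = zero_mor C b (sho a)" using tri_comp[OF tri_rot[OF assms]] .
  have "neg (shm f) \<cdot> h = zero_mor C c (sho b)" using tri_comp[OF tri_rot[OF tri_rot[OF assms]]] .
  then have "neg (shm f \<cdot> h) = neg (zero_mor C c (sho b))" using t by (simp add: neg_cmp)
  then show "shm f \<cdot> h = zero_mor C c (sho b)"
    using t neg_eq_iff[of "shm f \<cdot> h" "zero_mor C c (sho b)"] by simp
qed

text \<open>
  The usual chase on maps out of a single object \<open>x\<close>. It applies to an arbitrary fill-in \<open>w\<close>, which is
  what allows cones to be compared without being functorial.
\<close>

lemma five_lemma:
  assumes tri: "(a, b, c, f, g, h) \<in> Tri C" "(a', b', c', f', g', h') \<in> Tri C"
    and u: "in_hom u a a'" and v: "in_hom v b b'" and w: "in_hom w c c'"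
    and eq: "v \<cdot> f = f' \<cdot> u" "w \<cdot> g = g' \<cdot> v" "shm u \<cdot> h = h' \<cdot> w"
    and hyp: "surj_on_hom x u" "bij_on_hom x v" "bij_on_hom x (shm u)" "inj_on_hom x (shm v)"
    and x: "x \<in> Ob C"
  shows "bij_on_hom x w"
proof (rule bij_on_homI)
  note t = triD[OF tri(1)] triD[OF tri(2)]
  note t' = t u[simplified] v[simplified] w[simplified]
  fix y assume y0: "in_hom y x (cd w)"
  then have y: "arr y" "dm y = x" "cd y = c'" using w by auto
  obtain p where p: "arr p" "dm p = x" "cd p = sho a" "h' \<cdot> y = shm u \<cdot> p"
    by (rule surj_on_homE[of x "shm u" "h' \<cdot> y"]) (use hyp y t' in \<open>auto simp: bij_on_hom_def\<close>)
  have "shm v \<cdot> (shm f \<cdot> p) = shm f' \<cdot> (shm u \<cdot> p)"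
  proof (rule cmp_swap)
    have "shm (v \<cdot> f) = shm (f' \<cdot> u)" using eq by simp
    then show "shm v \<cdot> shm f = shm f' \<cdot> shm u" using t' by simp
  qed (use p t' in auto)
  also have "\<dots> = (shm f' \<cdot> h') \<cdot> y" using p(4)[symmetric] t' y by (simp add: assoc)
  also have "\<dots> = zero_mor C x (sho b')" using tri_comp'[OF tri(2)] t' y by simp
  finally have "shm f \<cdot> p = zero_mor C x (sho b)"
    using hyp(4) t' p unfolding inj_on_hom_def by simp
  then obtain q where q: "arr q" "dm q = x" "cd q = c" "p = h \<cdot> q"
    using exact_shift[OF tri(1), of p x] p by auto
  have "h' \<cdot> (w \<cdot> q) = shm u \<cdot> (h \<cdot> q)"
    by (rule cmp_swap) (use eq t' q in auto)
  then have "h' \<cdot> sub y (w \<cdot> q) = zero_mor C x (sho a')"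
    using t' y q p by (simp add: cmp_sub sub_eq_zero)
  then obtain r where r: "arr r" "dm r = x" "cd r = b'" "sub y (w \<cdot> q) = g' \<cdot> r"
    using exact_right[OF tri(2), of "sub y (w \<cdot> q)" x] y t' q by auto
  obtain s where s: "arr s" "dm s = x" "cd s = b" "r = v \<cdot> s"
    by (rule surj_on_homE[of x v r]) (use hyp r t' in \<open>auto simp: bij_on_hom_def\<close>)
  have "w \<cdot> (g \<cdot> s) = g' \<cdot> (v \<cdot> s)" by (rule cmp_swap) (use eq t' s in auto)
  then have "sub y (w \<cdot> q) = w \<cdot> (g \<cdot> s)" using r s by simp
  then have "y = add (w \<cdot> (g \<cdot> s)) (w \<cdot> q)"
    using add_sub(1)[of y "w \<cdot> q"] y t' q by simp
  then have "y = w \<cdot> add (g \<cdot> s) q" using t' s q by (simp add: cmp_add)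
  then show "\<exists>z. in_hom z x (dm w) \<and> y = w \<cdot> z"
    using t' s q by (intro exI[of _ "add (g \<cdot> s) q"]) auto
next
  note t = triD[OF tri(1)] triD[OF tri(2)]
  note t' = t u[simplified] v[simplified] w[simplified]
  fix y assume y0: "in_hom y x (dm w) \<and> w \<cdot> y = zero_mor C x (cd w)"
  then have y: "arr y" "dm y = x" "cd y = c" "w \<cdot> y = zero_mor C x c'" using w by auto
  have "shm u \<cdot> (h \<cdot> y) = h' \<cdot> (w \<cdot> y)" by (rule cmp_swap) (use eq t' y in auto)
  also have "\<dots> = zero_mor C x (sho a')" using y t' x by simp
  finally have "h \<cdot> y = zero_mor C x (sho a)"
    using hyp(3) t' y unfolding bij_on_hom_def inj_on_hom_def by simp
  then obtain r where r: "arr r" "dm r = x" "cd r = b" "y = g \<cdot> r"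
    using exact_right[OF tri(1), of y x] y by auto
  have "g' \<cdot> (v \<cdot> r) = w \<cdot> (g \<cdot> r)" by (rule cmp_swap) (use eq t' r in auto)
  also have "\<dots> = zero_mor C x c'" using y r by simp
  finally obtain s where s: "arr s" "dm s = x" "cd s = a'" "v \<cdot> r = f' \<cdot> s"
    using exact_mid[OF tri(2), of "v \<cdot> r" x] r t' by auto
  obtain p where p: "arr p" "dm p = x" "cd p = a" "s = u \<cdot> p"
    by (rule surj_on_homE[of x u s]) (use hyp s t' in \<open>auto\<close>)
  have "v \<cdot> (f \<cdot> p) = f' \<cdot> (u \<cdot> p)" by (rule cmp_swap) (use eq t' p in auto)
  then have "r = f \<cdot> p" using s p t' r hyp(2)
    by (intro inj_on_homD[of x v r "f \<cdot> p"]) (auto simp: bij_on_hom_def)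
  then have "y = (g \<cdot> f) \<cdot> p" using r t' p by (simp add: assoc)
  then show "y = zero_mor C x (dm w)" using tri_comp[OF tri(1)] t' p by simp
qed

lemma bij_on_hom_shift:
  assumes "arr u" "x \<in> Ob C" "bij_on_hom x u"
  shows "bij_on_hom (sho x) (shm u)"
proof (rule bij_on_homI)
  fix v assume v: "in_hom v (sho x) (dm (shm u)) \<and> shm u \<cdot> v = zero_mor C (sho x) (cd (shm u))"
  obtain v' where v': "arr v'" "dm v' = x" "cd v' = dm u" "v = shm v'"
    by (rule shm_full[of v x "dm u"]) (use v assms in auto)
  have "shm (u \<cdot> v') = zero_mor C (sho x) (sho (cd u))" using v v' assms by simp
  then have "u \<cdot> v' = zero_mor C x (cd u)"
    by (rule shm_faithful_zero[rotated 3]) (use v' assms in auto)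
  then have "v' = zero_mor C x (dm u)" using assms v' unfolding bij_on_hom_def inj_on_hom_def by simp
  then show "v = zero_mor C (sho x) (dm (shm u))" using v' assms by simp
next
  fix v assume v: "in_hom v (sho x) (cd (shm u))"
  obtain v' where v': "arr v'" "dm v' = x" "cd v' = cd u" "v = shm v'"
    by (rule shm_full[of v x "cd u"]) (use v assms in auto)
  obtain w where w: "arr w" "dm w = x" "cd w = dm u" "v' = u \<cdot> w"
    by (rule surj_on_homE[of x u v']) (use v' assms in \<open>auto simp: bij_on_hom_def\<close>)
  then show "\<exists>w. in_hom w (sho x) (dm (shm u)) \<and> v = shm u \<cdot> w"
    using v' w assms by (intro exI[of _ "shm w"]) auto
qed

lemma bij_on_hom_unshift:
  assumes "arr u" "x \<in> Ob C" "bij_on_hom (sho x) (shm u)"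
  shows "bij_on_hom x u"
proof (rule bij_on_homI)
  fix v assume v: "in_hom v x (dm u) \<and> u \<cdot> v = zero_mor C x (cd u)"
  have "shm u \<cdot> shm v = shm (u \<cdot> v)" by (rule shm_cmp[symmetric]) (use v assms in auto)
  also have "\<dots> = zero_mor C (sho x) (sho (cd u))" using v assms by simp
  finally have "shm u \<cdot> shm v = zero_mor C (sho x) (sho (cd u))" .
  then have "shm v = zero_mor C (sho x) (sho (dm u))"
    using v assms unfolding bij_on_hom_def inj_on_hom_def by simp
  then show "v = zero_mor C x (dm u)"
    by (rule shm_faithful_zero[rotated 3]) (use v assms in auto)
next
  fix v assume v: "in_hom v x (cd u)"
  obtain w where w: "arr w" "dm w = sho x" "cd w = sho (dm u)" "shm v = shm u \<cdot> w"
    by (rule surj_on_homE[of "sho x" "shm u" "shm v"]) (use v assms in \<open>auto simp: bij_on_hom_def\<close>)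
  obtain w' where w': "arr w'" "dm w' = x" "cd w' = dm u" "w = shm w'"
    by (rule shm_full[of w x "dm u"]) (use w assms in auto)
  have "v = u \<cdot> w'" by (rule shm_faithful) (use v w w' assms in auto)
  then show "\<exists>w. in_hom w x (dm u) \<and> v = u \<cdot> w" using w' by auto
qed

lemma iso_if_zero_cone:
  assumes "(a, b, c, f, g, h) \<in> Tri C" "is_zero_object C c"
  obtains k where "in_hom k b a" "k \<cdot> f = Id C a" "f \<cdot> k = Id C b"
proof -
  note t = triD[OF assms(1)]
  have "g \<cdot> Id C b = zero_mor C b c" using to_zero_object[OF assms(2), of g b] t by simp
  then obtain k where k: "arr k" "dm k = b" "cd k = a" "Id C b = f \<cdot> k"
    using exact_mid[OF assms(1), of "Id C b" b] t by auto
  have "h = zero_mor C c (sho a)" using from_zero_object[OF assms(2), of h] t by simp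
  have "f \<cdot> (k \<cdot> f) = (f \<cdot> k) \<cdot> f" by (rule assoc[symmetric]) (use k t in simp_all)
  also have "\<dots> = f" using t by (simp add: k(4)[symmetric])
  finally have "f \<cdot> (k \<cdot> f) = f" .
  then have "f \<cdot> sub (k \<cdot> f) (Id C a) = zero_mor C a b"
    using t k by (simp add: cmp_sub sub_eq_zero)
  then have "shm (f \<cdot> sub (k \<cdot> f) (Id C a)) = zero_mor C (sho a) (sho b)" using t by simp
  then have "shm f \<cdot> shm (sub (k \<cdot> f) (Id C a)) = zero_mor C (sho a) (sho b)"
    using t k by simp
  then obtain w where w: "arr w" "dm w = sho a" "cd w = c" "shm (sub (k \<cdot> f) (Id C a)) = h \<cdot> w"
    using exact_shift[OF assms(1), of "shm (sub (k \<cdot> f) (Id C a))" "sho a"] t k by auto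
  then have "shm (sub (k \<cdot> f) (Id C a)) = zero_mor C (sho a) (sho a)"
    using \<open>h = zero_mor C c (sho a)\<close> t by simp
  then have "sub (k \<cdot> f) (Id C a) = zero_mor C a a"
    by (rule shm_faithful_zero[rotated 3]) (use k t in auto)
  then have "k \<cdot> f = Id C a" using sub_eq_zero[of "k \<cdot> f" "Id C a" a a] k t by simp
  with k that show ?thesis by auto
qed

lemma tri_fibre:
  assumes "in_hom g b c"
  obtains a f h where "(a, b, c, f, g, h) \<in> Tri C"
proof -
  have bc: "b \<in> Ob C" "c \<in> Ob C" using assms by auto
  obtain e k l where t: "(b, c, e, g, k, l) \<in> Tri C"
    using tri_cone[of b c g] assms bc by (auto simp: Mor_iff)
  note t' = triD[OF t]
  obtain a i j where a: "a \<in> Ob C" "in_hom i (sho a) e" "in_hom j e (sho a)"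
    "j \<cdot> i = Id C (sho a)" "i \<cdot> j = Id C e"
    using unshift[of e] t' by auto
  obtain f where f: "arr f" "dm f = a" "cd f = b" "neg (l \<cdot> i) = shm f"
    by (rule shm_full[of "neg (l \<cdot> i)" a b]) (use t' a in auto)
  have f': "neg (shm f) = l \<cdot> i" using f(4)[symmetric] t' a by simp
  have "(b, c, sho a, g, j \<cdot> k, l \<cdot> i) \<in> Tri C"
  proof (rule tri_iso_closed[OF t, where u = "Id C b" and v = "Id C c" and w = j])
    show "is_iso C e (sho a) j" by (rule is_isoI[of _ _ _ i]) (use a in auto)
    have "(l \<cdot> i) \<cdot> j = l \<cdot> (i \<cdot> j)" by (rule assoc) (use a t' in auto)
    then show "shm (Id C b) \<cdot> l = (l \<cdot> i) \<cdot> j" using t' a by simp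
  qed (use t' a in \<open>auto simp: Mor_iff\<close>)
  then have "(a, b, c, f, g, j \<cdot> k) \<in> Tri C"
    using tri_rot_iff[of f a b g c "j \<cdot> k"] f f' t' a by simp
  then show ?thesis using that by blast
qed

text \<open>
  If \<open>a \<longrightarrow> b\<close> vanishes, then the identity of \<open>b\<close> extends over the cone, and the triangle splits.
\<close>

lemma biproduct_if_zero:
  assumes "(a, b, c, zero_mor C a b, g, h) \<in> Tri C"
  shows "is_biproduct C b (sho a) c"
proof -
  note t = triD[OF assms]
  obtain p where p: "arr p" "dm p = c" "cd p = b" "Id C b = p \<cdot> g"
    using coexact_mid[OF assms, of "Id C b" b] t by auto
  \<comment> \<open>The complementary idempotent kills \<open>g\<close>, hence factors through \<open>h\<close>; this is the other section.\<close>
  have "sub (Id C c) (g \<cdot> p) \<cdot> g = zero_mor C b c"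
    using p t by (simp add: sub_cmp assoc sub_eq_zero p(4)[symmetric])
  then obtain j where j: "arr j" "dm j = sho a" "cd j = c" "sub (Id C c) (g \<cdot> p) = j \<cdot> h"
    using coexact_right[OF assms, of "sub (Id C c) (g \<cdot> p)" c] p t by auto
  have hg: "h \<cdot> g = zero_mor C b (sho a)" using tri_comp'[OF assms] by simp
  have hgp: "h \<cdot> (g \<cdot> p) = zero_mor C c (sho a)"
    using hg p t assoc[of p g h, symmetric] by simp
  have "(h \<cdot> j) \<cdot> h = h \<cdot> sub (Id C c) (g \<cdot> p)" using j t by (simp add: assoc)
  also have "\<dots> = h" using hgp p t by (simp add: cmp_sub)
  finally have "sub (h \<cdot> j) (Id C (sho a)) \<cdot> h = zero_mor C c (sho a)"
    using j t by (simp add: sub_cmp sub_eq_zero)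
  then obtain w where "arr w" "dm w = sho b" "cd w = sho a" "sub (h \<cdot> j) (Id C (sho a)) = w \<cdot> shm (zero_mor C a b)"
    using coexact_shift[OF assms, of "sub (h \<cdot> j) (Id C (sho a))" "sho a"] j t by auto
  then have hj: "h \<cdot> j = Id C (sho a)" using sub_eq_zero[of "h \<cdot> j" "Id C (sho a)" "sho a" "sho a"] j t by simp
  have "(p \<cdot> j) \<cdot> h = p \<cdot> sub (Id C c) (g \<cdot> p)" using j t p by (simp add: assoc)
  also have "\<dots> = sub p (p \<cdot> (g \<cdot> p))" using p t by (simp add: cmp_sub)
  also have "p \<cdot> (g \<cdot> p) = (p \<cdot> g) \<cdot> p" by (rule assoc[symmetric]) (use p t in simp_all)
  also have "\<dots> = p" using p(1-3) by (simp add: p(4)[symmetric])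
  also have "sub p p = zero_mor C c b" using p t by (simp add: sub_eq_zero)
  finally obtain w where "arr w" "dm w = sho b" "cd w = b" "p \<cdot> j = w \<cdot> shm (zero_mor C a b)"
    using coexact_shift[OF assms, of "p \<cdot> j" b] j t p by auto
  then have pj: "p \<cdot> j = zero_mor C (sho a) b" using t by simp
  have "add (g \<cdot> p) (j \<cdot> h) = Id C c"
    using add_sub(3)[of "g \<cdot> p" "Id C c"] j p t by simp
  then have "(g \<cdot> p) \<otimes>\<^bsub>Hom C c c\<^esub> (j \<cdot> h) = Id C c" using p t by (simp add: add_def)
  then show ?thesis unfolding is_biproduct_def
    using p j t hj pj hg
    by (intro conjI bexI[of _ g] bexI[of _ j] bexI[of _ p] bexI[of _ h]) (auto simp: Mor_iff)
qed

lemma coexact_left: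
  assumes "(a, b, c, f, g, h) \<in> Tri C" "in_hom u a x" "shm u \<cdot> h = zero_mor C c (sho x)"
  obtains w where "arr w" "dm w = b" "cd w = x" "u = w \<cdot> f"
proof -
  note t = triD[OF assms(1)]
  have x: "x \<in> Ob C" using assms(2) by auto
  obtain v where v: "arr v" "dm v = sho b" "cd v = sho x" "shm u = v \<cdot> shm f"
    using coexact_shift[OF assms(1), of "shm u" "sho x"] assms(2,3) by auto
  obtain w where w: "arr w" "dm w = b" "cd w = x" "v = shm w"
    by (rule shm_full[of v b x]) (use v t x in auto)
  have "u = w \<cdot> f" by (rule shm_faithful) (use assms(2) v w t in auto)
  with w that show ?thesis by blast
qed

lemma bij_on_hom_cmp:
  assumes "arr u" "arr v" "dm v = cd u" "bij_on_hom x u" "bij_on_hom x v" "x \<in> Ob C"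
  shows "bij_on_hom x (v \<cdot> u)"
proof (rule bij_on_homI)
  fix w assume "in_hom w x (dm (v \<cdot> u)) \<and> v \<cdot> u \<cdot> w = zero_mor C x (cd (v \<cdot> u))"
  then have w: "arr w" "dm w = x" "cd w = dm u" "(v \<cdot> u) \<cdot> w = zero_mor C x (cd v)"
    using assms by auto
  then have "v \<cdot> (u \<cdot> w) = zero_mor C x (cd v)" using assms by (simp add: assoc)
  then have "u \<cdot> w = zero_mor C x (cd u)" using assms w unfolding bij_on_hom_def inj_on_hom_def by simp
  then have "w = zero_mor C x (dm u)" using assms w unfolding bij_on_hom_def inj_on_hom_def by simp
  then show "w = zero_mor C x (dm (v \<cdot> u))" using assms by simp
next
  fix w assume w: "in_hom w x (cd (v \<cdot> u))"
  obtain p where p: "arr p" "dm p = x" "cd p = dm v" "w = v \<cdot> p"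
    by (rule surj_on_homE[of x v w]) (use w assms in \<open>auto simp: bij_on_hom_def\<close>)
  obtain q where q: "arr q" "dm q = x" "cd q = dm u" "p = u \<cdot> q"
    by (rule surj_on_homE[of x u p]) (use p assms in \<open>auto simp: bij_on_hom_def\<close>)
  show "\<exists>q. in_hom q x (dm (v \<cdot> u)) \<and> w = v \<cdot> u \<cdot> q"
    using p q assms by (intro exI[of _ q]) (auto simp: assoc)
qed

lemma bij_on_hom_Id: "x \<in> Ob C \<Longrightarrow> a \<in> Ob C \<Longrightarrow> bij_on_hom x (Id C a)"
  by (rule iso_on_hom[of x "Id C a" a a "Id C a"]) auto

text \<open>
  The part of the long exact sequence of \<open>Hom(x, -)\<close> around the cone, between two isomorphisms.
\<close>

lemma cone_orthogonal:
  assumes "(a, b, c, f, g, h) \<in> Tri C" "bij_on_hom x f" "bij_on_hom x (shm f)" "in_hom u x c"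
  shows "u = zero_mor C x c"
proof -
  note t = triD[OF assms(1)]
  have x: "x \<in> Ob C" using assms by auto
  have "shm f \<cdot> (h \<cdot> u) = (shm f \<cdot> h) \<cdot> u" by (rule assoc[symmetric]) (use t assms(4) in auto)
  also have "\<dots> = zero_mor C x (sho b)" using tri_comp'[OF assms(1)] t assms(4) by simp
  finally have "h \<cdot> u = zero_mor C x (sho a)"
    using assms t unfolding bij_on_hom_def inj_on_hom_def by simp
  then obtain w where w: "arr w" "dm w = x" "cd w = b" "u = g \<cdot> w"
    using exact_right[OF assms(1,4)] by blast
  obtain v where v: "arr v" "dm v = x" "cd v = a" "w = f \<cdot> v"
    by (rule surj_on_homE[of x f w]) (use assms(2) w t in \<open>auto simp: bij_on_hom_def\<close>)
  have "u = (g \<cdot> f) \<cdot> v" using w v t by (simp add: assoc)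
  then show ?thesis using tri_comp[OF assms(1)] v t by simp
qed

end

section \<open>Colimits of representable modules\<close>

locale sequence = preadditive_category C
  for C :: "('o, 'm, 'x) precat_scheme" (structure) +
  fixes E :: "nat \<Rightarrow> 'o" and e :: "nat \<Rightarrow> 'm"
  assumes seq: "is_seq C E e"
begin

lemma E_Ob [simp]: "E i \<in> Ob C"
  using seq by (auto simp: is_seq_def)

lemma e_simps [simp]: "arr (e i)" "dm (e i) = E i" "cd (e i) = E (Suc i)"
  using seq Mor_iff[of "E i" "E (Suc i)" "e i"] by (auto simp: is_seq_def)

abbreviation tr :: "nat \<Rightarrow> nat \<Rightarrow> 'm" where "tr \<equiv> transit C E e"

lemma tr_add_simps:
  "arr (transit_add C E e j n) \<and> dm (transit_add C E e j n) = E j \<and> cd (transit_add C E e j n) = E (j + n)"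
  by (induction n) auto

lemma tr_simps [simp]:
  assumes "j \<le> k"
  shows "arr (tr j k)" "dm (tr j k) = E j" "cd (tr j k) = E k"
  using tr_add_simps[of j "k - j"] assms by (auto simp: transit_def)

lemma tr_refl [simp]: "tr j j = Id C (E j)"
  by (simp add: transit_def)

lemma tr_Suc: "j \<le> k \<Longrightarrow> tr j (Suc k) = e k \<cdot> tr j k"
  by (simp add: transit_def Suc_diff_le)

lemma tr_step: "tr k (Suc k) = e k"
  by (simp add: tr_Suc)

lemma tr_trans:
  assumes "j \<le> k" "k \<le> l"
  shows "tr k l \<cdot> tr j k = tr j l"
  using assms(2)
proof (induction l rule: dec_induct)
  case base
  then show ?case using assms by simp
next
  case (step l)
  then have "tr k (Suc l) \<cdot> tr j k = e l \<cdot> (tr k l \<cdot> tr j k)"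
    using assms by (simp add: tr_Suc assoc)
  then show ?case using step assms by (simp add: tr_Suc)
qed

lemma tr_trans_cmp:
  assumes "j \<le> k" "k \<le> l" "arr h" "cd h = E j"
  shows "tr k l \<cdot> (tr j k \<cdot> h) = tr j l \<cdot> h"
proof -
  have "tr k l \<cdot> (tr j k \<cdot> h) = (tr k l \<cdot> tr j k) \<cdot> h"
    by (rule assoc[symmetric]) (use assms in simp_all)
  then show ?thesis using assms by (simp add: tr_trans)
qed

abbreviation gm :: "nat \<Rightarrow> 'm \<Rightarrow> (nat \<times> 'm) set" where "gm \<equiv> germ C E e"

abbreviation colim :: "('o, 'm, (nat \<times> 'm) set) cmod" where "colim \<equiv> colimY C E e"

lemma germ_mem:
  assumes "arr h" "dm h = x" "cd h = E k"
  shows "(k', h') \<in> gm k h \<longleftrightarrow>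
    in_hom h' x (E k') \<and> (\<exists>l. k \<le> l \<and> k' \<le> l \<and> tr k l \<cdot> h = tr k' l \<cdot> h')"
  using assms by (auto simp: germ_def germ_rel_def Mor_iff)

lemma germ_memE:
  assumes "(k', h') \<in> gm k h" "arr h" "dm h = x" "cd h = E k"
  obtains l where "arr h'" "dm h' = x" "cd h' = E k'" "k \<le> l" "k' \<le> l" "tr k l \<cdot> h = tr k' l \<cdot> h'"
  using germ_mem[OF assms(2-4), THEN iffD1, OF assms(1)] that by (elim conjE exE) simp

lemma germ_self:
  assumes "arr h" "cd h = E k"
  shows "(k, h) \<in> gm k h"
  using germ_mem[of h "dm h" k k h] assms by auto

lemma eq_later:
  assumes "tr k l \<cdot> h = tr k' l \<cdot> h'" "arr h" "cd h = E k" "arr h'" "cd h' = E k'" "k \<le> l" "k' \<le> l" "l \<le> m"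
  shows "tr k m \<cdot> h = tr k' m \<cdot> h'"
proof -
  have "tr k m \<cdot> h = tr l m \<cdot> (tr k l \<cdot> h)" using assms(2-) by (simp add: tr_trans_cmp)
  also have "\<dots> = tr l m \<cdot> (tr k' l \<cdot> h')" by (simp only: assms(1))
  also have "\<dots> = tr k' m \<cdot> h'" using assms(2-) by (simp add: tr_trans_cmp)
  finally show ?thesis .
qed

lemma germ_eq_iff:
  assumes "arr h" "dm h = x" "cd h = E k" "arr h'" "dm h' = x" "cd h' = E k'"
  shows "gm k h = gm k' h' \<longleftrightarrow> (\<exists>l. k \<le> l \<and> k' \<le> l \<and> tr k l \<cdot> h = tr k' l \<cdot> h')"
proof
  assume "gm k h = gm k' h'"
  then have "(k', h') \<in> gm k h" using germ_self assms by simp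
  then show "\<exists>l. k \<le> l \<and> k' \<le> l \<and> tr k l \<cdot> h = tr k' l \<cdot> h'"
    using assms germ_mem by blast
next
  assume "\<exists>l. k \<le> l \<and> k' \<le> l \<and> tr k l \<cdot> h = tr k' l \<cdot> h'"
  then obtain l where l: "k \<le> l" "k' \<le> l" "tr k l \<cdot> h = tr k' l \<cdot> h'" by blast
  have *: "gm k1 h1 \<subseteq> gm k2 h2"
    if h12: "arr h1" "dm h1 = x" "cd h1 = E k1" "arr h2" "dm h2 = x" "cd h2 = E k2" "k1 \<le> l" "k2 \<le> l"
      "tr k1 l \<cdot> h1 = tr k2 l \<cdot> h2" for k1 k2 h1 h2
  proof
    fix p assume "p \<in> gm k1 h1"
    moreover obtain k3 h3 where p3: "p = (k3, h3)" by (cases p)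
    ultimately obtain l3 where "arr h3" "dm h3 = x" "cd h3 = E k3" "k1 \<le> l3" "k3 \<le> l3"
      "tr k1 l3 \<cdot> h1 = tr k3 l3 \<cdot> h3"
      using germ_memE[OF _ h12(1-3)] by metis
    then have p: "p = (k3, h3)" "in_hom h3 x (E k3)" "k1 \<le> l3" "k3 \<le> l3"
      "tr k1 l3 \<cdot> h1 = tr k3 l3 \<cdot> h3" using p3 by simp_all
    have "tr k1 (max l l3) \<cdot> h1 = tr k3 (max l l3) \<cdot> h3"
      by (rule eq_later[OF p(5)]) (use h12 p in auto)
    moreover have "tr k1 (max l l3) \<cdot> h1 = tr k2 (max l l3) \<cdot> h2"
      by (rule eq_later[OF h12(9)]) (use h12 p in auto)
    ultimately show "p \<in> gm k2 h2" using p h12 germ_mem[of h2 x k2 k3 h3] by (metis le_max_iff_disj)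
  qed
  show "gm k h = gm k' h'"
    using *[OF assms l] *[OF assms(4-6) assms(1-3) l(2,1) l(3)[symmetric]] by blast
qed

lemma germ_push:
  assumes "arr h" "cd h = E k" "k \<le> l"
  shows "gm l (tr k l \<cdot> h) = gm k h"
  using germ_eq_iff[of "tr k l \<cdot> h" "dm h" l h k] assms by auto

lemma colim_carrier:
  assumes "x \<in> Ob C"
  shows "U \<in> carrier (at colim x) \<longleftrightarrow> (\<exists>k h. in_hom h x (E k) \<and> U = gm k h)"
proof -
  have "carrier (at colim x) = (\<Union>p \<in> (SIGMA k:UNIV. Mor C x (E k)). {germ_rel C E e `` {p}})"
    by (simp add: colimY_def quotient_def)
  then have "U \<in> carrier (at colim x) \<longleftrightarrow> (\<exists>k h. h \<in> Mor C x (E k) \<and> U = gm k h)"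
    by (auto simp: germ_def)
  then show ?thesis using assms by (simp add: Mor_iff)
qed

lemma germ_carrier [simp]: "arr h \<Longrightarrow> dm h = x \<Longrightarrow> cd h = E k \<Longrightarrow> gm k h \<in> carrier (at colim x)"
  using colim_carrier[of x] dm_Ob[of h] by auto

lemma germ_cases:
  assumes "U \<in> carrier (at colim x)" "x \<in> Ob C"
  obtains k h where "arr h" "dm h = x" "cd h = E k" "\<And>l. k \<le> l \<Longrightarrow> U = gm l (tr k l \<cdot> h)"
proof -
  obtain k h where "in_hom h x (E k)" "U = gm k h" using assms colim_carrier by blast
  then show ?thesis using that[of h k] germ_push[of h k] by simp
qed

text \<open>
  The sum in the standard colimit is a union over all representatives. They all give one germ, since
  any finite set of representatives can be pushed to a common stage; at a common stage the sum is
  computed there.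
\<close>

lemma germ_mult:
  assumes h: "arr h" "dm h = x" "cd h = E k" and h': "arr h'" "dm h' = x" "cd h' = E k"
  shows "gm k h \<otimes>\<^bsub>at colim x\<^esub> gm k h' = gm k (add h h')"
proof -
  have x: "x \<in> Ob C" using h by auto
  have *: "gm (max k1 k2) ((tr k1 (max k1 k2) \<cdot> h1) \<otimes>\<^bsub>Hom C x (E (max k1 k2))\<^esub> (tr k2 (max k1 k2) \<cdot> h2))
     = gm k (add h h')" if mem: "(k1, h1) \<in> gm k h" "(k2, h2) \<in> gm k h'" for k1 k2 h1 h2
  proof -
    obtain l1 where h1: "arr h1" "dm h1 = x" "cd h1 = E k1"
      and l1: "k \<le> l1" "k1 \<le> l1" "tr k l1 \<cdot> h = tr k1 l1 \<cdot> h1"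
      using germ_memE[OF mem(1) h] .
    obtain l2 where h2: "arr h2" "dm h2 = x" "cd h2 = E k2"
      and l2: "k \<le> l2" "k2 \<le> l2" "tr k l2 \<cdot> h' = tr k2 l2 \<cdot> h2"
      using germ_memE[OF mem(2) h'] .
    define m where "m = max k1 k2"
    define l where "l = max l1 l2"
    have m: "k1 \<le> m" "k2 \<le> m" "m \<le> l" "k \<le> l" and l: "l1 \<le> l" "l2 \<le> l"
      using l1 l2 by (auto simp: m_def l_def)
    have e1: "tr k l \<cdot> h = tr k1 l \<cdot> h1" by (rule eq_later[OF l1(3)]) (use h h1 l1 l in auto)
    have e2: "tr k l \<cdot> h' = tr k2 l \<cdot> h2" by (rule eq_later[OF l2(3)]) (use h' h2 l2 l in auto)
    have "gm m (add (tr k1 m \<cdot> h1) (tr k2 m \<cdot> h2)) = gm l (tr m l \<cdot> add (tr k1 m \<cdot> h1) (tr k2 m \<cdot> h2))"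
      using m h1 h2 by (simp add: germ_push)
    also have "\<dots> = gm l (add (tr k1 l \<cdot> h1) (tr k2 l \<cdot> h2))"
      using m h1 h2 by (simp add: cmp_add tr_trans_cmp)
    also have "\<dots> = gm l (tr k l \<cdot> add h h')"
      using m h h' by (simp add: cmp_add e1 e2)
    also have "\<dots> = gm k (add h h')" using m h h' by (simp add: germ_push)
    finally show ?thesis using m h1 h2 by (simp add: m_def[symmetric] add_def)
  qed
  have "gm k h \<otimes>\<^bsub>at colim x\<^esub> gm k h' = (\<Union>(k1, h1) \<in> gm k h. \<Union>(k2, h2) \<in> gm k h'.
         gm (max k1 k2) ((tr k1 (max k1 k2) \<cdot> h1) \<otimes>\<^bsub>Hom C x (E (max k1 k2))\<^esub> (tr k2 (max k1 k2) \<cdot> h2)))"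
    by (simp add: colimY_def)
  also have "\<dots> = gm k (add h h')"
  proof
    show "(\<Union>(k1, h1) \<in> gm k h. \<Union>(k2, h2) \<in> gm k h'.
         gm (max k1 k2) ((tr k1 (max k1 k2) \<cdot> h1) \<otimes>\<^bsub>Hom C x (E (max k1 k2))\<^esub> (tr k2 (max k1 k2) \<cdot> h2)))
      \<subseteq> gm k (add h h')" using * by blast
    show "gm k (add h h') \<subseteq> (\<Union>(k1, h1) \<in> gm k h. \<Union>(k2, h2) \<in> gm k h'.
         gm (max k1 k2) ((tr k1 (max k1 k2) \<cdot> h1) \<otimes>\<^bsub>Hom C x (E (max k1 k2))\<^esub> (tr k2 (max k1 k2) \<cdot> h2)))"
      using *[of k h k h'] germ_self[of h k] germ_self[of h' k] h h' by blast
  qed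
  finally show ?thesis .
qed

lemma germ_act:
  assumes h: "arr h" "cd h = E k" and f: "arr f" "cd f = dm h"
  shows "act colim f (gm k h) = gm k (h \<cdot> f)"
proof -
  have *: "gm k1 (h1 \<cdot> f) = gm k (h \<cdot> f)" if mem: "(k1, h1) \<in> gm k h" for k1 h1
  proof -
    obtain l where h1: "arr h1" "dm h1 = dm h" "cd h1 = E k1"
      and l: "k \<le> l" "k1 \<le> l" "tr k l \<cdot> h = tr k1 l \<cdot> h1"
      using germ_memE[OF mem h(1) refl h(2)] .
    have "tr k l \<cdot> (h \<cdot> f) = tr k1 l \<cdot> (h1 \<cdot> f)" by (rule cmp_swap) (use h h1 l f in auto)
    then show ?thesis using germ_eq_iff[of "h1 \<cdot> f" "dm f" k1 "h \<cdot> f" k] h h1 f l by auto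
  qed
  have "act colim f (gm k h) = (\<Union>(k1, h1) \<in> gm k h. gm k1 (h1 \<cdot> f))" by (simp add: colimY_def)
  also have "\<dots> = gm k (h \<cdot> f)" using * germ_self[of h k] h by blast
  finally show ?thesis .
qed

lemma germ_zero:
  assumes "x \<in> Ob C"
  shows "\<one>\<^bsub>at colim x\<^esub> = gm k (zero_mor C x (E k))"
proof -
  have "gm k (tr 0 k \<cdot> zero_mor C x (E 0)) = gm 0 (zero_mor C x (E 0))"
    by (rule germ_push) (use assms in auto)
  then show ?thesis using assms by (simp add: colimY_def)
qed

lemma colim_group:
  assumes x: "x \<in> Ob C"
  shows "comm_group (at colim x)"
proof (rule comm_groupI)
  fix U V assume U: "U \<in> carrier (at colim x)" and V: "V \<in> carrier (at colim x)"
  obtain k h where h: "arr h" "dm h = x" "cd h = E k" "\<And>l. k \<le> l \<Longrightarrow> U = gm l (tr k l \<cdot> h)"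
      by (rule germ_cases[OF U x]) (rule that)
  obtain k' h' where h': "arr h'" "dm h' = x" "cd h' = E k'" "\<And>l. k' \<le> l \<Longrightarrow> V = gm l (tr k' l \<cdot> h')"
      by (rule germ_cases[OF V x]) (rule that)
  define l where "l = max k k'"
  define u v where "u = tr k l \<cdot> h" and "v = tr k' l \<cdot> h'"
  have u: "arr u" "dm u = x" "cd u = E l" "U = gm l u" and v: "arr v" "dm v = x" "cd v = E l" "V = gm l v"
    using h h' by (auto simp: l_def u_def v_def)
  show "U \<otimes>\<^bsub>at colim x\<^esub> V \<in> carrier (at colim x)" using u v by (simp add: germ_mult)
  interpret G: comm_group "Hom C x (E l)" using hom_comm_group x by simp
  have "add u v = add v u" using G.m_comm[of u v] u v x by (simp add: add_def Mor_iff)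
  then show "U \<otimes>\<^bsub>at colim x\<^esub> V = V \<otimes>\<^bsub>at colim x\<^esub> U" using u v by (simp add: germ_mult)
  fix W assume W: "W \<in> carrier (at colim x)"
  obtain k'' h'' where h'': "arr h''" "dm h'' = x" "cd h'' = E k''" "\<And>l. k'' \<le> l \<Longrightarrow> W = gm l (tr k'' l \<cdot> h'')"
      by (rule germ_cases[OF W x]) (rule that)
  define m where "m = max l k''"
  define a b c where "a = tr l m \<cdot> u" and "b = tr l m \<cdot> v" and "c = tr k'' m \<cdot> h''"
  have a: "arr a" "dm a = x" "cd a = E m" "U = gm m a" and b: "arr b" "dm b = x" "cd b = E m" "V = gm m b"
    and c: "arr c" "dm c = x" "cd c = E m" "W = gm m c"
    using u v h'' by (auto simp: m_def a_def b_def c_def germ_push)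
  have "add (add a b) c = add a (add b c)"
    by (rule add_assoc) (use a b c in simp_all)
  then show "U \<otimes>\<^bsub>at colim x\<^esub> V \<otimes>\<^bsub>at colim x\<^esub> W = U \<otimes>\<^bsub>at colim x\<^esub> (V \<otimes>\<^bsub>at colim x\<^esub> W)"
    using a b c by (simp add: germ_mult)
next
  show "\<one>\<^bsub>at colim x\<^esub> \<in> carrier (at colim x)" using germ_zero[OF x, of 0] x by simp
  fix U assume U: "U \<in> carrier (at colim x)"
  obtain k h where h: "arr h" "dm h = x" "cd h = E k" "\<And>l. k \<le> l \<Longrightarrow> U = gm l (tr k l \<cdot> h)"
      by (rule germ_cases[OF U x]) (rule that)
  then have U': "U = gm k h" using h(4)[of k] by simp
  show "\<one>\<^bsub>at colim x\<^esub> \<otimes>\<^bsub>at colim x\<^esub> U = U"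
    unfolding U' germ_zero[OF x, of k] using h x by (simp add: germ_mult)
  have "add (neg h) h = zero_mor C x (E k)" using add_neg[of "neg h"] h by simp
  then have "gm k (neg h) \<otimes>\<^bsub>at colim x\<^esub> U = \<one>\<^bsub>at colim x\<^esub>"
    unfolding U' germ_zero[OF x, of k] using h by (simp add: germ_mult)
  then show "\<exists>V\<in>carrier (at colim x). V \<otimes>\<^bsub>at colim x\<^esub> U = \<one>\<^bsub>at colim x\<^esub>"
    using h by (intro bexI[of _ "gm k (neg h)"]) simp_all
qed

lemma colim_module: "colim \<in> Modules C"
  unfolding Modules_def mem_Collect_eq
proof (intro conjI ballI)
  show "comm_group (at colim x)" if "x \<in> Ob C" for x using colim_group that .
  show "act colim f \<in> hom (at colim y) (at colim x)"
    if xy: "x \<in> Ob C" "y \<in> Ob C" "f \<in> Mor C x y" for x y f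
  proof (rule homI)
    have f: "arr f" "dm f = x" "cd f = y" using xy by (auto simp: Mor_iff)
    fix U assume U: "U \<in> carrier (at colim y)"
    obtain k h where h: "arr h" "dm h = y" "cd h = E k" "\<And>l. k \<le> l \<Longrightarrow> U = gm l (tr k l \<cdot> h)"
      by (rule germ_cases[OF U xy(2)]) (rule that)
    then show "act colim f U \<in> carrier (at colim x)" using f h(4)[of k] by (simp add: germ_act)
    fix V assume V: "V \<in> carrier (at colim y)"
    obtain k' h' where h': "arr h'" "dm h' = y" "cd h' = E k'" "\<And>l. k' \<le> l \<Longrightarrow> V = gm l (tr k' l \<cdot> h')"
      by (rule germ_cases[OF V xy(2)]) (rule that)
    define l where "l = max k k'"
    define u v where "u = tr k l \<cdot> h" and "v = tr k' l \<cdot> h'"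
    have u: "arr u" "dm u = y" "cd u = E l" "U = gm l u" and v: "arr v" "dm v = y" "cd v = E l" "V = gm l v"
      using h h' by (auto simp: l_def u_def v_def)
    then show "act colim f (U \<otimes>\<^bsub>at colim y\<^esub> V) = act colim f U \<otimes>\<^bsub>at colim x\<^esub> act colim f V"
      using f by (simp add: germ_mult germ_act add_cmp)
  qed
  show "act colim (Id C x) U = U" if x: "x \<in> Ob C" "U \<in> carrier (at colim x)" for x U
    using germ_cases[OF x(2,1)] x by (metis (no_types) Id_simps(1,3) cmp_Id_right colim_carrier germ_act in_hom_def)
  show "act colim (g \<cdot> f) U = act colim f (act colim g U)"
    if th: "x \<in> Ob C" "y \<in> Ob C" "z \<in> Ob C" "f \<in> Mor C x y" "g \<in> Mor C y z" "U \<in> carrier (at colim z)"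
    for x y z f g U
  proof -
    obtain k h where h: "arr h" "dm h = z" "cd h = E k" "\<And>l. k \<le> l \<Longrightarrow> U = gm l (tr k l \<cdot> h)"
      by (rule germ_cases[OF th(6,3)]) (rule that)
    then have "U = gm k h" using h(4)[of k] by simp
    then show ?thesis using h that by (simp add: germ_act Mor_iff assoc)
  qed
  show "act colim (f \<otimes>\<^bsub>Hom C x y\<^esub> f') U = act colim f U \<otimes>\<^bsub>at colim x\<^esub> act colim f' U"
    if th: "x \<in> Ob C" "y \<in> Ob C" "f \<in> Mor C x y" "f' \<in> Mor C x y" "U \<in> carrier (at colim y)"
    for x y f f' U
  proof -
    obtain k h where h: "arr h" "dm h = y" "cd h = E k" "\<And>l. k \<le> l \<Longrightarrow> U = gm l (tr k l \<cdot> h)"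
      by (rule germ_cases[OF th(5,2)]) (rule that)
    then have "U = gm k h" using h(4)[of k] by simp
    moreover have "f \<otimes>\<^bsub>Hom C x y\<^esub> f' = add f f'" using that by (simp add: add_def Mor_iff)
    ultimately show ?thesis using h that by (simp add: germ_act germ_mult Mor_iff cmp_add)
  qed
qed

lemma colim_is_colimY: "is_colimY C E e colim (\<lambda>k _ h. gm k h)"
  unfolding is_colimY_def
proof (intro conjI bexI)
  show "(\<lambda>x U. U) \<in> mod_iso C colim colim"
    by (auto simp: mod_iso_def mod_hom_def iso_def hom_def bij_betw_def
        comm_group.axioms group.is_monoid monoid.m_closed colim_group)
qed (auto simp: colim_module)

end

context preadditive_category
begin

lemma module_group: "A \<in> Modules C \<Longrightarrow> x \<in> Ob C \<Longrightarrow> group (at A x)"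
  by (auto simp: Modules_def comm_group_def)

lemma module_act_Id: "A \<in> Modules C \<Longrightarrow> x \<in> Ob C \<Longrightarrow> u \<in> carrier (at A x) \<Longrightarrow> act A (Id C x) u = u"
  by (auto simp: Modules_def)

lemma mod_hom_one:
  assumes "A \<in> Modules C" "B \<in> Modules C" "\<eta> \<in> mod_hom C A B" "x \<in> Ob C"
  shows "\<eta> x \<one>\<^bsub>at A x\<^esub> = \<one>\<^bsub>at B x\<^esub>"
proof (rule hom_one)
  show "\<eta> x \<in> hom (at A x) (at B x)" using assms by (auto simp: mod_hom_def)
qed (use module_group assms in auto)

lemma mod_hom_closed:
  assumes "\<eta> \<in> mod_hom C A B" "x \<in> Ob C" "u \<in> carrier (at A x)"
  shows "\<eta> x u \<in> carrier (at B x)"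
  using assms by (auto simp: mod_hom_def hom_def)

lemma mod_hom_compose:
  assumes "\<eta> \<in> mod_hom C A B" "\<theta> \<in> mod_hom C B D"
  shows "(\<lambda>x u. \<theta> x (\<eta> x u)) \<in> mod_hom C A D"
proof -
  have "(\<lambda>u. \<theta> x (\<eta> x u)) \<in> hom (at A x) (at D x)" if "x \<in> Ob C" for x
    using that assms by (auto simp: mod_hom_def hom_def Pi_iff)
  moreover have "\<theta> x (\<eta> x (act A f u)) = act D f (\<theta> y (\<eta> y u))"
    if "x \<in> Ob C" "y \<in> Ob C" "f \<in> Mor C x y" "u \<in> carrier (at A y)" for x y f u
    using that assms mod_hom_closed[OF assms(1)] by (auto simp: mod_hom_def)
  ultimately show ?thesis by (simp add: mod_hom_def)
qed

lemma mod_iso_inverse: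
  assumes "A \<in> Modules C" "B \<in> Modules C" "\<eta> \<in> mod_iso C A B"
  shows "(\<lambda>x. inv_into (carrier (at A x)) (\<eta> x)) \<in> mod_iso C B A"
proof -
  define \<theta> where "\<theta> = (\<lambda>x. inv_into (carrier (at A x)) (\<eta> x))"
  have \<eta>: "\<eta> \<in> mod_hom C A B" "\<And>x. x \<in> Ob C \<Longrightarrow> \<eta> x \<in> iso (at A x) (at B x)"
    using assms by (auto simp: mod_iso_def)
  have iso: "\<theta> x \<in> iso (at B x) (at A x)" if "x \<in> Ob C" for x
    unfolding \<theta>_def by (rule group.iso_set_sym) (use that assms module_group \<eta> in auto)
  have inv: "\<theta> x (\<eta> x u) = u" if "x \<in> Ob C" "u \<in> carrier (at A x)" for x u
    using \<eta>(2)[of x] that by (auto simp: \<theta>_def iso_def bij_betw_def)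
  have nat: "\<theta> x (act B f v) = act A f (\<theta> y v)"
    if xy: "x \<in> Ob C" "y \<in> Ob C" "f \<in> Mor C x y" "v \<in> carrier (at B y)" for x y f v
  proof -
    have "v \<in> \<eta> y ` carrier (at A y)" using \<eta>(2)[of y] xy by (auto simp: iso_def bij_betw_def)
    then obtain u where u: "u \<in> carrier (at A y)" "v = \<eta> y u" by blast
    have "act A f u \<in> carrier (at A x)" using assms(1) xy u by (auto simp: Modules_def hom_def Pi_iff)
    moreover have "\<eta> x (act A f u) = act B f v" using \<eta>(1) xy u by (auto simp: mod_hom_def)
    ultimately show ?thesis using inv xy u by metis
  qed
  show ?thesis unfolding \<theta>_def[symmetric] using iso nat by (auto simp: mod_iso_def mod_hom_def iso_def)
qed

text \<open>
  The Yoneda lemma, in the only form in which it is used.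
\<close>

lemma yoneda_trivial:
  assumes A: "A \<in> Modules C" and s: "s \<in> Ob C"
  shows "mod_hom_trivial C (yoneda C s) A \<longleftrightarrow> carrier (at A s) = {\<one>\<^bsub>at A s\<^esub>}"
proof
  assume triv: "mod_hom_trivial C (yoneda C s) A"
  have "u = \<one>\<^bsub>at A s\<^esub>" if u: "u \<in> carrier (at A s)" for u
  proof -
    have "(\<lambda>x h. act A h u) \<in> mod_hom C (yoneda C s) A"
      using A s u by (auto simp: mod_hom_def yoneda_def Modules_def hom_def Pi_iff)
    moreover have "Id C s \<in> carrier (at (yoneda C s) s)" using s by (simp add: yoneda_def Mor_iff)
    ultimately have "(\<lambda>x h. act A h u) s (Id C s) = \<one>\<^bsub>at A s\<^esub>"
      using triv s unfolding mod_hom_trivial_def by (elim ballE) auto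
    then show ?thesis using module_act_Id[OF A s u] by simp
  qed
  moreover have "\<one>\<^bsub>at A s\<^esub> \<in> carrier (at A s)" using module_group[OF A s] by (simp add: group.is_monoid)
  ultimately show "carrier (at A s) = {\<one>\<^bsub>at A s\<^esub>}" by blast
next
  assume one: "carrier (at A s) = {\<one>\<^bsub>at A s\<^esub>}"
  show "mod_hom_trivial C (yoneda C s) A"
    unfolding mod_hom_trivial_def
  proof (intro ballI)
    fix \<eta> x u assume \<eta>: "\<eta> \<in> mod_hom C (yoneda C s) A" and x: "x \<in> Ob C" and "u \<in> carrier (at (yoneda C s) x)"
    then have u: "u \<in> Mor C x s" by (simp add: yoneda_def)
    have i: "Id C s \<in> carrier (at (yoneda C s) s)" using s by (simp add: yoneda_def Mor_iff)
    have "\<eta> x (act (yoneda C s) u (Id C s)) = act A u (\<eta> s (Id C s))"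
      using \<eta> x s u i unfolding mod_hom_def by blast
    moreover have "act (yoneda C s) u (Id C s) = u" using u x s by (simp add: yoneda_def Mor_iff)
    moreover have "\<eta> s (Id C s) = \<one>\<^bsub>at A s\<^esub>" using mod_hom_closed[OF \<eta> s i] one by blast
    moreover have "act A u \<in> hom (at A s) (at A x)" using A u x s by (auto simp: Modules_def)
    ultimately show "\<eta> x u = \<one>\<^bsub>at A x\<^esub>" using hom_one module_group[OF A] x s by metis
  qed
qed

lemma trivial_carrier_iso:
  assumes "A \<in> Modules C" "B \<in> Modules C" "\<eta> \<in> mod_iso C A B" "s \<in> Ob C" "carrier (at A s) = {\<one>\<^bsub>at A s\<^esub>}"
  shows "carrier (at B s) = {\<one>\<^bsub>at B s\<^esub>}"
proof -
  have "\<eta> s \<in> iso (at A s) (at B s)" using assms by (simp add: mod_iso_def)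
  then have "carrier (at B s) = \<eta> s ` {\<one>\<^bsub>at A s\<^esub>}"
    using assms(5) by (simp add: iso_def bij_betw_def)
  moreover have "\<eta> s \<one>\<^bsub>at A s\<^esub> = \<one>\<^bsub>at B s\<^esub>"
    by (rule mod_hom_one) (use assms in \<open>auto simp: mod_iso_def\<close>)
  ultimately show ?thesis by simp
qed

lemma yoneda_module: "s \<in> Ob C \<Longrightarrow> yoneda C s \<in> Modules C"
  unfolding Modules_def mem_Collect_eq
proof (intro conjI ballI)
  assume s: "s \<in> Ob C"
  show "comm_group (at (yoneda C s) x)" if "x \<in> Ob C" for x
    using that s hom_comm_group by (simp add: yoneda_def)
  show "act (yoneda C s) f \<in> hom (at (yoneda C s) y) (at (yoneda C s) x)"
    if "x \<in> Ob C" "y \<in> Ob C" "f \<in> Mor C x y" for x y f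
    using that s cmp_add_left[of x y s f] cmp_mor[of x y s f] by (intro homI) (auto simp: yoneda_def)
  show "act (yoneda C s) (Id C x) u = u"
    if "x \<in> Ob C" "u \<in> carrier (at (yoneda C s) x)" for x u
    using that s by (simp add: yoneda_def Mor_iff)
  show "act (yoneda C s) (g \<cdot> f) u = act (yoneda C s) f (act (yoneda C s) g u)"
    if "x \<in> Ob C" "y \<in> Ob C" "z \<in> Ob C" "f \<in> Mor C x y" "g \<in> Mor C y z" "u \<in> carrier (at (yoneda C s) z)"
    for x y z f g u
    using that s by (simp add: yoneda_def Mor_iff assoc)
  show "act (yoneda C s) (f \<otimes>\<^bsub>Hom C x y\<^esub> f') u = act (yoneda C s) f u \<otimes>\<^bsub>at (yoneda C s) x\<^esub> act (yoneda C s) f' u"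
    if "x \<in> Ob C" "y \<in> Ob C" "f \<in> Mor C x y" "f' \<in> Mor C x y" "u \<in> carrier (at (yoneda C s) y)"
    for x y f f' u
    using that s cmp_add_right[of x y s f f' u] by (simp add: yoneda_def)
qed

lemma const_seq: "b \<in> Ob C \<Longrightarrow> is_seq C (\<lambda>_. b) (\<lambda>_. Id C b)"
  by (simp add: is_seq_def Mor_iff)

lemma transit_const:
  assumes "b \<in> Ob C"
  shows "j \<le> k \<Longrightarrow> transit C (\<lambda>_. b) (\<lambda>_. Id C b) j k = Id C b"
proof -
  have "transit_add C (\<lambda>_. b) (\<lambda>_. Id C b) j n = Id C b" for n
    using assms by (induction n) auto
  then show ?thesis by (simp add: transit_def)
qed

text \<open>
  All transition maps are identities, so a germ is \<open>UNIV \<times> {h}\<close>, from which \<open>h\<close> can be read off.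
\<close>

lemma const_colimY:
  assumes b: "b \<in> Ob C"
  shows "is_colimY C (\<lambda>_. b) (\<lambda>_. Id C b) (yoneda C b) (\<lambda>_ _ h. h)"
proof -
  interpret sequence C "\<lambda>_. b" "\<lambda>_. Id C b" by unfold_locales (rule const_seq[OF b])
  have germ: "gm k h = UNIV \<times> {h}" if h: "in_hom h x b" for k h x
  proof -
    have "(k', h') \<in> gm k h \<longleftrightarrow> h' = h" for k' h'
    proof
      assume "(k', h') \<in> gm k h"
      then obtain l where "arr h'" "dm h' = x" "cd h' = b" "k \<le> l" "k' \<le> l" "tr k l \<cdot> h = tr k' l \<cdot> h'"
        by (rule germ_memE[where x = x]) (use h in auto)
      then show "h' = h" using h transit_const[OF b] by simp
    next
      assume "h' = h"
      then show "(k', h') \<in> gm k h"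
        using germ_mem[where h = h and x = x and k = k and k' = k' and h' = h'] h transit_const[OF b]
        by (simp add: exI[of _ "max k k'"])
    qed
    then show ?thesis by auto
  qed
  define \<eta> :: "'o \<Rightarrow> (nat \<times> 'm) set \<Rightarrow> 'm" where "\<eta> = (\<lambda>x U. the_elem (snd ` U))"
  have \<eta>: "\<eta> x (gm k h) = h" if "in_hom h x b" for k h x
    using germ[OF that] by (simp add: \<eta>_def)
  have "\<eta> x \<in> hom (at colim x) (Hom C x b)" if x: "x \<in> Ob C" for x
  proof (rule homI)
    fix U assume U: "U \<in> carrier (at colim x)"
    then obtain k h where h: "in_hom h x b" "U = gm k h" using colim_carrier x by blast
    then show "\<eta> x U \<in> carrier (Hom C x b)" using \<eta>[OF h(1), of k] x b by (simp add: Mor_iff)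
    fix V assume U: "V \<in> carrier (at colim x)"
    then obtain k' h' where h': "in_hom h' x b" "V = gm k' h'" using colim_carrier x by blast
    then have V: "V = gm k h'" using germ by simp
    have "U \<otimes>\<^bsub>at colim x\<^esub> V = gm k (add h h')" using V h h' by (simp add: germ_mult)
    moreover have "in_hom (add h h') x b" "in_hom h x b" "in_hom h' x b" using h h' by simp_all
    ultimately show "\<eta> x (U \<otimes>\<^bsub>at colim x\<^esub> V) = \<eta> x U \<otimes>\<^bsub>Hom C x b\<^esub> \<eta> x V"
      using \<eta>[of _ x k] V h by (simp add: add_def)
  qed
  moreover have "bij_betw (\<eta> x) (carrier (at colim x)) (Mor C x b)" if x: "x \<in> Ob C" for x
    unfolding bij_betw_def
  proof
    show "inj_on (\<eta> x) (carrier (at colim x))"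
      using \<eta> germ x colim_carrier by (auto simp: inj_on_def simp del: in_hom_def)
    show "\<eta> x ` carrier (at colim x) = Mor C x b"
    proof
      show "\<eta> x ` carrier (at colim x) \<subseteq> Mor C x b"
      proof
        fix h assume "h \<in> \<eta> x ` carrier (at colim x)"
        then obtain k h' where "in_hom h' x b" "h = \<eta> x (gm k h')" using colim_carrier[OF x] by auto
        then show "h \<in> Mor C x b" using \<eta>[of h' x k] x b by (simp add: Mor_iff)
      qed
      show "Mor C x b \<subseteq> \<eta> x ` carrier (at colim x)"
      proof
        fix h assume "h \<in> Mor C x b"
        then have h: "in_hom h x b" using x b by (simp add: Mor_iff)
        then have "gm 0 h \<in> carrier (at colim x)" by simp
        then show "h \<in> \<eta> x ` carrier (at colim x)" using \<eta>[OF h, of 0] by (metis imageI)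
      qed
    qed
  qed
  moreover have "\<eta> x (act colim f U) = \<eta> y U \<cdot> f"
    if xy: "x \<in> Ob C" "y \<in> Ob C" "f \<in> Mor C x y" "U \<in> carrier (at colim y)" for x y f U
  proof -
    obtain k h where h: "in_hom h y b" "U = gm k h" using colim_carrier xy by blast
    moreover have "act colim f U = gm k (h \<cdot> f)" using h xy by (simp add: germ_act Mor_iff)
    moreover have "in_hom (h \<cdot> f) x b" using h xy by (simp add: Mor_iff)
    ultimately show ?thesis using \<eta> by metis
  qed
  ultimately have "\<eta> \<in> mod_iso C colim (yoneda C b)"
    by (simp add: mod_iso_def mod_hom_def yoneda_def iso_def)
  moreover have "\<forall>x \<in> Ob C. \<forall>k. \<forall>h \<in> Mor C x b. \<eta> x (gm k h) = h"
    using \<eta> b by (auto simp: Mor_iff)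
  ultimately show ?thesis using yoneda_module[OF b] unfolding is_colimY_def by blast
qed

end

section \<open>Homotopy colimits\<close>

text \<open>
  An inverse system of sets whose maps are eventually surjective has a compatible family through its
  stages: choose upwards from \<open>N\<close> and push down below it. It is stated for sets rather than groups so as
  to apply to the affine maps of an inhomogeneous system such as \<open>z i - z (i + 1) = c i\<close>.
\<close>

lemma mittag_leffler:
  assumes "\<And>i u. u \<in> Z (Suc i) \<Longrightarrow> \<rho> i u \<in> Z i"
    and "\<And>i u. N \<le> i \<Longrightarrow> u \<in> Z i \<Longrightarrow> \<exists>v \<in> Z (Suc i). \<rho> i v = u"
    and "Z N \<noteq> {}"
  shows "\<exists>z. \<forall>i. z i \<in> Z i \<and> \<rho> i (z (Suc i)) = z i"
  using assms
proof (induction N arbitrary: Z \<rho>)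
  case 0
  have "\<exists>z. \<forall>i. z i \<in> Z i \<and> \<rho> i (z (Suc i)) = z i"
    by (rule dependent_nat_choice[where P = "\<lambda>i u. u \<in> Z i" and Q = "\<lambda>i u v. \<rho> i v = u"])
      (use 0 in blast)+
  then show ?case .
next
  case (Suc N)
  have "\<exists>z. \<forall>i. z i \<in> Z (Suc i) \<and> \<rho> (Suc i) (z (Suc i)) = z i"
    by (rule Suc.IH[where Z = "\<lambda>i. Z (Suc i)" and \<rho> = "\<lambda>i. \<rho> (Suc i)"])
      (use Suc.prems Suc_le_mono in blast)+
  then obtain z where z: "\<And>i. z i \<in> Z (Suc i)" "\<And>i. \<rho> (Suc i) (z (Suc i)) = z i" by blast
  have "case_nat (\<rho> 0 (z 0)) z i \<in> Z i \<and> \<rho> i (case_nat (\<rho> 0 (z 0)) z (Suc i)) = case_nat (\<rho> 0 (z 0)) z i" for i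
    using z Suc.prems(1)[OF z(1)[of 0]] by (cases i) auto
  then show ?case by blast
qed

context triangulated_category
begin

lemma coproduct_simps:
  assumes "is_coproduct C X P \<iota>" "\<And>i. X i \<in> Ob C"
  shows "P \<in> Ob C" "arr (\<iota> i)" "dm (\<iota> i) = X i" "cd (\<iota> i) = P"
  using assms Mor_iff[of "X i" P "\<iota> i"] by (auto simp: is_coproduct_def)

lemma coproduct_map:
  assumes "is_coproduct C X P \<iota>" "\<And>i. X i \<in> Ob C" "y \<in> Ob C" "\<And>i. in_hom (f i) (X i) y"
  obtains g where "arr g" "dm g = P" "cd g = y" "\<And>i. g \<cdot> \<iota> i = f i"
proof -
  have "\<forall>i. f i \<in> Mor C (X i) y" using assms(2-4) by (simp add: Mor_iff)
  then obtain g where "g \<in> Mor C P y" "\<And>i. g \<cdot> \<iota> i = f i"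
    using assms(1,3) unfolding is_coproduct_def by blast
  then show ?thesis using coproduct_simps(1)[OF assms(1,2)] assms(3)
    by (intro that[of g]) (simp_all add: Mor_iff)
qed

lemma coproduct_ext:
  assumes "is_coproduct C X P \<iota>" "\<And>i. X i \<in> Ob C" "in_hom f P y" "in_hom g P y" "\<And>i. f \<cdot> \<iota> i = g \<cdot> \<iota> i"
  shows "f = g"
proof -
  note p = coproduct_simps[OF assms(1,2)]
  have y: "y \<in> Ob C" using assms(3) by auto
  have fg: "f \<in> Mor C P y" "g \<in> Mor C P y" using assms(3,4) p y by (simp_all add: Mor_iff)
  have "\<forall>i. g \<cdot> \<iota> i \<in> Mor C (X i) y" using assms(2,4) p y by (simp add: Mor_iff)
  then have "\<exists>!k. k \<in> Mor C P y \<and> (\<forall>i. k \<cdot> \<iota> i = g \<cdot> \<iota> i)"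
    using assms(1)[unfolded is_coproduct_def, THEN conjunct2, THEN conjunct2, THEN bspec, OF y,
        THEN spec[of _ "\<lambda>i. g \<cdot> \<iota> i"]] by blast
  then show ?thesis using fg assms(5) by (metis (no_types))
qed

text \<open>
  With the witnesses explicit, a homotopy colimit can be transported along an isomorphism by keeping
  \<open>P\<close> and \<open>s\<close> and changing only the end of the triangle.
\<close>

definition hocolim_via ::
  "(nat \<Rightarrow> 'o) \<Rightarrow> (nat \<Rightarrow> 'm) \<Rightarrow> 'o \<Rightarrow> (nat \<Rightarrow> 'm) \<Rightarrow> 'o \<Rightarrow> (nat \<Rightarrow> 'm) \<Rightarrow> 'm \<Rightarrow> 'm \<Rightarrow> 'm \<Rightarrow> bool" where
  "hocolim_via X x t \<kappa> P \<iota> s g h \<longleftrightarrow> is_coproduct C X P \<iota> \<and> in_hom s P P \<and>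
     (\<forall>i. s \<cdot> \<iota> i = \<iota> (Suc i) \<cdot> x i) \<and> (P, P, t, sub (Id C P) s, g, h) \<in> Tri C \<and> (\<forall>i. \<kappa> i = g \<cdot> \<iota> i)"

lemma is_hocolim_iff: "is_hocolim C X x t \<kappa> \<longleftrightarrow> (\<exists>P \<iota> s g h. hocolim_via X x t \<kappa> P \<iota> s g h)"
proof -
  have "hocolim_via X x t \<kappa> P \<iota> s g h \<longleftrightarrow> is_coproduct C X P \<iota> \<and>
        s \<in> Mor C P P \<and> (\<forall>i. s \<cdot> \<iota> i = \<iota> (Suc i) \<cdot> x i) \<and>
        (P, P, t, Id C P \<otimes>\<^bsub>Hom C P P\<^esub> neg_mor C P P s, g, h) \<in> Tri C \<and> (\<forall>i. \<kappa> i = g \<cdot> \<iota> i)"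
    (is "?l \<longleftrightarrow> ?r") for P \<iota> s g h
  proof (cases "is_coproduct C X P \<iota> \<and> in_hom s P P")
    case True
    then have P: "P \<in> Ob C" by (simp add: is_coproduct_def)
    then have "sub (Id C P) s = Id C P \<otimes>\<^bsub>Hom C P P\<^esub> neg_mor C P P s"
      using True by (simp add: sub_def add_def neg_def)
    then show ?thesis using True P by (simp add: hocolim_via_def Mor_iff)
  next
    case False
    moreover have "in_hom s P P" if "is_coproduct C X P \<iota>" "s \<in> Mor C P P"
      using that Mor_iff[of P P s] by (simp add: is_coproduct_def)
    ultimately show ?thesis unfolding hocolim_via_def by blast
  qed
  then show ?thesis unfolding is_hocolim_def by presburger
qed

lemma hocolim_viaD:
  assumes "hocolim_via X x t \<kappa> P \<iota> s g h" "\<And>i. X i \<in> Ob C"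
  shows "is_coproduct C X P \<iota>" "P \<in> Ob C" "t \<in> Ob C"
    "\<And>i. arr (\<iota> i)" "\<And>i. dm (\<iota> i) = X i" "\<And>i. cd (\<iota> i) = P"
    "arr s" "dm s = P" "cd s = P" "\<And>i. s \<cdot> \<iota> i = \<iota> (Suc i) \<cdot> x i"
    "(P, P, t, sub (Id C P) s, g, h) \<in> Tri C"
    "arr g" "dm g = P" "cd g = t" "arr h" "dm h = t" "cd h = sho P"
    "\<And>i. \<kappa> i = g \<cdot> \<iota> i"
proof -
  have 1: "is_coproduct C X P \<iota>" and t: "(P, P, t, sub (Id C P) s, g, h) \<in> Tri C"
    using assms(1) by (simp_all add: hocolim_via_def)
  note c = coproduct_simps[OF 1 assms(2)] and t' = triD[OF t]
  show "is_coproduct C X P \<iota>" by (rule 1)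
  show "(P, P, t, sub (Id C P) s, g, h) \<in> Tri C" by (rule t)
  show "P \<in> Ob C" "t \<in> Ob C" "arr g" "dm g = P" "cd g = t" "arr h" "dm h = t" "cd h = sho P"
    by (rule c t')+
  show "arr (\<iota> i)" "dm (\<iota> i) = X i" "cd (\<iota> i) = P" for i by (rule c)+
qed (use assms(1) in \<open>simp_all add: hocolim_via_def\<close>)

lemma hocolim_exists:
  assumes "is_coproduct C X P \<iota>" "\<And>i. in_hom (x i) (X i) (X (Suc i))"
  obtains t \<kappa> where "is_hocolim C X x t \<kappa>"
proof -
  have X: "X i \<in> Ob C" for i using in_homD(1)[OF assms(2)[of i]] .
  note c = coproduct_simps[OF assms(1) X]
  obtain s where s: "arr s" "dm s = P" "cd s = P" "\<And>i. s \<cdot> \<iota> i = \<iota> (Suc i) \<cdot> x i"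
  proof (rule coproduct_map[OF assms(1) X])
    show "in_hom (\<iota> (Suc i) \<cdot> x i) (X i) P" for i using c assms(2)[of i] by simp
  qed (use c in auto)
  obtain t g h where "(P, P, t, sub (Id C P) s, g, h) \<in> Tri C"
    using tri_cone[of P P "sub (Id C P) s"] c s by (auto simp: Mor_iff)
  then have "hocolim_via X x t (\<lambda>i. g \<cdot> \<iota> i) P \<iota> s g h"
    using assms(1) s by (simp add: hocolim_via_def)
  then have "is_hocolim C X x t (\<lambda>i. g \<cdot> \<iota> i)" using is_hocolim_iff by blast
  then show ?thesis by (rule that)
qed

lemma hocolim_legs:
  assumes "is_hocolim C X x t \<kappa>" "\<And>i. in_hom (x i) (X i) (X (Suc i))"
  shows "t \<in> Ob C" "arr (\<kappa> i)" "dm (\<kappa> i) = X i" "cd (\<kappa> i) = t" "\<kappa> (Suc i) \<cdot> x i = \<kappa> i"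
proof -
  have X: "X i \<in> Ob C" for i using in_homD(1)[OF assms(2)[of i]] .
  obtain P \<iota> s g h where "hocolim_via X x t \<kappa> P \<iota> s g h" using assms(1) is_hocolim_iff by blast
  note 1 = hocolim_viaD[OF this X]
  then show "t \<in> Ob C" "arr (\<kappa> i)" "dm (\<kappa> i) = X i" "cd (\<kappa> i) = t" by simp_all
  have "sub g (g \<cdot> s) = g \<cdot> sub (Id C P) s" using 1(1-9,12-17) by (simp add: cmp_sub)
  also have "\<dots> = zero_mor C P t" by (rule tri_comp[OF 1(11)])
  finally have gs: "g = g \<cdot> s" using 1(1-9,12-17) by (simp add: sub_eq_zero)
  have "\<kappa> (Suc i) \<cdot> x i = g \<cdot> (\<iota> (Suc i) \<cdot> x i)"
    using 1 assms(2)[of i] by (simp add: assoc)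
  also have "\<dots> = g \<cdot> (s \<cdot> \<iota> i)" using 1(10) by simp
  also have "\<dots> = (g \<cdot> s) \<cdot> \<iota> i" by (rule assoc[symmetric]) (use 1 in simp_all)
  also have "\<dots> = \<kappa> i" using gs 1(18) by simp
  finally show "\<kappa> (Suc i) \<cdot> x i = \<kappa> i" .
qed

lemma hocolim_map:
  assumes "is_hocolim C X x t \<kappa>" "\<And>i. in_hom (x i) (X i) (X (Suc i))"
    and y: "y \<in> Ob C" "\<And>i. in_hom (\<beta> i) (X i) y" "\<And>i. \<beta> (Suc i) \<cdot> x i = \<beta> i"
  obtains b where "arr b" "dm b = t" "cd b = y" "\<And>i. b \<cdot> \<kappa> i = \<beta> i"
proof -
  have X: "X i \<in> Ob C" for i using in_homD(1)[OF assms(2)[of i]] .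
  obtain P \<iota> s g h where "hocolim_via X x t \<kappa> P \<iota> s g h" using assms(1) is_hocolim_iff by blast
  note 1 = hocolim_viaD[OF this X]
  obtain c where c: "arr c" "dm c = P" "cd c = y" "\<And>i. c \<cdot> \<iota> i = \<beta> i"
    by (rule coproduct_map[OF 1(1) X y(1,2)]) (rule that)
  have "c = c \<cdot> s"
  proof (rule coproduct_ext[OF 1(1) X])
    fix i
    have "(c \<cdot> s) \<cdot> \<iota> i = c \<cdot> (\<iota> (Suc i) \<cdot> x i)" using 1 c by (simp add: assoc)
    also have "\<dots> = \<beta> (Suc i) \<cdot> x i" using c(4)[of "Suc i"] 1 c(1-3) assms(2)[of i]
        assoc[of "x i" "\<iota> (Suc i)" c] by simp
    finally show "c \<cdot> \<iota> i = (c \<cdot> s) \<cdot> \<iota> i" using y(3)[of i] c(4) by simp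
  qed (use 1 c in auto)
  then have "c \<cdot> sub (Id C P) s = zero_mor C P y" using 1 c by (simp add: cmp_sub sub_eq_zero)
  then obtain b where b: "arr b" "dm b = t" "cd b = y" "c = b \<cdot> g"
    using coexact_mid[OF 1(11), of c y] c by auto
  then have "b \<cdot> \<kappa> i = \<beta> i" for i using c(4)[of i] 1 by (simp add: assoc)
  with b show ?thesis by (intro that)
qed

lemma hocolim_iso:
  assumes "is_hocolim C X x t \<kappa>" "\<And>i. in_hom (x i) (X i) (X (Suc i))"
    and \<theta>: "in_hom \<theta> t t'" "in_hom \<theta>' t' t" "\<theta>' \<cdot> \<theta> = Id C t" "\<theta> \<cdot> \<theta>' = Id C t'"
  shows "is_hocolim C X x t' (\<lambda>i. \<theta> \<cdot> \<kappa> i)"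
proof -
  have X: "X i \<in> Ob C" for i using in_homD(1)[OF assms(2)[of i]] .
  obtain P \<iota> s g h where "hocolim_via X x t \<kappa> P \<iota> s g h" using assms(1) is_hocolim_iff by blast
  note 1 = hocolim_viaD[OF this X]
  have t': "t' \<in> Ob C" using \<theta>(2) by auto
  have "(P, P, t', sub (Id C P) s, \<theta> \<cdot> g, h \<cdot> \<theta>') \<in> Tri C"
  proof (rule tri_iso_closed[OF 1(11), where u = "Id C P" and v = "Id C P" and w = \<theta>])
    show "is_iso C t t' \<theta>" using is_isoI[OF \<theta>] .
    have "(h \<cdot> \<theta>') \<cdot> \<theta> = h \<cdot> (\<theta>' \<cdot> \<theta>)" by (rule assoc) (use \<theta> 1 in auto)
    then show "shm (Id C P) \<cdot> h = (h \<cdot> \<theta>') \<cdot> \<theta>" using \<theta> 1 by simp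
  qed (use 1 \<theta> t' in \<open>auto simp: Mor_iff\<close>)
  then have "hocolim_via X x t' (\<lambda>i. \<theta> \<cdot> \<kappa> i) P \<iota> s (\<theta> \<cdot> g) (h \<cdot> \<theta>')"
    using 1 \<theta> by (simp add: hocolim_via_def assoc)
  then show ?thesis using is_hocolim_iff by blast
qed

text \<open>
  A map that vanishes on all terms factors as a map \<open>w\<close> after the connecting map into the shifted
  coproduct. It is zero once \<open>w\<close> extends along the shift of \<open>id - shift\<close>, and the components of such
  an extension form a compatible family for an inhomogeneous inverse system. In other words, the first
  derived limit of \<open>Hom(X i, y)\<close> vanishes.
\<close>

lemma hocolim_no_phantom:
  assumes "is_hocolim C X x t \<kappa>" "\<And>i. in_hom (x i) (X i) (X (Suc i))"
    and g: "in_hom \<gamma> t (sho y)" "\<And>i. \<gamma> \<cdot> \<kappa> i = zero_mor C (X i) (sho y)" "y \<in> Ob C"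
    and surj: "\<And>i u. N \<le> i \<Longrightarrow> in_hom u (X i) y \<Longrightarrow> \<exists>w. in_hom w (X (Suc i)) y \<and> u = w \<cdot> x i"
  shows "\<gamma> = zero_mor C t (sho y)"
proof -
  have X: "X i \<in> Ob C" for i using in_homD(1)[OF assms(2)[of i]] .
  obtain P \<iota> s g h where "hocolim_via X x t \<kappa> P \<iota> s g h" using assms(1) is_hocolim_iff by blast
  note 1 = hocolim_viaD[OF this X]
  have x: "arr (x i)" "dm (x i) = X i" "cd (x i) = X (Suc i)" for i using assms(2)[of i] by auto
  have "\<gamma> \<cdot> g = zero_mor C P (sho y)"
    by (rule coproduct_ext[OF 1(1) X]) (use g 1 X in \<open>auto simp: assoc\<close>)
  then obtain w where w: "arr w" "dm w = sho P" "cd w = sho y" "\<gamma> = w \<cdot> h"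
    using coexact_right[OF 1(11) g(1)] by blast
  obtain v where v: "arr v" "dm v = P" "cd v = y" "w = shm v"
    by (rule shm_full[of w P y]) (use w 1 g in auto)
  \<comment> \<open>The components of an extension of \<open>v\<close> along \<open>id - shift\<close> have to satisfy this recursion.\<close>
  have "\<exists>z. \<forall>i. z i \<in> {u. in_hom u (X i) y} \<and> add (z (Suc i) \<cdot> x i) (v \<cdot> \<iota> i) = z i"
  proof (rule mittag_leffler[where \<rho> = "\<lambda>i u. add (u \<cdot> x i) (v \<cdot> \<iota> i)" and N = N])
    fix i u assume "u \<in> {u. in_hom u (X (Suc i)) y}"
    then show "add (u \<cdot> x i) (v \<cdot> \<iota> i) \<in> {u. in_hom u (X i) y}" using v 1 x by simp
  next
    fix i u assume i: "N \<le> i" and u: "u \<in> {u. in_hom u (X i) y}"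
    then obtain z where "in_hom z (X (Suc i)) y" "sub u (v \<cdot> \<iota> i) = z \<cdot> x i"
      using surj[OF i, of "sub u (v \<cdot> \<iota> i)"] v 1 by auto
    then show "\<exists>z\<in>{u. in_hom u (X (Suc i)) y}. add (z \<cdot> x i) (v \<cdot> \<iota> i) = u"
      using add_sub(1)[of u "v \<cdot> \<iota> i"] u v 1 by auto
  next
    have "in_hom (zero_mor C (X N) y) (X N) y" using X g(3) by simp
    then show "{u. in_hom u (X N) y} \<noteq> {}" by blast
  qed
  then obtain z where z: "\<And>i. in_hom (z i) (X i) y" "\<And>i. add (z (Suc i) \<cdot> x i) (v \<cdot> \<iota> i) = z i"
    by blast
  obtain c where c: "arr c" "dm c = P" "cd c = y" "\<And>i. c \<cdot> \<iota> i = z i"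
    by (rule coproduct_map[OF 1(1) X g(3) z(1)]) (rule that)
  have "v = c \<cdot> sub (Id C P) s"
  proof (rule coproduct_ext[OF 1(1) X])
    fix i
    have "(c \<cdot> sub (Id C P) s) \<cdot> \<iota> i = sub (c \<cdot> \<iota> i) (c \<cdot> (s \<cdot> \<iota> i))"
      using c(1-3) 1 by (simp add: cmp_sub sub_cmp assoc)
    also have "c \<cdot> (s \<cdot> \<iota> i) = (c \<cdot> \<iota> (Suc i)) \<cdot> x i"
      using c(1-3) 1 x by (simp add: assoc)
    also have "sub (c \<cdot> \<iota> i) ((c \<cdot> \<iota> (Suc i)) \<cdot> x i) = sub (add (z (Suc i) \<cdot> x i) (v \<cdot> \<iota> i)) (z (Suc i) \<cdot> x i)"
      using c(4) z(2) by simp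
    also have "\<dots> = v \<cdot> \<iota> i" by (rule add_sub(2)) (use z(1)[of "Suc i"] v 1 x in simp)
    finally show "v \<cdot> \<iota> i = (c \<cdot> sub (Id C P) s) \<cdot> \<iota> i" by simp
  qed (use 1 v c in auto)
  then have "\<gamma> = (shm c \<cdot> shm (sub (Id C P) s)) \<cdot> h" using w v c 1 by simp
  also have "\<dots> = shm c \<cdot> (shm (sub (Id C P) s) \<cdot> h)" by (rule assoc) (use c 1 in simp_all)
  also have "shm (sub (Id C P) s) \<cdot> h = zero_mor C t (sho P)" by (rule tri_comp'(2)[OF 1(11)])
  finally show ?thesis using c 1 by simp
qed

end

section \<open>Left orthogonals of a very good metric\<close>

locale metric_category = triangulated_category C
  for C :: "('o, 'm, 'x) tricat_scheme" (structure) +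
  fixes M :: "nat \<Rightarrow> 'o set"
  assumes very_good: "very_good_metric C M"
begin

lemma good: "good_metric C M"
  using very_good by (simp add: very_good_metric_def)

lemma M_Ob: "x \<in> M i \<Longrightarrow> x \<in> Ob C"
  using good by (auto simp: good_metric_def)

lemma M_Suc: "M (Suc i) \<subseteq> M i"
  using good by (auto simp: good_metric_def)

lemma M_mono: "i \<le> j \<Longrightarrow> M j \<subseteq> M i"
  using lift_Suc_antimono_le[of M] M_Suc by blast

lemma M_shift: "x \<in> M (Suc i) \<Longrightarrow> sho x \<in> M i"
  using good by (auto simp: good_metric_def)

lemma M_unshift: "x \<in> Ob C \<Longrightarrow> sho x \<in> M (Suc i) \<Longrightarrow> x \<in> M i"
  using good by (auto simp: good_metric_def)

lemma M_zero: "\<exists>z \<in> M i. is_zero_object C z"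
  using good by (auto simp: good_metric_def)

lemma M_ext: "(a, b, c, f, g, h) \<in> Tri C \<Longrightarrow> a \<in> M i \<Longrightarrow> c \<in> M i \<Longrightarrow> b \<in> M i"
proof -
  assume t: "(a, b, c, f, g, h) \<in> Tri C" "a \<in> M i" "c \<in> M i"
  have "ext_class C (M i) (M i) \<subseteq> M i" using good by (simp add: good_metric_def)
  moreover have "b \<in> ext_class C (M i) (M i)" using t unfolding ext_class_def by blast
  ultimately show "b \<in> M i" by blast
qed

text \<open>
  Closure under extensions and a zero object give closure under isomorphism: \<open>x \<longrightarrow> y \<longrightarrow> 0\<close> is a
  triangle.
\<close>

lemma M_iso:
  assumes "x \<in> M i" "in_hom f x y" "in_hom g y x" "g \<cdot> f = Id C x" "f \<cdot> g = Id C y"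
  shows "y \<in> M i"
proof -
  obtain z where z: "z \<in> M i" "is_zero_object C z" using M_zero by blast
  note [simp] = M_Ob[OF z(1)] M_Ob[OF assms(1)]
  have y: "y \<in> Ob C" using assms by auto
  have "(x, y, z, f, zero_mor C y z, zero_mor C z (sho x)) \<in> Tri C"
  proof (rule tri_iso_closed[OF tri_id[of x z], where u = "Id C x" and v = f and w = "Id C z"])
    show "is_iso C x y f" using is_isoI[OF assms(2-5)] .
  qed (use assms z y in \<open>auto simp: Mor_iff\<close>)
  then show ?thesis using M_ext z assms by blast
qed

abbreviation perp :: "nat \<Rightarrow> 'o set" where "perp n \<equiv> perp_left C (M n)"

lemma perp_Ob: "x \<in> perp n \<Longrightarrow> x \<in> Ob C"
  by (simp add: perp_left_def)

lemma perpD: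
  assumes "x \<in> perp n" "c \<in> M n" "in_hom u x c"
  shows "u = zero_mor C x c"
  using assms M_Ob[OF assms(2)] Mor_iff[of x c u] by (auto simp: perp_left_def)

lemma perpI:
  assumes "x \<in> Ob C" "\<And>c u. c \<in> M n \<Longrightarrow> in_hom u x c \<Longrightarrow> u = zero_mor C x c"
  shows "x \<in> perp n"
proof -
  have "Mor C x c = {zero_mor C x c}" if "c \<in> M n" for c
    using assms M_Ob[OF that] that Mor_iff[of x c] zero_simps[of x c] by auto
  then show ?thesis using assms by (simp add: perp_left_def)
qed

lemma perp_ex: "x \<in> Ob C \<Longrightarrow> \<exists>n. x \<in> perp n"
  using very_good by (auto simp: very_good_metric_def)

lemma perp_shift:
  assumes "x \<in> perp n"
  shows "sho x \<in> perp (Suc n)"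
proof (rule perpI)
  fix c u assume c: "c \<in> M (Suc n)" and u: "in_hom u (sho x) c"
  obtain d i j where d: "d \<in> Ob C" "in_hom i (sho d) c" "in_hom j c (sho d)"
    "j \<cdot> i = Id C (sho d)" "i \<cdot> j = Id C c" using unshift[OF M_Ob[OF c]] by blast
  have "sho d \<in> M (Suc n)" using M_iso[OF c d(3,2,5,4)] .
  then have "d \<in> M n" using M_unshift d by blast
  obtain v where v: "arr v" "dm v = x" "cd v = d" "j \<cdot> u = shm v"
    by (rule shm_full[of "j \<cdot> u" x d]) (use d u perp_Ob[OF assms] in auto)
  have "v = zero_mor C x d" using perpD[OF assms \<open>d \<in> M n\<close>] v by simp
  then have "j \<cdot> u = zero_mor C (sho x) (sho d)" using v perp_Ob[OF assms] d by simp
  then have "i \<cdot> (j \<cdot> u) = zero_mor C (sho x) c" using d perp_Ob[OF assms] by simp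
  then show "u = zero_mor C (sho x) c" using assoc[of u j i, symmetric] d u by simp
qed (use perp_Ob[OF assms] in simp)

lemma perp_unshift:
  assumes "x \<in> perp n" "y \<in> Ob C" "in_hom i (sho y) x" "in_hom j x (sho y)" "j \<cdot> i = Id C (sho y)" "i \<cdot> j = Id C x"
  shows "y \<in> perp (Suc n)"
proof (rule perpI[OF assms(2)])
  fix c u assume c: "c \<in> M (Suc n)" and u: "in_hom u y c"
  have "shm u \<cdot> j = zero_mor C x (sho c)"
    by (rule perpD[OF assms(1) M_shift[OF c]]) (use u assms in auto)
  then have "(shm u \<cdot> j) \<cdot> i = zero_mor C (sho y) (sho c)" using assms M_Ob[OF c] by simp
  moreover have "(shm u \<cdot> j) \<cdot> i = shm u" using assms(2-5) u assoc[of i j "shm u"] by simp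
  ultimately have "shm u = zero_mor C (sho y) (sho c)" by simp
  then show "u = zero_mor C y c" by (rule shm_faithful_zero[rotated 3]) (use u in auto)
qed

text \<open>
  By the second axiom of a very good metric, \<open>c\<close> sits in a triangle \<open>x \<longrightarrow> c \<longrightarrow> d\<close> with \<open>d\<close> in \<open>M i\<close>
  and \<open>x\<close> left orthogonal to \<open>M n\<close>. If \<open>x \<longrightarrow> c\<close> vanishes, then \<open>c\<close> is a summand of \<open>d\<close>.
\<close>

lemma mem_if_orthogonal:
  assumes "\<And>i. closed_under_summands C (M i)"
  shows "\<exists>n > i. \<forall>c \<in> Ob C. (\<forall>x \<in> perp n. \<forall>u. in_hom u x c \<longrightarrow> u = zero_mor C x c) \<longrightarrow> c \<in> M i"
proof -
  obtain n where n: "n > i" "\<And>c. c \<in> Ob C \<Longrightarrow> c \<in> ext_class C (perp n) (M i)"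
  proof -
    have "\<exists>n>i. \<forall>x \<in> Ob C. x \<in> ext_class C (perp n) (M i)"
      using very_good[unfolded very_good_metric_def, THEN conjunct2, THEN conjunct2] by (rule spec)
    then show ?thesis using that by blast
  qed
  have "c \<in> M i" if c: "c \<in> Ob C" "\<And>x u. x \<in> perp n \<Longrightarrow> in_hom u x c \<Longrightarrow> u = zero_mor C x c" for c
  proof -
    obtain x d f g h where t: "x \<in> perp n" "d \<in> M i" "(x, c, d, f, g, h) \<in> Tri C"
      using n(2)[OF c(1)] unfolding ext_class_def by blast
    note t' = triD[OF t(3)]
    have "f = zero_mor C x c" using c(2)[OF t(1), of f] t' by simp
    then have "is_biproduct C c (sho x) d" using biproduct_if_zero t(3) by simp
    then show ?thesis using assms[of i] t' t(2) unfolding closed_under_summands_def by (metis sho_Ob)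
  qed
  with n(1) show ?thesis by blast
qed

lemma const_cauchy:
  assumes "b \<in> Ob C"
  shows "cauchy C M (\<lambda>_. b) (\<lambda>_. Id C b)"
  unfolding cauchy_def
proof (intro conjI allI)
  show "is_seq C (\<lambda>_. b) (\<lambda>_. Id C b)" by (rule const_seq[OF assms])
  fix i
  obtain z where "z \<in> M i" "is_zero_object C z" using M_zero by blast
  then have "cone_in C (M i) b b (Id C b)" using tri_id[OF assms] unfolding cone_in_def by blast
  then show "\<exists>N. \<forall>j k. N \<le> j \<and> j < k \<longrightarrow>
      cone_in C (M i) b b (transit C (\<lambda>_. b) (\<lambda>_. Id C b) j k)"
    using transit_const[OF assms] by auto
qed

lemma cone_bij_on_hom:
  assumes "cone_in C (M (Suc n)) a b f" "x \<in> perp n"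
  shows "bij_on_hom x f"
proof -
  obtain c g h where c: "c \<in> M (Suc n)" and tri: "(a, b, c, f, g, h) \<in> Tri C"
    using assms unfolding cone_in_def by blast
  note t = triD[OF tri]
  note x = perp_Ob[OF assms(2)]
  show ?thesis
  proof (rule bij_on_homI)
    fix v assume v: "in_hom v x (dm f) \<and> f \<cdot> v = zero_mor C x (cd f)"
    have "shm f \<cdot> shm v = shm (f \<cdot> v)" using v t by (intro shm_cmp[symmetric]) auto
    also have "\<dots> = zero_mor C (sho x) (sho b)" using v t x by simp
    finally obtain w where w: "arr w" "dm w = sho x" "cd w = c" "shm v = h \<cdot> w"
      using exact_shift[OF tri, of "shm v" "sho x"] v t by auto
    have "w = zero_mor C (sho x) c" by (rule perpD[OF perp_shift[OF assms(2)] c]) (use w in auto)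
    then have "shm v = zero_mor C (sho x) (sho a)" using w t x by simp
    then have "v = zero_mor C x a" by (rule shm_faithful_zero[rotated 3]) (use v t in auto)
    then show "v = zero_mor C x (dm f)" using t by simp
  next
    fix v assume v: "in_hom v x (cd f)"
    have "g \<cdot> v = zero_mor C x c"
      by (rule perpD[OF assms(2)]) (use c M_Suc v t in auto)
    then show "\<exists>w. in_hom w x (dm f) \<and> v = f \<cdot> w"
      using exact_mid[OF tri, of v x] v t by auto
  qed
qed

lemma perp_desuspend:
  assumes "x \<in> perp n"
  obtains y i j where "y \<in> perp (Suc n)" "in_hom i (sho y) x" "in_hom j x (sho y)"
    "j \<cdot> i = Id C (sho y)" "i \<cdot> j = Id C x"
proof -
  obtain y i j where y: "y \<in> Ob C" "in_hom i (sho y) x" "in_hom j x (sho y)"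
    "j \<cdot> i = Id C (sho y)" "i \<cdot> j = Id C x" using unshift[OF perp_Ob[OF assms]] by blast
  then show ?thesis using perp_unshift[OF assms y] that by blast
qed

lemma bij_on_perp_shift:
  assumes "\<And>y. y \<in> perp (Suc n) \<Longrightarrow> bij_on_hom y u" "arr u" "x \<in> perp n"
  shows "bij_on_hom x (shm u)"
proof -
  obtain y i j where y: "y \<in> perp (Suc n)" "in_hom i (sho y) x" "in_hom j x (sho y)"
    "j \<cdot> i = Id C (sho y)" "i \<cdot> j = Id C x" using perp_desuspend[OF assms(3)] by blast
  show ?thesis
    by (rule bij_on_hom_source[OF y(2-5)])
      (use bij_on_hom_shift[OF assms(2) perp_Ob[OF y(1)] assms(1)[OF y(1)]] assms(2) in auto)
qed

lemma cauchyD: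
  assumes "cauchy C M a d"
  shows "is_seq C a d" "\<exists>N. \<forall>j k. N \<le> j \<and> j < k \<longrightarrow> cone_in C (M i) (a j) (a k) (transit C a d j k)"
  using assms by (auto simp: cauchy_def)

end

section \<open>Good extensions\<close>

locale good_ext = S: metric_category S M + T: triangulated_category T
  for S :: "('o, 'm, 'x) tricat_scheme" and M :: "nat \<Rightarrow> 'o set"
    and T :: "('p, 'n, 'y) tricat_scheme" +
  fixes F :: "('o, 'm, 'p, 'n) fctr" and \<phi> :: "'o \<Rightarrow> 'n"
  assumes good_extension: "good_extension S M T F \<phi>"
    and summands: "\<And>i. closed_under_summands S (M i)"
begin

abbreviation compS :: "'m \<Rightarrow> 'm \<Rightarrow> 'm"  (infixl \<open>\<star>\<close> 75) where "g \<star> f \<equiv> g \<cdot>\<^bsub>S\<^esub> f"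
abbreviation compT :: "'n \<Rightarrow> 'n \<Rightarrow> 'n"  (infixl \<open>\<bullet>\<close> 75) where "g \<bullet> f \<equiv> g \<cdot>\<^bsub>T\<^esub> f"
abbreviation FO :: "'o \<Rightarrow> 'p" where "FO \<equiv> Fo F"
abbreviation FM :: "'m \<Rightarrow> 'n" where "FM \<equiv> Fm F"

abbreviation F_bij :: "'o \<Rightarrow> 'n \<Rightarrow> bool" where "F_bij x \<equiv> T.bij_on_hom (FO x)"

abbreviation F_bij_from :: "nat \<Rightarrow> nat \<Rightarrow> (nat \<Rightarrow> 'n) \<Rightarrow> bool" where
  "F_bij_from N n \<psi> \<equiv> \<forall>i\<ge>N. \<forall>x \<in> S.perp n. F_bij x (\<psi> i)"

lemma F_tri_functor: "triangulated_functor S T F \<phi>"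
  using good_extension by (simp add: good_extension_def)

lemma F_ff: "ff_fun S T F"
proof
  show "additive_functor S T F" using F_tri_functor by (simp add: triangulated_functor_def)
  show "fully_faithful S T F" using good_extension by (simp add: good_extension_def)
qed

lemma F_add: "additive_fun S T F"
  using F_ff by (simp add: ff_fun_def)

lemmas FO_Ob [simp] = additive_fun.obj[OF F_add]
lemmas FM_simps [simp] = additive_fun.map_simps[OF F_add]
lemmas FM_Id [simp] = additive_fun.map_Id[OF F_add]
lemmas FM_cmp [simp] = additive_fun.map_cmp[OF F_add]
lemmas FM_zero [simp] = additive_fun.map_zero[OF F_add]
lemmas F_full = ff_fun.full[OF F_ff]
lemmas F_faithful = ff_fun.faithful[OF F_ff]
lemmas F_faithful_zero = ff_fun.faithful_zero[OF F_ff]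

lemma F_tri:
  assumes "(a, b, c, f, g, h) \<in> Tri S"
  shows "(FO a, FO b, FO c, FM f, FM g, \<phi> a \<bullet> FM h) \<in> Tri T"
  using F_tri_functor assms unfolding triangulated_functor_def by (elim conjE) simp

text \<open>
  A function of the object, so that rewriting can cancel it against \<open>\<phi>\<close>.
\<close>

definition phi_inv :: "'o \<Rightarrow> 'n" where
  "phi_inv a = (SOME \<psi>. T.in_hom \<psi> (T.sho (FO a)) (FO (S.sho a)) \<and>
     \<psi> \<bullet> \<phi> a = Id T (FO (S.sho a)) \<and> \<phi> a \<bullet> \<psi> = Id T (T.sho (FO a)))"

lemma phi_simps [simp]:
  assumes "a \<in> Ob S"
  shows "T.arr (\<phi> a)" "T.dm (\<phi> a) = FO (S.sho a)" "T.cd (\<phi> a) = T.sho (FO a)"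
    "T.arr (phi_inv a)" "T.dm (phi_inv a) = T.sho (FO a)" "T.cd (phi_inv a) = FO (S.sho a)"
    "phi_inv a \<bullet> \<phi> a = Id T (FO (S.sho a))" "\<phi> a \<bullet> phi_inv a = Id T (T.sho (FO a))"
proof -
  have iso: "is_iso T (FO (S.sho a)) (T.sho (FO a)) (\<phi> a)"
    using F_tri_functor assms unfolding triangulated_functor_def by simp
  have ob: "FO (S.sho a) \<in> Ob T" "T.sho (FO a) \<in> Ob T" using assms by simp_all
  have hom: "T.in_hom (\<phi> a) (FO (S.sho a)) (T.sho (FO a))"
    and ex: "\<exists>\<psi>. T.in_hom \<psi> (T.sho (FO a)) (FO (S.sho a)) \<and>
     \<psi> \<bullet> \<phi> a = Id T (FO (S.sho a)) \<and> \<phi> a \<bullet> \<psi> = Id T (T.sho (FO a))"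
    using T.is_isoE[OF iso ob] by blast+
  from someI_ex[OF ex, folded phi_inv_def] hom
  show "T.arr (\<phi> a)" "T.dm (\<phi> a) = FO (S.sho a)" "T.cd (\<phi> a) = T.sho (FO a)"
    "T.arr (phi_inv a)" "T.dm (phi_inv a) = T.sho (FO a)" "T.cd (phi_inv a) = FO (S.sho a)"
    "phi_inv a \<bullet> \<phi> a = Id T (FO (S.sho a))" "\<phi> a \<bullet> phi_inv a = Id T (T.sho (FO a))"
    by simp_all
qed

lemma bij_F_shift:
  assumes "x \<in> Ob S" "T.arr u" "F_bij x u"
  shows "F_bij (S.sho x) (T.shm u)"
  by (rule T.bij_on_hom_source[of "phi_inv x" "T.sho (FO x)" _ "\<phi> x"])
    (use T.bij_on_hom_shift[OF assms(2) _ assms(3)] assms in auto)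

lemma bij_F_unshift:
  assumes "x \<in> Ob S" "T.arr u" "F_bij (S.sho x) (T.shm u)"
  shows "F_bij x u"
  by (rule T.bij_on_hom_unshift)
      (use assms T.bij_on_hom_source[of "\<phi> x" "FO (S.sho x)" "T.sho (FO x)" "phi_inv x", of "T.shm u"] in auto)

lemma bij_F_iso:
  assumes "S.in_hom i y x" "S.in_hom j x y" "j \<star> i = Id S y" "i \<star> j = Id S x"
    "T.arr u" "F_bij y u"
  shows "F_bij x u"
proof (rule T.bij_on_hom_source[OF _ _ _ _ assms(5,6)])
  have "FM j \<bullet> FM i = FM (Id S y)" using assms(1,2) by (simp add: assms(3)[symmetric])
  then show "FM j \<bullet> FM i = Id T (FO y)" using S.in_homD[OF assms(1)] by simp
  have "FM i \<bullet> FM j = FM (Id S x)" using assms(1,2) by (simp add: assms(4)[symmetric])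
  then show "FM i \<bullet> FM j = Id T (FO x)" using S.in_homD[OF assms(1)] by simp
qed (use assms in auto)

text \<open>
  The right orthogonal of the image of \<open>F\<close>, and below its left orthogonal. The latter replaces the
  localizing subcategory generated by the image: it contains all homotopy colimits considered here,
  it is closed under cones and shifts, and on it maps from the \<open>F x\<close> detect isomorphisms.
\<close>

definition null :: "'p \<Rightarrow> bool" where
  "null q \<longleftrightarrow> q \<in> Ob T \<and> (\<forall>x \<in> Ob S. \<forall>u. T.in_hom u (FO x) q \<longrightarrow> u = zero_mor T (FO x) q)"

definition generated :: "'p \<Rightarrow> bool" where
  "generated t \<longleftrightarrow> t \<in> Ob T \<and> (\<forall>q u. null q \<and> T.in_hom u t q \<longrightarrow> u = zero_mor T t q)"

lemma nullD: "null q \<Longrightarrow> x \<in> Ob S \<Longrightarrow> T.in_hom u (FO x) q \<Longrightarrow> u = zero_mor T (FO x) q"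
  by (simp add: null_def)

lemma null_Ob: "null q \<Longrightarrow> q \<in> Ob T"
  by (simp add: null_def)

lemma generatedD: "generated t \<Longrightarrow> null q \<Longrightarrow> T.in_hom u t q \<Longrightarrow> u = zero_mor T t q"
  unfolding generated_def by blast

lemma generated_Ob: "generated t \<Longrightarrow> t \<in> Ob T"
  by (simp add: generated_def)

lemma generated_F: "x \<in> Ob S \<Longrightarrow> generated (FO x)"
  by (simp add: generated_def null_def)

lemma null_iso:
  assumes "null q" "T.in_hom i q r" "T.in_hom j r q" "i \<bullet> j = Id T r"
  shows "null r"
  unfolding null_def
proof (intro conjI ballI allI impI)
  show "r \<in> Ob T" using assms by auto
  fix x u assume x: "x \<in> Ob S" and u: "T.in_hom u (FO x) r"
  have "j \<bullet> u = zero_mor T (FO x) q" by (rule nullD[OF assms(1) x]) (use assms u in auto)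
  then have "i \<bullet> (j \<bullet> u) = zero_mor T (FO x) r" using assms(2) x by simp
  moreover have "i \<bullet> (j \<bullet> u) = u" using T.assoc[of u j i] assms(2-4) u by simp
  ultimately show "u = zero_mor T (FO x) r" by simp
qed

lemma null_shift:
  assumes "null q"
  shows "null (T.sho q)"
  unfolding null_def
proof (intro conjI ballI allI impI)
  note q = null_Ob[OF assms]
  show "T.sho q \<in> Ob T" using q by simp
  fix x u assume x: "x \<in> Ob S" and u: "T.in_hom u (FO x) (T.sho q)"
  obtain y i j where y: "y \<in> Ob S" "S.in_hom i (S.sho y) x" "S.in_hom j x (S.sho y)"
    "j \<star> i = Id S (S.sho y)" "i \<star> j = Id S x" using S.unshift[OF x] by blast
  obtain v where v: "T.arr v" "T.dm v = FO y" "T.cd v = q" "u \<bullet> (FM i \<bullet> phi_inv y) = T.shm v"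
    by (rule T.shm_full[of "u \<bullet> (FM i \<bullet> phi_inv y)" "FO y" q]) (use u y q in auto)
  have "v = zero_mor T (FO y) q" by (rule nullD[OF assms y(1)]) (use v in auto)
  then have "u \<bullet> (FM i \<bullet> phi_inv y) = zero_mor T (T.sho (FO y)) (T.sho q)" using v q y by simp
  then have "(u \<bullet> (FM i \<bullet> phi_inv y)) \<bullet> (\<phi> y \<bullet> FM j) = zero_mor T (FO x) (T.sho q)"
    using y q x by simp
  moreover have "(u \<bullet> (FM i \<bullet> phi_inv y)) \<bullet> (\<phi> y \<bullet> FM j) = u"
  proof -
    have "phi_inv y \<bullet> (\<phi> y \<bullet> FM j) = FM j"
      using T.assoc[of "FM j" "\<phi> y" "phi_inv y", symmetric] y by simp
    moreover have "FM i \<bullet> FM j = Id T (FO x)"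
      using y x FM_cmp[of j i, symmetric] by (simp del: FM_cmp)
    ultimately show ?thesis using y(1-3) u by (simp add: T.assoc)
  qed
  ultimately show "u = zero_mor T (FO x) (T.sho q)" by simp
qed

lemma null_unshift:
  assumes "null (T.sho q)" "q \<in> Ob T"
  shows "null q"
  unfolding null_def
proof (intro conjI ballI allI impI)
  fix x u assume x: "x \<in> Ob S" and u: "T.in_hom u (FO x) q"
  have "T.shm u \<bullet> \<phi> x = zero_mor T (FO (S.sho x)) (T.sho q)"
    by (rule nullD[OF assms(1)]) (use x u in auto)
  then have "(T.shm u \<bullet> \<phi> x) \<bullet> phi_inv x = zero_mor T (T.sho (FO x)) (T.sho q)"
    using x assms(2) by simp
  moreover have "(T.shm u \<bullet> \<phi> x) \<bullet> phi_inv x = T.shm u" using x u by (simp add: T.assoc)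
  ultimately have "T.shm u = zero_mor T (T.sho (FO x)) (T.sho q)" by simp
  then show "u = zero_mor T (FO x) q" by (rule T.shm_faithful_zero[rotated 3]) (use u in auto)
qed (rule assms)

lemma generated_shift:
  assumes "generated t"
  shows "generated (T.sho t)"
  unfolding generated_def
proof (intro conjI allI impI)
  note t = generated_Ob[OF assms]
  show "T.sho t \<in> Ob T" using t by simp
  fix q u assume qu: "null q \<and> T.in_hom u (T.sho t) q"
  note q = null_Ob[of q]
  obtain r i j where r: "r \<in> Ob T" "T.in_hom i (T.sho r) q" "T.in_hom j q (T.sho r)"
    "j \<bullet> i = Id T (T.sho r)" "i \<bullet> j = Id T q" using T.unshift[of q] qu q by blast
  have "null (T.sho r)" using null_iso[of q j "T.sho r" i] r qu by blast
  then have n: "null r" using null_unshift r by blast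
  obtain v where v: "T.arr v" "T.dm v = t" "T.cd v = r" "j \<bullet> u = T.shm v"
    by (rule T.shm_full[of "j \<bullet> u" t r]) (use qu r t in auto)
  have "v = zero_mor T t r" by (rule generatedD[OF assms n]) (use v in auto)
  then have "j \<bullet> u = zero_mor T (T.sho t) (T.sho r)" using v r t by simp
  then have "i \<bullet> (j \<bullet> u) = zero_mor T (T.sho t) q" using r t by simp
  moreover have "i \<bullet> (j \<bullet> u) = u" using T.assoc[of u j i] r qu by simp
  ultimately show "u = zero_mor T (T.sho t) q" by simp
qed

lemma generated_unshift:
  assumes "generated (T.sho t)" "t \<in> Ob T"
  shows "generated t"
  unfolding generated_def
proof (intro conjI allI impI)
  fix q u assume qu: "null q \<and> T.in_hom u t q"
  have "T.shm u = zero_mor T (T.sho t) (T.sho q)"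
    by (rule generatedD[OF assms(1) null_shift]) (use qu in auto)
  then show "u = zero_mor T t q" by (rule T.shm_faithful_zero[rotated 3]) (use qu in auto)
qed (rule assms)

lemma generated_third:
  assumes "(a, b, c, f, g, h) \<in> Tri T" "generated a" "generated b"
  shows "generated c"
  unfolding generated_def
proof (intro conjI allI impI)
  note t = T.triD[OF assms(1)]
  show "c \<in> Ob T" by (rule t)
  fix q u assume qu: "null q \<and> T.in_hom u c q"
  have "u \<bullet> g = zero_mor T b q" by (rule generatedD[OF assms(3)]) (use qu t in auto)
  then obtain w where w: "T.arr w" "T.dm w = T.sho a" "T.cd w = q" "u = w \<bullet> h"
    using T.coexact_right[OF assms(1), of u q] qu by blast
  have "w = zero_mor T (T.sho a) q" by (rule generatedD[OF generated_shift[OF assms(2)]]) (use qu w in auto)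
  then show "u = zero_mor T c q" using w t null_Ob[of q] qu by simp
qed

lemma generated_hocolim:
  assumes "is_hocolim T X x t \<kappa>" "\<And>i. T.in_hom (x i) (X i) (X (Suc i))" "\<And>i. generated (X i)"
  shows "generated t"
proof -
  obtain P \<iota> s g h where "T.hocolim_via X x t \<kappa> P \<iota> s g h" using assms(1) T.is_hocolim_iff by blast
  note 1 = T.hocolim_viaD[OF this generated_Ob[OF assms(3)]]
  have "generated P"
    unfolding generated_def
  proof (intro conjI allI impI)
    show "P \<in> Ob T" by (rule 1)
    fix q u assume qu: "null q \<and> T.in_hom u P q"
    show "u = zero_mor T P q"
    proof (rule T.coproduct_ext[OF 1(1)])
      fix i
      have "u \<bullet> \<iota> i = zero_mor T (X i) q" by (rule generatedD[OF assms(3)]) (use qu 1 in auto)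
      then show "u \<bullet> \<iota> i = zero_mor T P q \<bullet> \<iota> i" using 1 qu null_Ob[of q] by simp
    qed (use qu 1 generated_Ob[OF assms(3)] null_Ob[of q] in auto)
  qed
  then show ?thesis using generated_third[OF 1(11)] by blast
qed

text \<open>
  The cone of such a \<open>\<theta>\<close> is both null and generated, so its identity vanishes.
\<close>

lemma generated_iso:
  assumes "generated t" "generated t'" "T.in_hom \<theta> t t'" "\<And>x. x \<in> Ob S \<Longrightarrow> F_bij x \<theta>"
  obtains \<theta>' where "T.in_hom \<theta>' t' t" "\<theta>' \<bullet> \<theta> = Id T t" "\<theta> \<bullet> \<theta>' = Id T t'"
proof -
  note tt = generated_Ob[OF assms(1)] generated_Ob[OF assms(2)]
  obtain q g h where tri: "(t, t', q, \<theta>, g, h) \<in> Tri T"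
    using T.tri_cone[of t t' \<theta>] assms(3) tt by (auto simp: T.Mor_iff)
  note tr = T.triD[OF tri]
  have "null q"
    unfolding null_def
  proof (intro conjI ballI allI impI)
    show "q \<in> Ob T" by (rule tr)
    fix x u assume x: "x \<in> Ob S" and u: "T.in_hom u (FO x) q"
    obtain y i j where y: "y \<in> Ob S" "S.in_hom i (S.sho y) x" "S.in_hom j x (S.sho y)"
      "j \<star> i = Id S (S.sho y)" "i \<star> j = Id S x" using S.unshift[OF x] by blast
    have "F_bij (S.sho y) (T.shm \<theta>)" using bij_F_shift[OF y(1) _ assms(4)] tr y by simp
    \<comment> \<open>Every object of \<open>S\<close> is a shift, so bijectivity passes to the shift of \<open>\<theta>\<close>.\<close>
    then have bij: "F_bij x (T.shm \<theta>)" using bij_F_iso[OF y(2-5)] tr by simp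
    have "T.shm \<theta> \<bullet> (h \<bullet> u) = (T.shm \<theta> \<bullet> h) \<bullet> u"
      by (rule T.assoc[symmetric]) (use tr u in auto)
    also have "\<dots> = zero_mor T (FO x) (T.sho t')" using T.tri_comp'(2)[OF tri] tr u by simp
    finally have "h \<bullet> u = zero_mor T (FO x) (T.sho t)"
      using bij tr u unfolding T.bij_on_hom_def T.inj_on_hom_def by simp
    then obtain w where w: "T.arr w" "T.dm w = FO x" "T.cd w = t'" "u = g \<bullet> w"
      using T.exact_right[OF tri u] by blast
    obtain v where v: "T.arr v" "T.dm v = FO x" "T.cd v = t" "w = \<theta> \<bullet> v"
      by (rule T.surj_on_homE[of "FO x" \<theta> w]) (use assms(4)[OF x] w tr in \<open>auto simp: T.bij_on_hom_def\<close>)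
    have "u = (g \<bullet> \<theta>) \<bullet> v" using w v tr by (simp add: T.assoc)
    then show "u = zero_mor T (FO x) q" using T.tri_comp[OF tri] v tr by simp
  qed
  moreover have "generated q" using generated_third[OF tri assms(1,2)] .
  ultimately have "Id T q = zero_mor T q q" using generatedD[of q q "Id T q"] tr by simp
  then have "is_zero_object T q" using tr by (simp add: is_zero_object_def)
  then show ?thesis using T.iso_if_zero_cone[OF tri] that by blast
qed

abbreviation hocolimF :: "(nat \<Rightarrow> 'o) \<Rightarrow> (nat \<Rightarrow> 'm) \<Rightarrow> 'p \<Rightarrow> (nat \<Rightarrow> 'n) \<Rightarrow> bool" where
  "hocolimF a d t \<kappa> \<equiv> is_hocolim T (\<lambda>i. FO (a i)) (\<lambda>i. FM (d i)) t \<kappa>"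

abbreviation RY :: "'p \<Rightarrow> ('o, 'm, 'n) cmod" where "RY \<equiv> restricted_yoneda T F"

lemma F_seq:
  assumes "is_seq S a d"
  shows "T.in_hom (FM (d i)) (FO (a i)) (FO (a (Suc i)))"
proof -
  interpret A: sequence S a d by unfold_locales (rule assms)
  show ?thesis by simp
qed

lemma hocolimF_exists:
  assumes "cauchy S M a d"
  obtains t \<kappa> where "hocolimF a d t \<kappa>"
proof -
  obtain P \<iota> where "is_coproduct T (\<lambda>i. FO (a i)) P \<iota>"
    using good_extension assms unfolding good_extension_def by blast
  from T.hocolim_exists[OF this, of "\<lambda>i. FM (d i)"] show ?thesis
    using that F_seq[OF S.cauchyD(1)[OF assms]] by blast
qed

lemma hocolimF_legs:
  assumes "is_seq S a d" "hocolimF a d t \<kappa>"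
  shows "t \<in> Ob T" "T.arr (\<kappa> i)" "T.dm (\<kappa> i) = FO (a i)" "T.cd (\<kappa> i) = t"
    "\<kappa> (Suc i) \<bullet> FM (d i) = \<kappa> i"
  by (rule T.hocolim_legs[OF assms(2) F_seq[OF assms(1)]])+

lemma hocolimF_generated:
  assumes "is_seq S a d" "hocolimF a d t \<kappa>"
  shows "generated t"
proof -
  interpret A: sequence S a d by unfold_locales (rule assms)
  show ?thesis by (rule generated_hocolim[OF assms(2) F_seq[OF assms(1)]]) (simp add: generated_F)
qed

lemma hocolimF_colimY:
  assumes "cauchy S M a d" "hocolimF a d t \<kappa>"
  shows "is_colimY S a d (RY t) (\<lambda>k _ h. \<kappa> k \<bullet> FM h)"
  using good_extension assms unfolding good_extension_def by blast

lemma RY_simps [simp]: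
  "at (RY t) x = Hom T (FO x) t" "act (RY t) f u = u \<bullet> FM f"
  by (simp_all add: restricted_yoneda_def)

lemma hocolimF_colimE:
  assumes "cauchy S M a d" "hocolimF a d t \<kappa>"
  obtains \<eta> where "RY t \<in> Modules S" "\<eta> \<in> mod_iso S (colimY S a d) (RY t)"
    "\<And>x k h. S.in_hom h x (a k) \<Longrightarrow> \<eta> x (germ S a d k h) = \<kappa> k \<bullet> FM h"
proof -
  interpret A: sequence S a d by unfold_locales (rule S.cauchyD[OF assms(1)])
  obtain \<eta> where \<eta>: "RY t \<in> Modules S" "\<eta> \<in> mod_iso S (colimY S a d) (RY t)"
    "\<forall>x \<in> Ob S. \<forall>k. \<forall>h \<in> Mor S x (a k). \<eta> x (germ S a d k h) = \<kappa> k \<bullet> FM h"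
    using hocolimF_colimY[OF assms] unfolding is_colimY_def by blast
  show ?thesis
  proof (rule that[OF \<eta>(1,2)])
    fix x k h assume "S.in_hom h x (a k)"
    then have "x \<in> Ob S" "h \<in> Mor S x (a k)" by (auto simp: S.Mor_iff)
    then show "\<eta> x (germ S a d k h) = \<kappa> k \<bullet> FM h" using \<eta>(3) by blast
  qed
qed

text \<open>
  Every map from \<open>F x\<close> to the homotopy colimit comes from a finite stage. This and \<open>hocolimF_zero\<close>
  unfold the surjectivity and the injectivity of the comparison map in the definition of a good
  extension.
\<close>

lemma hocolimF_surj:
  assumes "cauchy S M a d" "hocolimF a d t \<kappa>" "T.in_hom u (FO x) t" "x \<in> Ob S"
  obtains k h where "S.arr h" "S.dm h = x" "S.cd h = a k" "u = \<kappa> k \<bullet> FM h"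
proof -
  interpret A: sequence S a d by unfold_locales (rule S.cauchyD[OF assms(1)])
  obtain \<eta> where \<eta>: "RY t \<in> Modules S" "\<eta> \<in> mod_iso S (colimY S a d) (RY t)"
    "\<And>x k h. S.in_hom h x (a k) \<Longrightarrow> \<eta> x (germ S a d k h) = \<kappa> k \<bullet> FM h"
    by (rule hocolimF_colimE[OF assms(1,2)]) (rule that)
  have "\<eta> x \<in> iso (at A.colim x) (at (RY t) x)" using \<eta>(2) assms(4) by (simp add: mod_iso_def)
  then have "\<eta> x ` carrier (at A.colim x) = Mor T (FO x) t" by (simp add: iso_def bij_betw_def)
  moreover have "u \<in> Mor T (FO x) t" using T.in_homD(3)[OF assms(3)] .
  ultimately obtain U where U: "U \<in> carrier (at A.colim x)" "u = \<eta> x U" by blast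
  obtain k h where h: "S.in_hom h x (a k)" "U = A.gm k h"
    using A.colim_carrier[OF assms(4)] U(1) by blast
  then have "u = \<kappa> k \<bullet> FM h" using U \<eta>(3) by blast
  then show ?thesis by (intro that[of h k]) (use h in simp_all)
qed

lemma hocolimF_zero:
  assumes "cauchy S M a d" "hocolimF a d t \<kappa>" "S.in_hom h x (a k)" "\<kappa> k \<bullet> FM h = zero_mor T (FO x) t"
  obtains l where "k \<le> l" "transit S a d k l \<star> h = zero_mor S x (a l)"
proof -
  interpret A: sequence S a d by unfold_locales (rule S.cauchyD[OF assms(1)])
  obtain \<eta> where \<eta>: "RY t \<in> Modules S" "\<eta> \<in> mod_iso S (colimY S a d) (RY t)"
    "\<And>x k h. S.in_hom h x (a k) \<Longrightarrow> \<eta> x (germ S a d k h) = \<kappa> k \<bullet> FM h"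
    by (rule hocolimF_colimE[OF assms(1,2)]) (rule that)
  note lg = hocolimF_legs[OF S.cauchyD(1)[OF assms(1)] assms(2)]
  have h: "S.arr h" "S.dm h = x" "S.cd h = a k" and x: "x \<in> Ob S" using assms(3) by auto
  have "\<eta> x \<in> iso (at A.colim x) (at (RY t) x)" using \<eta>(2) x by (simp add: mod_iso_def)
  then have inj: "inj_on (\<eta> x) (carrier (at A.colim x))" by (simp add: iso_def bij_betw_def)
  have "\<eta> x (A.gm k (zero_mor S x (a k))) = \<kappa> k \<bullet> FM (zero_mor S x (a k))"
    by (rule \<eta>(3)) (use x in simp)
  also have "\<dots> = zero_mor T (FO x) t" using lg x by simp
  also have "\<dots> = \<eta> x (A.gm k h)" using \<eta>(3)[OF assms(3)] assms(4) by simp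
  finally have "A.gm k (zero_mor S x (a k)) = A.gm k h"
    using inj x h by (simp add: inj_on_eq_iff)
  then obtain l where "k \<le> l" "A.tr k l \<star> h = A.tr k l \<star> zero_mor S x (a k)"
    using A.germ_eq_iff[where h = "zero_mor S x (a k)" and x = x and k = k and h' = h and k' = k] x h by auto
  then show ?thesis using that x by simp
qed

lemma legs_transit:
  assumes "is_seq S a d" "\<And>i. T.in_hom (\<psi> i) (FO (a i)) t" "\<And>i. \<psi> (Suc i) \<bullet> FM (d i) = \<psi> i" "k \<le> l"
  shows "\<psi> l \<bullet> FM (transit S a d k l) = \<psi> k"
proof -
  interpret A: sequence S a d by unfold_locales (rule assms)
  have \<psi>: "T.arr (\<psi> i)" "T.dm (\<psi> i) = FO (a i)" for i using assms(2)[of i] by auto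
  show ?thesis using assms(4)
  proof (induction l rule: dec_induct)
    case base
    show ?case using \<psi>[of k] by simp
  next
    case (step l)
    have "\<psi> (Suc l) \<bullet> FM (A.tr k (Suc l)) = (\<psi> (Suc l) \<bullet> FM (d l)) \<bullet> FM (A.tr k l)"
      using step(1) \<psi>[of "Suc l"] by (simp add: A.tr_Suc T.assoc)
    then show ?case using step assms(3) by simp
  qed
qed

end

section \<open>Approximation by Cauchy sequences\<close>

context good_ext
begin

text \<open>
  The bound \<open>N\<close> depends on \<open>n\<close> but not on \<open>x\<close>. This uniformity is what makes the sequences
  constructed from such families Cauchy.
\<close>

definition approx :: "'p \<Rightarrow> (nat \<Rightarrow> 'o) \<Rightarrow> (nat \<Rightarrow> 'n) \<Rightarrow> bool" where
  "approx t a \<psi> \<longleftrightarrow> (\<forall>i. a i \<in> Ob S \<and> T.in_hom (\<psi> i) (FO (a i)) t) \<and>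
     (\<forall>n. \<exists>N. F_bij_from N n \<psi>)"

text \<open>
  An object left orthogonal to \<open>M n\<close> desuspends to one left orthogonal to \<open>M (n + 1)\<close>, so
  approximation also controls the shifted maps, at the cost of one index.
\<close>

lemma approx_shift:
  assumes "approx t a \<psi>"
  shows "\<exists>N. F_bij_from N n (\<lambda>i. T.shm (\<psi> i))"
proof -
  obtain N where N: "\<And>i x. N \<le> i \<Longrightarrow> x \<in> S.perp (Suc n) \<Longrightarrow> F_bij x (\<psi> i)"
    using assms unfolding approx_def by blast
  have \<psi>: "T.arr (\<psi> i)" for i using assms unfolding approx_def by simp
  have "F_bij x (T.shm (\<psi> i))" if ix: "N \<le> i" "x \<in> S.perp n" for i x
  proof -
    obtain y j k where y: "y \<in> S.perp (Suc n)" "S.in_hom j (S.sho y) x" "S.in_hom k x (S.sho y)"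
      "k \<star> j = Id S (S.sho y)" "j \<star> k = Id S x" using S.perp_desuspend[OF ix(2)] by blast
    show ?thesis
      by (rule bij_F_iso[OF y(2-5)])
        (use bij_F_shift[OF S.perp_Ob[OF y(1)] \<psi> N[OF ix(1) y(1)]] \<psi> in auto)
  qed
  then show ?thesis by blast
qed

text \<open>
  Beyond the stage where the cones lie in \<open>M (n + 1)\<close>, an \<open>x\<close> left orthogonal to \<open>M n\<close> has no maps to the
  cones or to their desuspensions. The transition maps are then bijective on \<open>Hom(x, -)\<close>, and so is
  the map into the colimit.
\<close>

lemma approx_hocolimF:
  assumes "cauchy S M a d" "hocolimF a d t \<kappa>"
  shows "approx t a \<kappa>"
  unfolding approx_def
proof (intro conjI allI)
  interpret A: sequence S a d by unfold_locales (rule S.cauchyD[OF assms(1)])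
  note lg = hocolimF_legs[OF A.seq assms(2)]
  show "a i \<in> Ob S" "T.in_hom (\<kappa> i) (FO (a i)) t" for i using lg by auto
  fix n
  obtain N where N: "\<And>j k. N \<le> j \<Longrightarrow> j < k \<Longrightarrow> cone_in S (M (Suc n)) (a j) (a k) (A.tr j k)"
    using S.cauchyD(2)[OF assms(1), of "Suc n"] by blast
  have "F_bij x (\<kappa> i)" if i: "N \<le> i" and xp: "x \<in> S.perp n" for i x
  proof (rule T.bij_on_homI)
    note x = S.perp_Ob[OF xp]
    fix v assume v: "T.in_hom v (FO x) (T.dm (\<kappa> i)) \<and> \<kappa> i \<bullet> v = zero_mor T (FO x) (T.cd (\<kappa> i))"
    obtain h where h: "S.arr h" "S.dm h = x" "S.cd h = a i" "v = FM h"
      by (rule F_full[of v x "a i"]) (use v lg x in auto)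
    obtain l where l: "i \<le> l" "A.tr i l \<star> h = zero_mor S x (a l)"
      by (rule hocolimF_zero[OF assms, of h x i]) (use h v lg in auto)
    have "h = zero_mor S x (a i)"
    proof (cases "i = l")
      case True
      then show ?thesis using l h by simp
    next
      case False
      then have "S.bij_on_hom x (A.tr i l)" using S.cone_bij_on_hom[OF N xp] i l by simp
      then show ?thesis using l h unfolding S.bij_on_hom_def S.inj_on_hom_def by simp
    qed
    then show "v = zero_mor T (FO x) (T.dm (\<kappa> i))" using h x lg by simp
  next
    note x = S.perp_Ob[OF xp]
    fix v assume v: "T.in_hom v (FO x) (T.cd (\<kappa> i))"
    obtain k h where h: "S.arr h" "S.dm h = x" "S.cd h = a k" "v = \<kappa> k \<bullet> FM h"
      by (rule hocolimF_surj[OF assms, of v x]) (use v x lg in auto)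
    define l where "l = max (Suc i) k"
    have l: "i < l" "i \<le> l" "k \<le> l" by (auto simp: l_def)
    have tr: "\<kappa> l \<bullet> FM (A.tr j l) = \<kappa> j" if "j \<le> l" for j
      by (rule legs_transit[OF A.seq]) (use lg that in auto)
    have "S.bij_on_hom x (A.tr i l)" using S.cone_bij_on_hom[OF N xp] i l by simp
    then obtain h' where h': "S.arr h'" "S.dm h' = x" "S.cd h' = a i" "A.tr k l \<star> h = A.tr i l \<star> h'"
      using S.surj_on_homE[of x "A.tr i l" "A.tr k l \<star> h"] h l unfolding S.bij_on_hom_def by auto
    have "v = (\<kappa> l \<bullet> FM (A.tr k l)) \<bullet> FM h" using h tr l by simp
    also have "\<dots> = \<kappa> l \<bullet> FM (A.tr k l \<star> h)" using h(1-3) l lg by (simp add: T.assoc)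
    also have "\<dots> = (\<kappa> l \<bullet> FM (A.tr i l)) \<bullet> FM h'" using h' l lg by (simp add: T.assoc)
    also have "\<dots> = \<kappa> i \<bullet> FM h'" using tr l by simp
    finally show "\<exists>w. T.in_hom w (FO x) (T.dm (\<kappa> i)) \<and> v = \<kappa> i \<bullet> w"
      using h' lg by (intro exI[of _ "FM h'"]) auto
  qed
  then show "\<exists>N. F_bij_from N n \<kappa>" by blast
qed

lemma approx_bij:
  assumes "S.arr f" "T.arr \<psi>" "T.dm \<psi> = FO (S.dm f)" "T.arr \<psi>'" "T.dm \<psi>' = FO (S.cd f)"
    "\<psi>' \<bullet> FM f = \<psi>" "F_bij x \<psi>" "F_bij x \<psi>'" "x \<in> Ob S"
  shows "S.bij_on_hom x f"
proof (rule S.bij_on_homI)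
  have cd: "T.cd \<psi> = T.cd \<psi>'" using assms(1,4,5) by (simp add: assms(6)[symmetric])
  {
    fix v assume v: "S.in_hom v x (S.dm f) \<and> f \<star> v = zero_mor S x (S.cd f)"
    have "\<psi> \<bullet> FM v = (\<psi>' \<bullet> FM f) \<bullet> FM v" by (simp add: assms(6))
    also have "\<dots> = \<psi>' \<bullet> (FM f \<bullet> FM v)" by (rule T.assoc) (use v assms(1-5) in auto)
    also have "FM f \<bullet> FM v = FM (f \<star> v)" by (rule FM_cmp[symmetric]) (use v assms(1-5) in auto)
    also have "\<psi>' \<bullet> FM (f \<star> v) = \<psi>' \<bullet> FM (zero_mor S x (S.cd f))" using v by simp
    also have "\<dots> = zero_mor T (FO x) (T.cd \<psi>)" using v assms(1-5,9) cd by simp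
    finally have "FM v = zero_mor T (FO x) (FO (S.dm f))"
      using assms(3,7) v unfolding T.bij_on_hom_def T.inj_on_hom_def by simp
    then show "v = zero_mor S x (S.dm f)" by (rule F_faithful_zero[rotated 3]) (use v in auto)
  }
  fix v assume v: "S.in_hom v x (S.cd f)"
  obtain w where w: "T.arr w" "T.dm w = FO x" "T.cd w = T.dm \<psi>" "\<psi>' \<bullet> FM v = \<psi> \<bullet> w"
    by (rule T.surj_on_homE[of "FO x" \<psi> "\<psi>' \<bullet> FM v"])
      (use v assms(1-5,7) cd in \<open>auto simp: T.bij_on_hom_def\<close>)
  obtain h where h: "S.arr h" "S.dm h = x" "S.cd h = S.dm f" "w = FM h"
    by (rule F_full[of w x "S.dm f"]) (use w assms in auto)
  have "\<psi>' \<bullet> FM v = (\<psi>' \<bullet> FM f) \<bullet> FM h" using w h by (simp add: assms(6))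
  also have "\<dots> = \<psi>' \<bullet> FM (f \<star> h)" using h assms(1-5) by (simp add: T.assoc)
  finally have "FM v = FM (f \<star> h)"
    by (rule T.inj_on_homD[of "FO x" \<psi>', rotated 4]) (use assms(1-5,8) v h in \<open>auto simp: T.bij_on_hom_def\<close>)
  then have "v = f \<star> h" by (rule F_faithful[rotated]) (use v h assms(1) in auto)
  then show "\<exists>h. S.in_hom h x (S.dm f) \<and> v = f \<star> h" using h by auto
qed

text \<open>
  Each \<open>a i\<close> is left orthogonal to some \<open>M n\<close>, so \<open>\<psi> i\<close> lifts along \<open>\<psi> j\<close> for every large \<open>j\<close>; iterating
  gives the transition maps. They are bijective on \<open>Hom(x, -)\<close> wherever the \<open>\<psi> i\<close> are, so their cones
  receive no maps from large left orthogonals and hence lie in small \<open>M i\<close>. The comparison map from the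
  homotopy colimit to \<open>t\<close> is bijective on all \<open>Hom(F x, -)\<close>, and both objects are generated.
\<close>

lemma approx_subsequence:
  assumes "generated t" "approx t a \<psi>"
  obtains r e where "strict_mono r" "cauchy S M (a \<circ> r) e" "hocolimF (a \<circ> r) e t (\<psi> \<circ> r)"
proof -
  note t = generated_Ob[OF assms(1)]
  have a: "a i \<in> Ob S" and \<psi>: "T.arr (\<psi> i)" "T.dm (\<psi> i) = FO (a i)" "T.cd (\<psi> i) = t" for i
    using assms(2) by (auto simp: approx_def)
  have bij: "\<exists>N. F_bij_from N n \<psi>" for n
    using assms(2) by (simp add: approx_def)
  have step: "\<exists>j>i. \<exists>e. S.in_hom e (a i) (a j) \<and> \<psi> j \<bullet> FM e = \<psi> i" for i
  proof -
    obtain n where n: "a i \<in> S.perp n" using S.perp_ex[OF a] by blast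
    obtain N where N: "\<forall>j\<ge>N. \<forall>x \<in> S.perp n. F_bij x (\<psi> j)" using bij by blast
    define j where "j = max N (Suc i)"
    have j: "N \<le> j" "i < j" by (auto simp: j_def)
    then have "T.surj_on_hom (FO (a i)) (\<psi> j)" using N n by (simp add: T.bij_on_hom_def)
    then obtain w where w: "T.arr w" "T.dm w = FO (a i)" "T.cd w = FO (a j)" "\<psi> i = \<psi> j \<bullet> w"
      using T.surj_on_homE[of "FO (a i)" "\<psi> j" "\<psi> i"] \<psi> by metis
    obtain e where "S.arr e" "S.dm e = a i" "S.cd e = a j" "w = FM e"
      by (rule F_full[OF w(1-3) a a]) (rule that)
    with w j show ?thesis by auto
  qed
  have "\<exists>r. \<forall>k. True \<and> (r k < r (Suc k) \<and> (\<exists>e. S.in_hom e (a (r k)) (a (r (Suc k))) \<and> \<psi> (r (Suc k)) \<bullet> FM e = \<psi> (r k)))"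
    by (rule dependent_nat_choice[where P = "\<lambda>_ _. True"
      and Q = "\<lambda>_ i j. i < j \<and> (\<exists>e. S.in_hom e (a i) (a j) \<and> \<psi> j \<bullet> FM e = \<psi> i)"]) (use step in blast)+
  then obtain r where r: "\<And>k. r k < r (Suc k)"
    "\<And>k. \<exists>e. S.in_hom e (a (r k)) (a (r (Suc k))) \<and> \<psi> (r (Suc k)) \<bullet> FM e = \<psi> (r k)" by blast
  then obtain e where e: "\<And>k. S.in_hom (e k) (a (r k)) (a (r (Suc k)))"
    "\<And>k. \<psi> (r (Suc k)) \<bullet> FM (e k) = \<psi> (r k)" by metis
  have mono: "strict_mono r" using r(1) by (simp add: strict_mono_Suc_iff)
  have seq: "is_seq S (a \<circ> r) e" using e(1) a by (auto simp: is_seq_def S.Mor_iff)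
  interpret A: sequence S "a \<circ> r" e by unfold_locales (rule seq)
  have tr: "\<psi> (r l) \<bullet> FM (A.tr k l) = \<psi> (r k)" if "k \<le> l" for k l
    using legs_transit[OF seq, of "\<lambda>k. \<psi> (r k)" t k l] \<psi> e(2) that by simp
  have cauchy: "cauchy S M (a \<circ> r) e"
    unfolding cauchy_def
  proof (intro conjI allI)
    show "is_seq S (a \<circ> r) e" by (rule seq)
    fix i
    obtain n where n: "\<forall>c \<in> Ob S. (\<forall>x \<in> S.perp n. \<forall>u. S.in_hom u x c \<longrightarrow> u = zero_mor S x c) \<longrightarrow> c \<in> M i"
      using S.mem_if_orthogonal[OF summands] by blast
    obtain N where N: "F_bij_from N n \<psi>" using bij by blast
    obtain N' where N': "F_bij_from N' (Suc n) \<psi>" using bij by blast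
    have "cone_in S (M i) ((a \<circ> r) j) ((a \<circ> r) k) (A.tr j k)" if jk: "max N N' \<le> j" "j < k" for j k
    proof -
      have "j \<le> r j" "j < r k"
        using strict_mono_imp_increasing[OF mono, of j] strict_mono_imp_increasing[OF mono, of k] jk(2) by auto
      then have rj: "N \<le> r j" "N' \<le> r j" "N \<le> r k" "N' \<le> r k" using jk by auto
      have trb: "S.bij_on_hom x (A.tr j k)"
        if "F_bij x (\<psi> (r j))" "F_bij x (\<psi> (r k))" "x \<in> Ob S" for x
        by (rule approx_bij[of _ "\<psi> (r j)" "\<psi> (r k)"]) (use that tr[of j k] jk \<psi> in auto)
      have b0: "S.bij_on_hom x (A.tr j k)" if "x \<in> S.perp n" for x
        using trb[of x] N rj that S.perp_Ob[OF that] by blast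
      have b1: "S.bij_on_hom x (A.tr j k)" if "x \<in> S.perp (Suc n)" for x
        using trb[of x] N' rj that S.perp_Ob[OF that] by blast
      \<comment> \<open>Bijectivity one index further out controls the shifted transition map.\<close>
      have b2: "S.bij_on_hom x (S.shm (A.tr j k))" if "x \<in> S.perp n" for x
        by (rule S.bij_on_perp_shift[OF b1 _ that]) (use jk in auto)
      obtain c g h where tri: "(a (r j), a (r k), c, A.tr j k, g, h) \<in> Tri S"
        using S.tri_cone[of "a (r j)" "a (r k)" "A.tr j k"] a jk by (auto simp: S.Mor_iff)
      have "c \<in> M i"
        using n S.triD(12)[OF tri] S.cone_orthogonal[OF tri b0 b2] by blast
      then show ?thesis using tri unfolding cone_in_def by auto
    qed
    then show "\<exists>N. \<forall>j k. N \<le> j \<and> j < k \<longrightarrow> cone_in S (M i) ((a \<circ> r) j) ((a \<circ> r) k) (A.tr j k)" by blast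
  qed
  obtain s \<kappa> where s: "hocolimF (a \<circ> r) e s \<kappa>" using hocolimF_exists[OF cauchy] by blast
  note lg = hocolimF_legs[OF seq s]
  obtain \<theta> where \<theta>: "T.arr \<theta>" "T.dm \<theta> = s" "T.cd \<theta> = t" "\<And>k. \<theta> \<bullet> \<kappa> k = \<psi> (r k)"
    by (rule T.hocolim_map[OF s F_seq[OF seq] t, of "\<lambda>k. \<psi> (r k)"]) (use \<psi> e(2) in auto)
  have bij\<theta>: "F_bij x \<theta>" if x: "x \<in> Ob S" for x
  proof -
    obtain n where n: "x \<in> S.perp n" using S.perp_ex[OF x] by blast
    obtain N where N: "\<forall>i\<ge>N. F_bij x (\<psi> i)" using bij[of n] n by blast
    obtain N' where N': "\<forall>i\<ge>N'. F_bij x (\<kappa> i)"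
      using approx_hocolimF[OF cauchy s] n unfolding approx_def by blast
    define k where "k = max N N'"
    have "N \<le> r k" "N' \<le> k" using strict_mono_imp_increasing[OF mono, of k] by (auto simp: k_def)
    then have b: "F_bij x (\<theta> \<bullet> \<kappa> k)" "F_bij x (\<kappa> k)" using N N' \<theta>(4) by auto
    show ?thesis
    proof (rule T.bij_on_homI)
      fix v assume v: "T.in_hom v (FO x) (T.dm \<theta>) \<and> \<theta> \<bullet> v = zero_mor T (FO x) (T.cd \<theta>)"
      obtain w where w: "T.arr w" "T.dm w = FO x" "T.cd w = T.dm (\<kappa> k)" "v = \<kappa> k \<bullet> w"
        by (rule T.surj_on_homE[of "FO x" "\<kappa> k" v]) (use v b \<theta> lg in \<open>auto simp: T.bij_on_hom_def\<close>)
      have "(\<theta> \<bullet> \<kappa> k) \<bullet> w = \<theta> \<bullet> v"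
        using w \<theta>(1-3) lg by (simp add: T.assoc)
      then have "(\<theta> \<bullet> \<kappa> k) \<bullet> w = zero_mor T (FO x) t" using v \<theta> by simp
      then have "w = zero_mor T (FO x) (T.dm (\<kappa> k))"
        using b(1) w \<theta>(1-3) lg unfolding T.bij_on_hom_def T.inj_on_hom_def by simp
      then show "v = zero_mor T (FO x) (T.dm \<theta>)" using w lg \<theta> x by simp
    next
      fix v assume v: "T.in_hom v (FO x) (T.cd \<theta>)"
      obtain w where w: "T.arr w" "T.dm w = FO x" "T.cd w = T.dm (\<theta> \<bullet> \<kappa> k)" "v = (\<theta> \<bullet> \<kappa> k) \<bullet> w"
        by (rule T.surj_on_homE[of "FO x" "\<theta> \<bullet> \<kappa> k" v])
          (use v b \<theta>(1-3) lg in \<open>auto simp: T.bij_on_hom_def\<close>)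
      have "v = \<theta> \<bullet> (\<kappa> k \<bullet> w)" using w \<theta>(1-3) lg by (simp add: T.assoc)
      then show "\<exists>w. T.in_hom w (FO x) (T.dm \<theta>) \<and> v = \<theta> \<bullet> w"
        using w \<theta>(1-3) lg by (intro exI[of _ "\<kappa> k \<bullet> w"]) auto
    qed
  qed
  have \<theta>': "T.in_hom \<theta> s t" using \<theta> by simp
  obtain \<theta>i where \<theta>i: "T.in_hom \<theta>i t s" "\<theta>i \<bullet> \<theta> = Id T s" "\<theta> \<bullet> \<theta>i = Id T t"
    by (rule generated_iso[OF hocolimF_generated[OF seq s] assms(1) \<theta>']) (erule bij\<theta>, rule that)
  have "hocolimF (a \<circ> r) e t (\<lambda>k. \<theta> \<bullet> \<kappa> k)"
    by (rule T.hocolim_iso[OF s F_seq[OF seq] \<theta>' \<theta>i])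
  then have "hocolimF (a \<circ> r) e t (\<psi> \<circ> r)" using \<theta>(4) by (simp add: o_def)
  with mono cauchy that show ?thesis by blast
qed

abbreviation L' :: "'p set" where "L' \<equiv> L'cat S M T F"
abbreviation L'at :: "nat \<Rightarrow> 'p set" where "L'at \<equiv> L'cat_at S M T F"

lemma isomorphic_refl: "t \<in> Ob T \<Longrightarrow> isomorphic T t t"
  unfolding isomorphic_def using T.is_iso_Id by blast

lemma hocolimF_transport:
  assumes "is_seq S a d" "hocolimF a d t \<kappa>" "isomorphic T t t'" "t' \<in> Ob T"
  obtains \<kappa>' where "hocolimF a d t' \<kappa>'"
proof -
  obtain \<theta> where "is_iso T t t' \<theta>" using assms(3) unfolding isomorphic_def by blast
  then obtain \<theta>' where "T.in_hom \<theta> t t'" "T.in_hom \<theta>' t' t" "\<theta>' \<bullet> \<theta> = Id T t" "\<theta> \<bullet> \<theta>' = Id T t'"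
    using T.is_isoE[of t t' \<theta>] hocolimF_legs(1)[OF assms(1,2)] assms(4) by blast
  from T.hocolim_iso[OF assms(2) F_seq[OF assms(1)] this] that show ?thesis by blast
qed

lemma L'_iff: "t \<in> L' \<longleftrightarrow> (\<exists>a d \<kappa>. cauchy S M a d \<and> hocolimF a d t \<kappa>)"
proof
  assume "t \<in> L'"
  then obtain a d t' \<kappa> where c: "cauchy S M a d" "hocolimF a d t' \<kappa>" "isomorphic T t' t" "t \<in> Ob T"
    unfolding L'cat_def by blast
  obtain \<kappa>' where "hocolimF a d t \<kappa>'" by (rule hocolimF_transport[OF S.cauchyD(1)[OF c(1)] c(2-4)])
  with c(1) show "\<exists>a d \<kappa>. cauchy S M a d \<and> hocolimF a d t \<kappa>" by blast
next
  assume "\<exists>a d \<kappa>. cauchy S M a d \<and> hocolimF a d t \<kappa>"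
  then obtain a d \<kappa> where "cauchy S M a d" "hocolimF a d t \<kappa>" by blast
  moreover from this have "t \<in> Ob T" "isomorphic T t t"
    using isomorphic_refl hocolimF_legs(1)[OF S.cauchyD(1)] by simp_all
  ultimately show "t \<in> L'" unfolding L'cat_def by blast
qed

lemma L'at_iff: "t \<in> L'at n \<longleftrightarrow> (\<exists>a d \<kappa>. cauchy S M a d \<and> (\<forall>k. a k \<in> M n) \<and> hocolimF a d t \<kappa>)"
proof
  assume "t \<in> L'at n"
  then obtain a d t' \<kappa> where c: "cauchy S M a d" "\<forall>k. a k \<in> M n" "hocolimF a d t' \<kappa>" "isomorphic T t' t" "t \<in> Ob T"
    unfolding L'cat_at_def by blast
  obtain \<kappa>' where "hocolimF a d t \<kappa>'" by (rule hocolimF_transport[OF S.cauchyD(1)[OF c(1)] c(3-5)])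
  with c(1,2) show "\<exists>a d \<kappa>. cauchy S M a d \<and> (\<forall>k. a k \<in> M n) \<and> hocolimF a d t \<kappa>" by blast
next
  assume "\<exists>a d \<kappa>. cauchy S M a d \<and> (\<forall>k. a k \<in> M n) \<and> hocolimF a d t \<kappa>"
  then obtain a d \<kappa> where "cauchy S M a d" "\<forall>k. a k \<in> M n" "hocolimF a d t \<kappa>" by blast
  moreover from this have "t \<in> Ob T" "isomorphic T t t"
    using isomorphic_refl hocolimF_legs(1)[OF S.cauchyD(1)] by simp_all
  ultimately show "t \<in> L'at n" unfolding L'cat_at_def by blast
qed

lemma L'at_subset: "L'at n \<subseteq> L'"
  unfolding L'cat_def L'cat_at_def by blast

lemma L'at_mono: "m \<le> n \<Longrightarrow> L'at n \<subseteq> L'at m"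
  unfolding L'cat_at_def using S.M_mono[of m n] by blast

lemma generated_L': "t \<in> L' \<Longrightarrow> generated t"
  unfolding L'_iff using hocolimF_generated[OF S.cauchyD(1)] by blast

lemma approx_L'at:
  assumes "generated t" "approx t a \<psi>" "\<And>k. a k \<in> M n"
  shows "t \<in> L'at n"
proof -
  obtain r e where "strict_mono r" "cauchy S M (a \<circ> r) e" "hocolimF (a \<circ> r) e t (\<psi> \<circ> r)"
    by (rule approx_subsequence[OF assms(1,2)]) (rule that)
  moreover have "\<forall>k. (a \<circ> r) k \<in> M n" using assms(3) by simp
  ultimately show ?thesis unfolding L'at_iff by blast
qed

lemma F_in_L':
  assumes "b \<in> Ob S"
  shows "FO b \<in> L'"
proof -
  have "approx (FO b) (\<lambda>_. b) (\<lambda>_. Id T (FO b))"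
    using assms T.bij_on_hom_Id S.perp_Ob by (auto simp: approx_def)
  then obtain r e where "strict_mono (r :: nat \<Rightarrow> nat)" "cauchy S M ((\<lambda>_. b) \<circ> r) e" "hocolimF ((\<lambda>_. b) \<circ> r) e (FO b) ((\<lambda>_. Id T (FO b)) \<circ> r)"
    by (rule approx_subsequence[OF generated_F[OF assms]]) (rule that)
  then show ?thesis unfolding L'_iff by blast
qed

text \<open>
  The termwise desuspension of a Cauchy sequence is handled by desuspending the approximating family
  only and rebuilding the sequence with \<open>approx_subsequence\<close>.
\<close>

lemma L'at_unshift:
  assumes "T.sho t \<in> L'at (Suc m)" "t \<in> Ob T"
  shows "t \<in> L'at m"
proof -
  obtain c d \<kappa> where c: "cauchy S M c d" "\<forall>k. c k \<in> M (Suc m)" "hocolimF c d (T.sho t) \<kappa>"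
    using assms(1) L'at_iff by blast
  note lg = hocolimF_legs[OF S.cauchyD(1)[OF c(1)] c(3)]
  define P where "P k a \<psi> \<longleftrightarrow> a \<in> M m \<and> T.in_hom \<psi> (FO a) t \<and>
    (\<forall>x \<in> Ob S. F_bij (S.sho x) (\<kappa> k) \<longrightarrow> F_bij x \<psi>)" for k a \<psi>
  have "\<exists>a \<psi>. P k a \<psi>" for k
  proof -
    have ck: "c k \<in> M (Suc m)" "c k \<in> Ob S" using c(2) S.M_Ob by auto
    obtain a i j where a: "a \<in> Ob S" "S.in_hom i (S.sho a) (c k)" "S.in_hom j (c k) (S.sho a)"
      "j \<star> i = Id S (S.sho a)" "i \<star> j = Id S (c k)" using S.unshift[OF ck(2)] by blast
    have "a \<in> M m" using S.M_unshift[OF a(1) S.M_iso[OF ck(1) a(3,2,5,4)]] .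
    obtain \<psi> where \<psi>: "T.arr \<psi>" "T.dm \<psi> = FO a" "T.cd \<psi> = t" "\<kappa> k \<bullet> (FM i \<bullet> phi_inv a) = T.shm \<psi>"
      by (rule T.shm_full[of "\<kappa> k \<bullet> (FM i \<bullet> phi_inv a)" "FO a" t]) (use a lg assms(2) in auto)
    have "F_bij x \<psi>" if x: "x \<in> Ob S" and b: "F_bij (S.sho x) (\<kappa> k)" for x
    proof (rule bij_F_unshift[OF x \<psi>(1)])
      have x': "FO (S.sho x) \<in> Ob T" using x by simp
      have "F_bij (S.sho x) (phi_inv a)"
        by (rule T.iso_on_hom[OF x', where u' = "\<phi> a"]) (use a in auto)
      moreover have "F_bij (S.sho x) (FM i)"
      proof (rule T.iso_on_hom[OF x', where u' = "FM j"])
        show "FM j \<bullet> FM i = Id T (FO (S.sho a))"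
          using a FM_cmp[of i j, symmetric] by (simp del: FM_cmp)
        show "FM i \<bullet> FM j = Id T (FO (c k))"
          using a ck FM_cmp[of j i, symmetric] by (simp del: FM_cmp)
      qed (use a in auto)
      ultimately have "F_bij (S.sho x) (FM i \<bullet> phi_inv a)"
        by (intro T.bij_on_hom_cmp) (use a x' in auto)
      then have "F_bij (S.sho x) (\<kappa> k \<bullet> (FM i \<bullet> phi_inv a))"
        by (intro T.bij_on_hom_cmp[OF _ _ _ _ b x']) (use a lg in auto)
      then show "F_bij (S.sho x) (T.shm \<psi>)" using \<psi>(4) by simp
    qed
    then show ?thesis using \<open>a \<in> M m\<close> \<psi> unfolding P_def
      by (intro exI[of _ a] exI[of _ \<psi>]) auto
  qed
  \<comment> \<open>No transition maps are chosen here, although \<open>c\<close> has some.\<close>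
  then obtain a \<psi> where "\<And>k. P k (a k) (\<psi> k)" by metis
  then have a: "\<And>k. a k \<in> M m" "\<And>k. T.in_hom (\<psi> k) (FO (a k)) t"
    "\<And>k x. x \<in> Ob S \<Longrightarrow> F_bij (S.sho x) (\<kappa> k) \<Longrightarrow> F_bij x (\<psi> k)"
    unfolding P_def by auto
  have "approx t a \<psi>"
    unfolding approx_def
  proof (intro conjI allI)
    show "a i \<in> Ob S" "T.in_hom (\<psi> i) (FO (a i)) t" for i using a(1,2) S.M_Ob by auto
    fix n
    obtain N where N: "F_bij_from N (Suc n) \<kappa>"
      using approx_hocolimF[OF c(1,3)] unfolding approx_def by blast
    then show "\<exists>N. F_bij_from N n \<psi>"
      using a(3) S.perp_shift S.perp_Ob by blast
  qed
  moreover have "generated t" using generated_unshift[OF hocolimF_generated[OF S.cauchyD(1)[OF c(1)] c(3)] assms(2)] .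
  ultimately show ?thesis using approx_L'at a(1) by blast
qed

end

section \<open>Orthogonality in modules and in the extension\<close>

context good_ext
begin

lemma Ccat_iff:
  assumes "A \<in> Modules S"
  shows "A \<in> Ccat S M \<longleftrightarrow> (\<exists>i. \<forall>s \<in> M i. carrier (at A s) = {\<one>\<^bsub>at A s\<^esub>})"
proof -
  have "mod_hom_trivial S (yoneda S s) A \<longleftrightarrow> carrier (at A s) = {\<one>\<^bsub>at A s\<^esub>}" if "s \<in> M i" for s i
    using S.yoneda_trivial[OF assms S.M_Ob[OF that]] .
  then show ?thesis using assms by (auto simp: Ccat_def)
qed

lemma Ccat_iso:
  assumes "A \<in> Modules S" "B \<in> Modules S" "\<eta> \<in> mod_iso S A B" "A \<in> Ccat S M"
  shows "B \<in> Ccat S M"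
proof -
  obtain i where i: "\<forall>s \<in> M i. carrier (at A s) = {\<one>\<^bsub>at A s\<^esub>}" using assms(1,4) Ccat_iff by blast
  have "\<forall>s \<in> M i. carrier (at B s) = {\<one>\<^bsub>at B s\<^esub>}"
    using i S.trivial_carrier_iso[OF assms(1-3) S.M_Ob] by blast
  then show ?thesis using Ccat_iff[OF assms(2)] by blast
qed

text \<open>
  For large \<open>k\<close> the cone of \<open>a k \<longrightarrow> a (k + 1)\<close> has no maps to \<open>q\<close>, so every map from \<open>F (a k)\<close> to the
  desuspension of \<open>q\<close> extends to \<open>F (a (k + 1))\<close>, and \<open>hocolim_no_phantom\<close> applies.
\<close>

lemma no_phantom:
  assumes "cauchy S M a d" "hocolimF a d t \<kappa>" "RY q \<in> Ccat S M" "T.in_hom \<gamma> t q"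
    "\<And>k. \<gamma> \<bullet> \<kappa> k = zero_mor T (FO (a k)) q"
  shows "\<gamma> = zero_mor T t q"
proof -
  interpret A: sequence S a d by unfold_locales (rule S.cauchyD[OF assms(1)])
  note lg = hocolimF_legs[OF A.seq assms(2)]
  have q: "q \<in> Ob T" using assms(4) by auto
  obtain i0 where i0: "\<forall>s \<in> M i0. Mor T (FO s) q = {zero_mor T (FO s) q}"
    using assms(3) Ccat_iff[of "RY q"] unfolding Ccat_def by auto
  obtain N where N: "\<And>j k. N \<le> j \<Longrightarrow> j < k \<Longrightarrow> cone_in S (M i0) (a j) (a k) (A.tr j k)"
    using S.cauchyD(2)[OF assms(1), of i0] by blast
  obtain y i j where y: "y \<in> Ob T" "T.in_hom i (T.sho y) q" "T.in_hom j q (T.sho y)"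
    "j \<bullet> i = Id T (T.sho y)" "i \<bullet> j = Id T q" using T.unshift[OF q] by blast
  have "j \<bullet> \<gamma> = zero_mor T t (T.sho y)"
  proof (rule T.hocolim_no_phantom[OF assms(2) F_seq[OF A.seq] _ _ y(1), where N = N])
    show "T.in_hom (j \<bullet> \<gamma>) t (T.sho y)" using assms(4) y by auto
    show "(j \<bullet> \<gamma>) \<bullet> \<kappa> k = zero_mor T (FO (a k)) (T.sho y)" for k
    proof -
      have "(j \<bullet> \<gamma>) \<bullet> \<kappa> k = j \<bullet> (\<gamma> \<bullet> \<kappa> k)" by (rule T.assoc) (use assms(4) y lg in auto)
      then show ?thesis using assms(5) y by simp
    qed
    fix k u assume k: "N \<le> k" and u: "T.in_hom u (FO (a k)) y"
    obtain c g h where c: "c \<in> M i0" and tri: "(a k, a (Suc k), c, d k, g, h) \<in> Tri S"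
      using N[OF k lessI] unfolding cone_in_def A.tr_step by blast
    note t = S.triD[OF tri]
    note Ft = T.triD[OF F_tri[OF tri]]
    have "i \<bullet> (T.shm u \<bullet> (\<phi> (a k) \<bullet> FM h)) \<in> Mor T (FO c) q"
      using T.Mor_iff[of "FO c" q] q y u Ft by simp
    then have "i \<bullet> (T.shm u \<bullet> (\<phi> (a k) \<bullet> FM h)) = zero_mor T (FO c) q" using i0 c by auto
    then have "j \<bullet> (i \<bullet> (T.shm u \<bullet> (\<phi> (a k) \<bullet> FM h))) = zero_mor T (FO c) (T.sho y)"
      using y Ft by simp
    moreover have "j \<bullet> (i \<bullet> (T.shm u \<bullet> (\<phi> (a k) \<bullet> FM h))) = (j \<bullet> i) \<bullet> (T.shm u \<bullet> (\<phi> (a k) \<bullet> FM h))"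
      by (rule T.assoc[symmetric]) (use y u Ft in auto)
    moreover have "\<dots> = T.shm u \<bullet> (\<phi> (a k) \<bullet> FM h)" using y u Ft by simp
    ultimately have "T.shm u \<bullet> (\<phi> (a k) \<bullet> FM h) = zero_mor T (FO c) (T.sho y)" by simp
    then show "\<exists>w. T.in_hom w (FO (a (Suc k))) y \<and> u = w \<bullet> FM (d k)"
      using T.coexact_left[OF F_tri[OF tri] u] by (metis T.in_hom_def)
  qed
  then have "i \<bullet> (j \<bullet> \<gamma>) = zero_mor T t q" using y lg by simp
  moreover have "i \<bullet> (j \<bullet> \<gamma>) = \<gamma>" using T.assoc[of \<gamma> j i] assms(4) y by simp
  ultimately show ?thesis by simp
qed

lemma cauchy_sequence: "cauchy S M a d \<Longrightarrow> sequence S a d"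
  using S.cauchyD(1) by unfold_locales

lemma S'cat_RY: "t \<in> S'cat S M T F \<Longrightarrow> RY t \<in> Ccat S M"
  by (simp add: S'cat_def)

text \<open>
  A map \<open>l \<longrightarrow> q\<close> induces a map between the standard colimits, which is trivial by hypothesis. Hence the
  map vanishes on every term of a sequence defining \<open>l\<close>, and \<open>no_phantom\<close> finishes.
\<close>

lemma perp_L'at:
  assumes "cauchy S M D d" "hocolimF D d q \<kappa>" "colimY S D d \<in> Lcat_at_perp S M n" "RY q \<in> Ccat S M"
  shows "q \<in> perp_right T (L'at n)"
proof -
  interpret D: sequence S D d by (rule cauchy_sequence[OF assms(1)])
  note q = hocolimF_legs(1)[OF D.seq assms(2)]
  obtain \<zeta> where \<zeta>: "RY q \<in> Modules S" "\<zeta> \<in> mod_iso S D.colim (RY q)"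
    "\<And>x k h. S.in_hom h x (D k) \<Longrightarrow> \<zeta> x (D.gm k h) = \<kappa> k \<bullet> FM h"
    by (rule hocolimF_colimE[OF assms(1,2)]) (rule that)
  \<comment> \<open>Conjugating by the identifications of the modules of \<open>l\<close> and \<open>q\<close> with standard colimits brings \<open>\<gamma>\<close>
    into the scope of the hypothesis.\<close>
  define \<zeta>' where "\<zeta>' = (\<lambda>x. inv_into (carrier (at D.colim x)) (\<zeta> x))"
  have \<zeta>': "\<zeta>' \<in> mod_hom S (RY q) D.colim"
    using S.mod_iso_inverse[OF D.colim_module \<zeta>(1,2)] by (simp add: \<zeta>'_def mod_iso_def)
  have inv: "\<zeta> x (\<zeta>' x u) = u" if "x \<in> Ob S" "u \<in> Mor T (FO x) q" for x u
  proof -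
    have "\<zeta> x \<in> iso (at D.colim x) (at (RY q) x)" using \<zeta>(2) that by (simp add: mod_iso_def)
    then have "\<zeta> x ` carrier (at D.colim x) = Mor T (FO x) q" by (simp add: iso_def bij_betw_def)
    then show ?thesis using that(2) by (simp add: \<zeta>'_def f_inv_into_f)
  qed
  have "\<gamma> = zero_mor T l q" if l: "l \<in> L'at n" and \<gamma>: "T.in_hom \<gamma> l q" for l \<gamma>
  proof -
    obtain a e \<xi> where a: "cauchy S M a e" "\<forall>k. a k \<in> M n" "hocolimF a e l \<xi>" using l L'at_iff by blast
    interpret A: sequence S a e by (rule cauchy_sequence[OF a(1)])
    note lg = hocolimF_legs[OF A.seq a(3)]
    obtain \<eta> where \<eta>: "RY l \<in> Modules S" "\<eta> \<in> mod_iso S A.colim (RY l)"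
      "\<And>x k h. S.in_hom h x (a k) \<Longrightarrow> \<eta> x (A.gm k h) = \<xi> k \<bullet> FM h"
      by (rule hocolimF_colimE[OF a(1,3)]) (rule that)
    have \<eta>': "\<eta> \<in> mod_hom S A.colim (RY l)" using \<eta>(2) by (simp add: mod_iso_def)
    have "(\<lambda>_ u. \<gamma> \<bullet> u) \<in> mod_hom S (RY l) (RY q)"
      unfolding mod_hom_def mem_Collect_eq
    proof (intro conjI ballI)
      fix x assume x: "x \<in> Ob S"
      show "(\<lambda>u. \<gamma> \<bullet> u) \<in> hom (at (RY l) x) (at (RY q) x)"
      proof (rule homI)
        fix u v assume u: "u \<in> carrier (at (RY l) x)" and v: "v \<in> carrier (at (RY l) x)"
        have u': "T.in_hom u (FO x) l" and v': "T.in_hom v (FO x) l" using u v x lg by (simp_all add: T.Mor_iff)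
        show "\<gamma> \<bullet> u \<in> carrier (at (RY q) x)" using u' \<gamma> x q by (simp add: T.Mor_iff)
        show "\<gamma> \<bullet> (u \<otimes>\<^bsub>at (RY l) x\<^esub> v) = \<gamma> \<bullet> u \<otimes>\<^bsub>at (RY q) x\<^esub> \<gamma> \<bullet> v"
          using T.cmp_add[of u v \<gamma>] u' v' \<gamma> by (simp add: T.add_def)
      qed
    next
      fix x y f u assume "x \<in> Ob S" "y \<in> Ob S" "f \<in> Mor S x y" "u \<in> carrier (at (RY l) y)"
      then show "\<gamma> \<bullet> act (RY l) f u = act (RY q) f (\<gamma> \<bullet> u)"
        using lg \<gamma> by (simp add: T.Mor_iff S.Mor_iff T.assoc)
    qed
    from S.mod_hom_compose[OF S.mod_hom_compose[OF \<eta>' this] \<zeta>']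
    have "(\<lambda>x u. \<zeta>' x (\<gamma> \<bullet> \<eta> x u)) \<in> mod_hom S A.colim D.colim" .
    moreover have "A.colim \<in> Lcat_at S M n"
      using A.colim_module a(1,2) A.colim_is_colimY unfolding Lcat_at_def is_colimY_def by blast
    ultimately have triv: "\<zeta>' x (\<gamma> \<bullet> \<eta> x u) = \<one>\<^bsub>at D.colim x\<^esub>"
      if "x \<in> Ob S" "u \<in> carrier (at A.colim x)" for x u
      using assms(3) that unfolding Lcat_at_perp_def mod_hom_trivial_def by (auto dest!: bspec)
    have "\<gamma> \<bullet> \<xi> k = zero_mor T (FO (a k)) q" for k
    proof -
      have "\<eta> (a k) (A.gm k (Id S (a k))) = \<xi> k" using \<eta>(3)[of "Id S (a k)" "a k" k] lg by simp
      then have "\<zeta>' (a k) (\<gamma> \<bullet> \<xi> k) = \<one>\<^bsub>at D.colim (a k)\<^esub>"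
        using triv[of "a k" "A.gm k (Id S (a k))"] by simp
      moreover have "\<zeta> (a k) \<one>\<^bsub>at D.colim (a k)\<^esub> = \<one>\<^bsub>at (RY q) (a k)\<^esub>"
        by (rule S.mod_hom_one[OF D.colim_module \<zeta>(1)]) (use \<zeta>(2) in \<open>simp_all add: mod_iso_def\<close>)
      moreover have "\<gamma> \<bullet> \<xi> k \<in> Mor T (FO (a k)) q" using lg \<gamma> q by (simp add: T.Mor_iff)
      ultimately show ?thesis using inv[of "a k" "\<gamma> \<bullet> \<xi> k"] by simp
    qed
    then show ?thesis using no_phantom[OF a(1,3) assms(4) \<gamma>] by blast
  qed
  then have "Mor T l q = {zero_mor T l q}" if "l \<in> L'at n" for l
    using that q generated_Ob[OF generated_L'] L'at_subset by (fastforce simp: T.Mor_iff)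
  then show ?thesis using q by (simp add: perp_right_def)
qed

text \<open>
  A module map out of the colimit of \<open>Y(a)\<close> is a compatible family of maps \<open>F (a k) \<longrightarrow> q\<close>. Such a
  family extends to the homotopy colimit, where it vanishes by hypothesis.
\<close>

lemma Lcat_at_perp_colim:
  assumes "cauchy S M D d" "hocolimF D d q \<kappa>" "q \<in> perp_right T (L'at n)"
  shows "colimY S D d \<in> Lcat_at_perp S M n"
proof -
  interpret D: sequence S D d by (rule cauchy_sequence[OF assms(1)])
  note q = hocolimF_legs(1)[OF D.seq assms(2)]
  obtain \<zeta> where \<zeta>: "RY q \<in> Modules S" "\<zeta> \<in> mod_iso S D.colim (RY q)"
    "\<And>x k h. S.in_hom h x (D k) \<Longrightarrow> \<zeta> x (D.gm k h) = \<kappa> k \<bullet> FM h"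
    by (rule hocolimF_colimE[OF assms(1,2)]) (rule that)
  have \<zeta>': "\<zeta> \<in> mod_hom S D.colim (RY q)" using \<zeta>(2) by (simp add: mod_iso_def)
  have "mod_hom_trivial S A D.colim"
    if A: "A \<in> Lcat_at S M n" for A :: "('o, 'm, (nat \<times> 'm) set) cmod"
    unfolding mod_hom_trivial_def
  proof (intro ballI)
    fix \<eta> x u assume \<eta>: "\<eta> \<in> mod_hom S A D.colim" and x: "x \<in> Ob S" and u: "u \<in> carrier (at A x)"
    obtain a e \<xi> where a: "A \<in> Modules S" "cauchy S M a e" "\<forall>k. a k \<in> M n" "\<xi> \<in> mod_iso S (colimY S a e) A"
      using A unfolding Lcat_at_def by blast
    interpret A: sequence S a e by (rule cauchy_sequence[OF a(2)])
    have \<xi>: "\<xi> \<in> mod_hom S A.colim A" using a(4) by (simp add: mod_iso_def)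
    define \<theta> where "\<theta> = (\<lambda>x u. \<zeta> x (\<eta> x (\<xi> x u)))"
    have \<theta>: "\<theta> \<in> mod_hom S A.colim (RY q)"
      unfolding \<theta>_def using S.mod_hom_compose[OF S.mod_hom_compose[OF \<xi> \<eta>] \<zeta>'] .
    \<comment> \<open>The compatible family that corresponds to \<open>\<theta>\<close>: the images of the universal elements.\<close>
    define \<beta> where "\<beta> k = \<theta> (a k) (A.gm k (Id S (a k)))" for k
    have gI: "A.gm k (Id S (a k)) \<in> carrier (at A.colim (a k))" for k by simp
    have \<beta>: "T.in_hom (\<beta> k) (FO (a k)) q" for k
      using S.mod_hom_closed[OF \<theta> A.E_Ob gI] q by (simp add: \<beta>_def T.Mor_iff)
    have \<beta>_act: "\<theta> y (A.gm k h) = \<beta> k \<bullet> FM h" if h: "S.in_hom h y (a k)" for y k h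
    proof -
      have "\<theta> y (act A.colim h (A.gm k (Id S (a k)))) = act (RY q) h (\<theta> (a k) (A.gm k (Id S (a k))))"
        using \<theta> gI[of k] S.in_homD[OF h] unfolding mod_hom_def by blast
      moreover have "act A.colim h (A.gm k (Id S (a k))) = A.gm k h"
        using A.germ_act[of "Id S (a k)" k h] h by simp
      ultimately show ?thesis by (simp add: \<beta>_def)
    qed
    have "\<beta> (Suc k) \<bullet> FM (e k) = \<beta> k" for k
    proof -
      have "\<beta> (Suc k) \<bullet> FM (e k) = \<theta> (a k) (A.gm (Suc k) (e k))" using \<beta>_act[of "e k" "a k" "Suc k"] by simp
      also have "A.gm (Suc k) (e k) = A.gm k (Id S (a k))"
        using A.germ_push[of "Id S (a k)" k "Suc k"] by (simp add: A.tr_step)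
      finally show ?thesis by (simp add: \<beta>_def)
    qed
    moreover obtain l \<mu> where l: "hocolimF a e l \<mu>" using hocolimF_exists[OF a(2)] by blast
    ultimately obtain b where b: "T.arr b" "T.dm b = l" "T.cd b = q" "\<And>k. b \<bullet> \<mu> k = \<beta> k"
      using T.hocolim_map[OF l F_seq[OF A.seq] q \<beta>] by blast
    have "l \<in> L'at n" using a(2,3) l L'at_iff by blast
    then have "Mor T l q = {zero_mor T l q}" using assms(3) by (simp add: perp_right_def)
    then have "b = zero_mor T l q" using T.Mor_iff[of l q b] b q hocolimF_legs(1)[OF A.seq l] by auto
    then have \<beta>0: "\<beta> k = zero_mor T (FO (a k)) q" for k
      using b(4)[of k] hocolimF_legs[OF A.seq l] q by simp
    have "\<xi> x \<in> iso (at A.colim x) (at A x)" using a(4) x by (simp add: mod_iso_def)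
    then have "u \<in> \<xi> x ` carrier (at A.colim x)" using u by (simp add: iso_def bij_betw_def)
    then obtain k h where h: "S.in_hom h x (a k)" "u = \<xi> x (A.gm k h)" using A.colim_carrier[OF x] by auto
    have "\<zeta> x (\<eta> x u) = zero_mor T (FO x) q"
      using \<beta>_act[OF h(1)] h \<beta>0[of k] q by (simp add: \<theta>_def)
    also have "\<dots> = \<zeta> x \<one>\<^bsub>at D.colim x\<^esub>" using S.mod_hom_one[OF D.colim_module \<zeta>(1) \<zeta>' x] by simp
    finally have eq: "\<zeta> x (\<eta> x u) = \<zeta> x \<one>\<^bsub>at D.colim x\<^esub>" .
    have "\<zeta> x \<in> iso (at D.colim x) (at (RY q) x)" using \<zeta>(2) x by (simp add: mod_iso_def)
    then have "inj_on (\<zeta> x) (carrier (at D.colim x))" by (simp add: iso_def bij_betw_def)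
    moreover have "\<eta> x u \<in> carrier (at D.colim x)" using S.mod_hom_closed[OF \<eta> x u] .
    moreover have "\<one>\<^bsub>at D.colim x\<^esub> \<in> carrier (at D.colim x)"
      using D.germ_zero[OF x, of 0] x by simp
    ultimately show "\<eta> x u = \<one>\<^bsub>at D.colim x\<^esub>" using eq by (simp add: inj_on_eq_iff)
  qed
  then show ?thesis using D.colim_module unfolding Lcat_at_perp_def by blast
qed

abbreviation excellent_at :: "nat \<Rightarrow> nat \<Rightarrow> 'o \<Rightarrow> bool" where
  "excellent_at m n b \<equiv> \<exists>D d G.
        cauchy S M D d \<and> colimY S D d \<in> Scat S M \<inter> Lcat_at_perp S M n \<and>
        type_mor S M m (\<lambda>_. b) (\<lambda>_. Id S b) (yoneda S b) (\<lambda>_ _ h. h)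
          D d (colimY S D d) (\<lambda>k _ h. germ S D d k h) G"

abbreviation triangle_at :: "nat \<Rightarrow> nat \<Rightarrow> 'o \<Rightarrow> bool" where
  "triangle_at m n b \<equiv> \<exists>A C f g h.
       (A, FO b, C, f, g, h) \<in> Tri_in T L' \<and>
       C \<in> S'cat S M T F \<inter> perp_right T (L'at n) \<and> A \<in> L'at m"

end

section \<open>The two characterisations of excellence\<close>

context good_ext
begin

text \<open>
  The cones of the maps \<open>b \<longrightarrow> D (s i)\<close> approximate the third object of a triangle on \<open>F b \<longrightarrow> q\<close>, where
  \<open>q\<close> is the homotopy colimit. Desuspending once gives \<open>A\<close>.
\<close>

lemma triangles_if_excellent:
  assumes "excellent_metric S M"
  shows "\<exists>n>0. \<forall>b \<in> Ob S. triangle_at m n b"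
proof -
  \<comment> \<open>At \<open>m + 1\<close>, since \<open>A\<close> is the desuspension of the object that the cones approximate.\<close>
  obtain n where n: "n > Suc m" and ex: "\<forall>x \<in> Ob S. excellent_at (Suc m) n x"
    using assms[unfolded excellent_metric_def, THEN conjunct2, THEN spec[of _ "Suc m"]] by blast
  have "triangle_at m n b" if b: "b \<in> Ob S" for b
  proof -
    obtain D d G where D: "cauchy S M D d" "colimY S D d \<in> Scat S M \<inter> Lcat_at_perp S M n"
      and G: "type_mor S M (Suc m) (\<lambda>_. b) (\<lambda>_. Id S b) (yoneda S b) (\<lambda>_ _ h. h)
          D d (colimY S D d) (\<lambda>k _ h. germ S D d k h) G"
      using ex b by blast
    interpret D: sequence S D d by (rule cauchy_sequence[OF D(1)])
    obtain r s f where rs: "strict_mono (r :: nat \<Rightarrow> nat)" "strict_mono (s :: nat \<Rightarrow> nat)"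
      and f: "\<forall>i. f i \<in> Mor S b (D (s i)) \<and>
             D.tr (s i) (s (Suc i)) \<star> f i = f (Suc i) \<star> transit S (\<lambda>_. b) (\<lambda>_. Id S b) (r i) (r (Suc i))"
      and N: "\<exists>N. \<forall>i\<ge>N. cone_in S (M (Suc m)) b (D (s i)) (f i)"
      using G unfolding type_mor_def by blast
    obtain N where N: "\<And>i. N \<le> i \<Longrightarrow> cone_in S (M (Suc m)) b (D (s i)) (f i)" using N by blast
    have f_hom: "S.arr (f i)" "S.dm (f i) = b" "S.cd (f i) = D (s i)" for i
      using f b by (simp_all add: S.Mor_iff)
    have f_step: "D.tr (s i) (s (Suc i)) \<star> f i = f (Suc i)" for i
      using f S.transit_const[OF b, of "r i" "r (Suc i)"] monoD[OF strict_mono_mono[OF rs(1)], of i "Suc i"] f_hom by simp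
    obtain q \<kappa> where q: "hocolimF D d q \<kappa>" using hocolimF_exists[OF D(1)] by blast
    note lg = hocolimF_legs[OF D.seq q]
    define \<gamma> where "\<gamma> = \<kappa> (s 0) \<bullet> FM (f 0)"
    have \<gamma>: "\<kappa> (s i) \<bullet> FM (f i) = \<gamma>" for i
    proof (induction i)
      case (Suc i)
      have le: "s i \<le> s (Suc i)" using monoD[OF strict_mono_mono[OF rs(2)], of i "Suc i"] by simp
      have "\<kappa> (s (Suc i)) \<bullet> FM (f (Suc i)) = (\<kappa> (s (Suc i)) \<bullet> FM (D.tr (s i) (s (Suc i)))) \<bullet> FM (f i)"
        using le lg f_hom by (simp add: f_step[symmetric] T.assoc)
      also have "\<kappa> (s (Suc i)) \<bullet> FM (D.tr (s i) (s (Suc i))) = \<kappa> (s i)"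
        by (rule legs_transit[OF D.seq]) (use lg le in auto)
      finally show ?case using Suc by simp
    qed (simp add: \<gamma>_def)
    have \<gamma>_hom: "T.in_hom \<gamma> (FO b) q" using lg f_hom by (simp add: \<gamma>_def)
    obtain A f' h' where tri: "(A, FO b, q, f', \<gamma>, h') \<in> Tri T" using T.tri_fibre[OF \<gamma>_hom] by blast
    note t = T.triD[OF tri]
    note rot = T.tri_rot[OF tri]
    define P where "P i c g h w \<longleftrightarrow> c \<in> M (Suc m) \<and> (b, D (s (N + i)), c, f (N + i), g, h) \<in> Tri S \<and>
       T.in_hom w (FO c) (T.sho A) \<and> w \<bullet> FM g = h' \<bullet> \<kappa> (s (N + i)) \<and>
       T.shm (Id T (FO b)) \<bullet> (\<phi> b \<bullet> FM h) = T.neg (T.shm f') \<bullet> w" for i c g h w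
    have "\<exists>c g h w. P i c g h w" for i
    proof -
      obtain c g h where c: "c \<in> M (Suc m)" "(b, D (s (N + i)), c, f (N + i), g, h) \<in> Tri S"
        using N[of "N + i"] unfolding cone_in_def by auto
      have "\<exists>w \<in> Mor T (FO c) (T.sho A). w \<bullet> FM g = h' \<bullet> \<kappa> (s (N + i)) \<and>
        T.shm (Id T (FO b)) \<bullet> (\<phi> b \<bullet> FM h) = T.neg (T.shm f') \<bullet> w"
      proof (rule T.tri_morphism[OF F_tri[OF c(2)] rot])
        show "Id T (FO b) \<in> Mor T (FO b) (FO b)" using b by (simp add: T.Mor_iff)
        show "\<kappa> (s (N + i)) \<in> Mor T (FO (D (s (N + i)))) q" using lg by (simp add: T.Mor_iff)
        show "\<kappa> (s (N + i)) \<bullet> FM (f (N + i)) = \<gamma> \<bullet> Id T (FO b)" using \<gamma> \<gamma>_hom by simp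
      qed
      then obtain w where w: "w \<in> Mor T (FO c) (T.sho A)" "w \<bullet> FM g = h' \<bullet> \<kappa> (s (N + i))"
        "T.shm (Id T (FO b)) \<bullet> (\<phi> b \<bullet> FM h) = T.neg (T.shm f') \<bullet> w" by blast
      have "T.in_hom w (FO c) (T.sho A)" using w(1) S.M_Ob[OF c(1)] t by (simp add: T.Mor_iff)
      with c w(2,3) have "P i c g h w" unfolding P_def by blast
      then show ?thesis by blast
    qed
    then obtain c g h w where P: "\<And>i. P i (c i) (g i) (h i) (w i)" by metis
    have c: "c i \<in> M (Suc m)" and tric: "(b, D (s (N + i)), c i, f (N + i), g i, h i) \<in> Tri S"
      and w: "T.in_hom (w i) (FO (c i)) (T.sho A)" "w i \<bullet> FM (g i) = h' \<bullet> \<kappa> (s (N + i))"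
        "T.shm (Id T (FO b)) \<bullet> (\<phi> b \<bullet> FM (h i)) = T.neg (T.shm f') \<bullet> w i" for i
      using P[of i] by (simp_all only: P_def)
    have ap: "approx q D \<kappa>" by (rule approx_hocolimF[OF D(1) q])
    have "approx (T.sho A) c w"
      unfolding approx_def
    proof (intro conjI allI)
      show "c i \<in> Ob S" "T.in_hom (w i) (FO (c i)) (T.sho A)" for i using c S.M_Ob w(1) by auto
      fix k
      obtain N1 where N1: "F_bij_from N1 k \<kappa>"
        using ap unfolding approx_def by blast
      obtain N2 where N2: "F_bij_from N2 k (\<lambda>i. T.shm (\<kappa> i))"
        using approx_shift[OF ap] by blast
      have "F_bij x (w i)" if i: "max N1 N2 \<le> i" and x: "x \<in> S.perp k" for i x
      proof -
        have "i \<le> s (N + i)" using strict_mono_imp_increasing[OF rs(2), of "N + i"] by simp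
        then have "F_bij x (\<kappa> (s (N + i)))" "F_bij x (T.shm (\<kappa> (s (N + i))))"
          using N1 N2 i x by auto
        moreover have "F_bij x (Id T (FO b))" "F_bij x (T.shm (Id T (FO b)))"
          using T.bij_on_hom_Id S.perp_Ob[OF x] b by simp_all
        ultimately show ?thesis
          by (intro T.five_lemma[OF F_tri[OF tric[of i]] rot, of "Id T (FO b)" "\<kappa> (s (N + i))" "w i"])
            (use lg \<gamma> \<gamma>_hom w S.perp_Ob[OF x] b in \<open>auto simp: T.bij_on_hom_def\<close>)
      qed
      then show "\<exists>N. F_bij_from N k w" by blast
    qed
    moreover have "generated (T.sho A)" by (rule generated_third[OF rot generated_F[OF b] hocolimF_generated[OF D.seq q]])
    ultimately have "T.sho A \<in> L'at (Suc m)" using approx_L'at c by blast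
    then have A: "A \<in> L'at m" using L'at_unshift t by blast
    have qL: "q \<in> L'" using L'_iff D(1) q by blast
    obtain \<zeta> where \<zeta>: "RY q \<in> Modules S" "\<zeta> \<in> mod_iso S D.colim (RY q)"
      using hocolimF_colimE[OF D(1) q] by metis
    have Cq: "RY q \<in> Ccat S M"
      by (rule Ccat_iso[OF D.colim_module \<zeta>]) (use D(2) in \<open>simp add: Scat_def\<close>)
    have "q \<in> S'cat S M T F \<inter> perp_right T (L'at n)"
      using qL Cq perp_L'at[OF D(1) q _ Cq, of n] D(2) by (simp add: S'cat_def)
    moreover have "(A, FO b, q, f', \<gamma>, h') \<in> Tri_in T L'"
      using tri A L'at_subset F_in_L'[OF b] qL by (auto simp: Tri_in_def)
    ultimately show ?thesis using A by blast
  qed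
  then show ?thesis using n by (intro exI[of _ n]) auto
qed

text \<open>
  The cones \<open>c i\<close> of the maps \<open>a i \<longrightarrow> b\<close> approximate \<open>q\<close>, so a subsequence of them is a Cauchy sequence
  for \<open>q\<close>. The maps \<open>b \<longrightarrow> c i\<close> become compatible with its transition maps because \<open>b\<close> is left orthogonal
  to some \<open>M n\<close>, so that eventually maps from \<open>b\<close> to \<open>c i\<close> are determined by their images in \<open>q\<close>.
\<close>

lemma excellent_if_triangles:
  assumes "\<forall>m>0. \<exists>n>0. \<forall>b \<in> Ob S. triangle_at m n b"
  shows "excellent_metric S M"
  unfolding excellent_metric_def
proof (intro conjI allI)
  show "very_good_metric S M" by (rule S.very_good)
  fix m
  \<comment> \<open>At \<open>m + 1\<close>, since the cones of the maps out of \<open>b\<close> are shifts of the terms of a sequence for \<open>A\<close>.\<close>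
  obtain n0 where n0: "\<forall>b \<in> Ob S. triangle_at (Suc m) n0 b"
    using assms[THEN spec[of _ "Suc m"]] by blast
  \<comment> \<open>Enlarging \<open>n0\<close> beyond \<open>m\<close> is harmless, as the \<open>L'at n\<close> decrease with \<open>n\<close>.\<close>
  define n where "n = max n0 (Suc m)"
  have "excellent_at m n b" if b: "b \<in> Ob S" for b
  proof -
    obtain A q f g h where tri_in: "(A, FO b, q, f, g, h) \<in> Tri_in T L'"
      and q: "q \<in> S'cat S M T F" "q \<in> perp_right T (L'at n0)" and A: "A \<in> L'at (Suc m)"
      using n0 b by blast
    have tri: "(A, FO b, q, f, g, h) \<in> Tri T" and qL: "q \<in> L'" using tri_in by (auto simp: Tri_in_def)
    note t = T.triD[OF tri]
    obtain a d \<mu> where a: "cauchy S M a d" "\<forall>k. a k \<in> M (Suc m)" "hocolimF a d A \<mu>" using A L'at_iff by blast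
    interpret A: sequence S a d by (rule cauchy_sequence[OF a(1)])
    note lg = hocolimF_legs[OF A.seq a(3)]
    define P where "P i c k f' l w \<longleftrightarrow> T.in_hom w (FO c) q \<and> (a i, b, c, k, f', l) \<in> Tri S \<and> FM k = f \<bullet> \<mu> i \<and>
       w \<bullet> FM f' = g \<and> T.shm (\<mu> i) \<bullet> (\<phi> (a i) \<bullet> FM l) = h \<bullet> w" for i c k f' l w
    have "\<exists>c k f' l w. P i c k f' l w" for i
    proof -
      obtain k where k: "S.arr k" "S.dm k = a i" "S.cd k = b" "f \<bullet> \<mu> i = FM k"
        by (rule F_full[of "f \<bullet> \<mu> i" "a i" b]) (use t lg b in auto)
      obtain c f' l where tric: "(a i, b, c, k, f', l) \<in> Tri S"
        using S.tri_cone[of "a i" b k] k b by (auto simp: S.Mor_iff)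
      note tc = S.triD[OF tric]
      have "\<exists>w \<in> Mor T (FO c) q. w \<bullet> FM f' = g \<bullet> Id T (FO b) \<and>
        T.shm (\<mu> i) \<bullet> (\<phi> (a i) \<bullet> FM l) = h \<bullet> w"
      proof (rule T.tri_morphism[OF F_tri[OF tric] tri])
        show "Id T (FO b) \<in> Mor T (FO b) (FO b)" using b by (simp add: T.Mor_iff)
        show "\<mu> i \<in> Mor T (FO (a i)) A" using lg by (simp add: T.Mor_iff)
        show "Id T (FO b) \<bullet> FM k = f \<bullet> \<mu> i" using k by simp
      qed
      then obtain w where "w \<in> Mor T (FO c) q" "w \<bullet> FM f' = g"
        "T.shm (\<mu> i) \<bullet> (\<phi> (a i) \<bullet> FM l) = h \<bullet> w" using t by auto
      then have "P i c k f' l w" using tric k tc t unfolding P_def by (simp add: T.Mor_iff)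
      then show ?thesis by blast
    qed
    then obtain c k f' l w where P: "\<And>i. P i (c i) (k i) (f' i) (l i) (w i)" by metis
    have w: "T.in_hom (w i) (FO (c i)) q" and tric: "(a i, b, c i, k i, f' i, l i) \<in> Tri S"
      and k: "FM (k i) = f \<bullet> \<mu> i" and wf: "w i \<bullet> FM (f' i) = g"
      and wh: "T.shm (\<mu> i) \<bullet> (\<phi> (a i) \<bullet> FM (l i)) = h \<bullet> w i" for i
      using P[of i] by (simp_all only: P_def)
    have ap: "approx A a \<mu>" by (rule approx_hocolimF[OF a(1,3)])
    have bij: "\<exists>N. F_bij_from N n w" for n
    proof -
      obtain N1 where N1: "F_bij_from N1 n \<mu>"
        using ap unfolding approx_def by blast
      obtain N2 where N2: "F_bij_from N2 n (\<lambda>i. T.shm (\<mu> i))"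
        using approx_shift[OF ap] by blast
      have "F_bij x (w i)" if i: "max N1 N2 \<le> i" and x: "x \<in> S.perp n" for i x
      proof -
        have "F_bij x (\<mu> i)" "F_bij x (T.shm (\<mu> i))" using N1 N2 i x by auto
        moreover have "F_bij x (Id T (FO b))" "F_bij x (T.shm (Id T (FO b)))"
          using T.bij_on_hom_Id S.perp_Ob[OF x] b by simp_all
        ultimately show ?thesis
          by (intro T.five_lemma[OF F_tri[OF tric[of i]] tri, of "\<mu> i" "Id T (FO b)" "w i"])
            (use lg t w wf wh k S.perp_Ob[OF x] b in \<open>auto simp: T.bij_on_hom_def\<close>)
      qed
      then show ?thesis by blast
    qed
    obtain n1 where n1: "b \<in> S.perp n1" using S.perp_ex[OF b] by blast
    \<comment> \<open>Dropping the first \<open>N\<close> terms makes maps from \<open>b\<close> into the later ones determined by their images in \<open>q\<close>.\<close>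
    obtain N where N: "F_bij_from N n1 w" using bij by blast
    have "approx q (\<lambda>i. c (N + i)) (\<lambda>i. w (N + i))"
      unfolding approx_def
    proof (intro conjI allI)
      show "c (N + i) \<in> Ob S" "T.in_hom (w (N + i)) (FO (c (N + i))) q" for i
        using S.triD[OF tric[of "N + i"]] w by auto
      fix n
      obtain N1 where "F_bij_from N1 n w" using bij by blast
      then show "\<exists>N1. \<forall>i\<ge>N1. \<forall>x\<in>S.perp n. F_bij x (w (N + i))"
        by (meson trans_le_add2)
    qed
    then obtain r e where r: "strict_mono r" "cauchy S M ((\<lambda>i. c (N + i)) \<circ> r) e"
        "hocolimF ((\<lambda>i. c (N + i)) \<circ> r) e q ((\<lambda>i. w (N + i)) \<circ> r)"
      by (rule approx_subsequence[OF generated_L'[OF qL]]) (rule that)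
    define D where "D = (\<lambda>i. c (N + i)) \<circ> r"
    define \<kappa> where "\<kappa> = (\<lambda>i. w (N + i)) \<circ> r"
    define p where "p i = f' (N + r i)" for i
    have D: "cauchy S M D e" "hocolimF D e q \<kappa>" using r by (simp_all add: D_def \<kappa>_def)
    interpret D: sequence S D e by (rule cauchy_sequence[OF D(1)])
    note lgD = hocolimF_legs[OF D.seq D(2)]
    have p: "S.arr (p i)" "S.dm (p i) = b" "S.cd (p i) = D i" and kp: "\<kappa> i \<bullet> FM (p i) = g" for i
      using S.triD[OF tric[of "N + r i"]] wf by (simp_all add: p_def D_def \<kappa>_def)
    have ep: "e i \<star> p i = p (Suc i)" for i
    proof (rule F_faithful)
      have inj: "T.inj_on_hom (FO b) (\<kappa> (Suc i))" using N n1 by (simp add: \<kappa>_def T.bij_on_hom_def)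
      have eq: "\<kappa> (Suc i) \<bullet> FM (e i \<star> p i) = \<kappa> (Suc i) \<bullet> FM (p (Suc i))"
      proof -
        have "\<kappa> (Suc i) \<bullet> FM (e i \<star> p i) = (\<kappa> (Suc i) \<bullet> FM (e i)) \<bullet> FM (p i)"
          using lgD(1-4) p by (simp add: T.assoc)
        then show ?thesis using lgD(5) kp by simp
      qed
      show "FM (e i \<star> p i) = FM (p (Suc i))"
        by (rule T.inj_on_homD[OF inj _ _ _ eq]) (use lgD(1-4) p in auto)
    qed (use p in simp)
    have cone: "cone_in S (M m) b (D i) (p i)" for i
    proof -
      have "(b, D i, S.sho (a (N + r i)), p i, l (N + r i), S.neg (S.shm (k (N + r i)))) \<in> Tri S"
        using S.tri_rot[OF tric[of "N + r i"]] by (simp add: D_def p_def)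
      moreover have "S.sho (a (N + r i)) \<in> M m" using S.M_shift a(2) by blast
      ultimately show ?thesis unfolding cone_in_def by blast
    qed
    obtain \<zeta> where \<zeta>: "RY q \<in> Modules S" "\<zeta> \<in> mod_iso S D.colim (RY q)"
      using hocolimF_colimE[OF D] by metis
    have "D.colim \<in> Ccat S M"
      by (rule Ccat_iso[OF \<zeta>(1) D.colim_module S.mod_iso_inverse[OF D.colim_module \<zeta>] S'cat_RY[OF q(1)]])
    moreover have "D.colim \<in> Lcat S M"
      using D.colim_module D(1) D.colim_is_colimY unfolding Lcat_def is_colimY_def by blast
    moreover have "q \<in> perp_right T (L'at n)"
      using q(2) L'at_mono[of n0 n] by (auto simp: perp_right_def n_def)
    then have "D.colim \<in> Lcat_at_perp S M n" by (rule Lcat_at_perp_colim[OF D])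
    ultimately have 1: "D.colim \<in> Scat S M \<inter> Lcat_at_perp S M n" by (simp add: Scat_def)
    define G where "G = (\<lambda>x :: 'o. \<lambda>u. D.gm 0 (p 0 \<star> u))"
    have G: "G x u = D.gm i (p i \<star> u)" if u: "S.in_hom u x b" for x u i
    proof (induction i)
      case (Suc i)
      have "D.gm (Suc i) (D.tr i (Suc i) \<star> (p i \<star> u)) = D.gm i (p i \<star> u)"
        by (rule D.germ_push) (use p u in auto)
      moreover have "D.tr i (Suc i) \<star> (p i \<star> u) = (e i \<star> p i) \<star> u"
        unfolding D.tr_step by (rule S.assoc[symmetric]) (use p u in auto)
      ultimately show ?case using Suc ep by simp
    qed (simp add: G_def)
    have Gh: "G \<in> mod_hom S (yoneda S b) D.colim"
      unfolding mod_hom_def mem_Collect_eq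
    proof (intro conjI ballI)
      fix x assume x: "x \<in> Ob S"
      show "G x \<in> hom (at (yoneda S b) x) (at D.colim x)"
      proof (rule homI)
        fix u v assume "u \<in> carrier (at (yoneda S b) x)" "v \<in> carrier (at (yoneda S b) x)"
        then have uv: "S.in_hom u x b" "S.in_hom v x b" using x b by (simp_all add: yoneda_def S.Mor_iff)
        show "G x u \<in> carrier (at D.colim x)" using uv p by (simp add: G_def)
        have "u \<otimes>\<^bsub>at (yoneda S b) x\<^esub> v = S.add u v" using uv by (simp add: yoneda_def S.add_def)
        then show "G x (u \<otimes>\<^bsub>at (yoneda S b) x\<^esub> v) = G x u \<otimes>\<^bsub>at D.colim x\<^esub> G x v"
          using uv p by (simp add: G_def S.cmp_add D.germ_mult)
      qed
    next
      fix x y v u assume "x \<in> Ob S" "y \<in> Ob S" "v \<in> Mor S x y" "u \<in> carrier (at (yoneda S b) y)"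
      then show "G x (act (yoneda S b) v u) = act D.colim v (G y u)"
        using b p by (simp add: yoneda_def G_def S.Mor_iff D.germ_act S.assoc)
    qed
    have "type_mor S M m (\<lambda>_. b) (\<lambda>_. Id S b) (yoneda S b) (\<lambda>_ _ h. h)
          D e D.colim (\<lambda>k _ h. D.gm k h) G"
      unfolding type_mor_def
    proof (intro conjI exI[of _ id] exI[of _ p] allI exI[of _ 0] impI ballI)
      show "cauchy S M (\<lambda>_. b) (\<lambda>_. Id S b)" by (rule S.const_cauchy[OF b])
      show "is_colimY S (\<lambda>_. b) (\<lambda>_. Id S b) (yoneda S b) (\<lambda>_ _ h. h)" by (rule S.const_colimY[OF b])
      show "D.tr (id i) (id (Suc i)) \<star> p i = p (Suc i) \<star> transit S (\<lambda>_. b) (\<lambda>_. Id S b) (id i) (id (Suc i))" for i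
        using ep[of i] p S.transit_const[OF b, of i "Suc i"] by (simp add: D.tr_step)
      show "G x h = D.gm (id i) (p i \<star> h)" if "x \<in> Ob S" "h \<in> Mor S x b" for i x h
        using G[of h x i] that b by (simp add: S.Mor_iff)
    qed (use D Gh p b cone D.colim_is_colimY in \<open>simp_all add: S.Mor_iff strict_mono_def\<close>)
    then show ?thesis using D(1) 1 by blast
  qed
  then show "\<exists>n>m. \<forall>x \<in> Ob S. excellent_at m n x"
    by (intro exI[of _ n]) (simp add: n_def)
qed

end

theorem proposition6p2:
  fixes S :: "('o, 'm, 'x) tricat_scheme"
    and T :: "('p, 'n, 'y) tricat_scheme"
    and M :: "nat \<Rightarrow> 'o set"
    and F :: "('o, 'm, 'p, 'n) fctr"
    and \<phi> :: "'o \<Rightarrow> 'n"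
  assumes "triangulated_category S"
    and "triangulated_category T"
    and "very_good_metric S M"
    and "good_extension S M T F \<phi>"
    and "\<And>i. closed_under_summands S (M i)"
  shows "excellent_metric S M \<longleftrightarrow>
    (\<forall>m>0. \<exists>n>0. \<forall>B \<in> Ob S. \<exists>A C f g h.
       (A, Fo F B, C, f, g, h) \<in> Tri_in T (L'cat S M T F) \<and>
       C \<in> S'cat S M T F \<inter> perp_right T (L'cat_at S M T F n) \<and>
       A \<in> L'cat_at S M T F m)"
proof -
  interpret S: triangulated_category S by (rule assms(1))
  interpret T: triangulated_category T by (rule assms(2))
  interpret good_ext S M T F \<phi>
    by unfold_locales (use assms in auto)
  show ?thesis
  proof
    show "excellent_metric S M \<Longrightarrow> \<forall>m>0. \<exists>n>0. \<forall>B \<in> Ob S. triangle_at m n B"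
      by (intro allI impI) (rule triangles_if_excellent)
  qed (rule excellent_if_triangles)
qed

end
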